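(* Let $m,n\ge 1$ be integers, $N=m+n$, and let $k$ be a positive odd integer. There is a constant $C>0$, depending only on $m,n,k$, such that for every $f\in L^1(\mathbb{R}^{m+n},\,1+|x|^{k+1}+|y|^{\frac{k+1}{2}})$ the solution $u(\cdot,t)=G_t\ast f$ of the Cauchy problem $$u_t=-\Delta_x^2u+\Delta_y u,\quad z=(x,y)\in\mathbb{R}^m\times\mathbb{R}^n,\ t>0,\qquad u(z,0)=f(z),$$ satisfies, for all $t>0$, $$\Big\| u(\cdot,t)-\sum_{|\beta|+2|\gamma|\le k}\frac{(-1)^{|\beta|+|\gamma|}}{\beta!\,\gamma!}\Big(\int_{\mathbb{R}^N}f(x,y)x^\beta y^\gamma\,dx\,dy\Big)D_x^\beta D_y^\gamma G_t\Big\|_{L^1(\mathbb{R}^N)}\le C\,t^{-\frac{k+1}{4}}\,\big\|(1+|x|^{k+1}+|y|^{\frac{k+1}{2}})f\big\|_{L^1(\mathbb{R}^N)},$$ where the sum runs over multi-indices $\beta\in\mathbb{Z}_{\ge0}^m$, $\gamma\in\mathbb{Z}_{\ge0}^n$.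
   Context: Points of $\mathbb{R}^{m+n}$ are written $z=(x,y)$ with $x\in\mathbb{R}^m$, $y\in\mathbb{R}^n$; $\Delta_x,\Delta_y$ are the Laplacians in $x$ and $y$. For a weight $w\ge0$, $L^1(\mathbb{R}^N,w)$ is the space of measurable $f$ with $\int_{\mathbb{R}^N}|f|\,w<\infty$. The fundamental solution is $G_t(x,y)=t^{-\frac m4-\frac n2}G_1\big(\frac{x}{t^{1/4}},\frac{y}{t^{1/2}}\big)$, where $G_1$ is the smooth function whose Fourier transform is $\widehat{G_1}(\xi,\eta)=e^{-|\xi|^4-|\eta|^2}$, the Fourier transform being $\widehat{g}(\xi,\eta)=\int g(x,y)e^{-i(x\cdot\xi+y\cdot\eta)}\,dx\,dy$. The solution with initial datum $f$ is $u(\cdot,t)=G_t\ast f$ (Euclidean convolution). Multi-index notation is standard. *)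

theory Defs
  imports "HOL-Analysis.Analysis"
begin

subsection \<open>Partial derivatives and smoothness\<close>

definition dir_deriv :: "'a::real_normed_vector \<Rightarrow> ('a \<Rightarrow> complex) \<Rightarrow> 'a \<Rightarrow> complex" where
  "dir_deriv v g z = vector_derivative (\<lambda>s. g (z + s *\<^sub>R v)) (at 0)"

text \<open>Being \<open>C\<^sup>\<infinity>\<close> is expressed by (Frechet) differentiability everywhere of all iterated partial
  derivatives. Taking \<open>vs = []\<close> covers \<open>g\<close> itself; differentiability at each stage guarantees
  that the partial derivatives of the next stage exist, and gives the continuity of all of
  them.\<close>

definition smooth :: "('a::euclidean_space \<Rightarrow> complex) \<Rightarrow> bool" where
  "smooth g \<longleftrightarrow> (\<forall>vs \<in> lists Basis. \<forall>z. foldr dir_deriv vs g differentiable (at z))"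

subsection \<open>Multi-indices\<close>

definition mi_abs :: "('i::finite \<Rightarrow> nat) \<Rightarrow> nat" where
  "mi_abs \<alpha> = (\<Sum>i\<in>UNIV. \<alpha> i)"

definition mi_fact :: "('i::finite \<Rightarrow> nat) \<Rightarrow> nat" where
  "mi_fact \<alpha> = (\<Prod>i\<in>UNIV. fact (\<alpha> i))"

definition mi_power :: "real ^ 'i::finite \<Rightarrow> ('i \<Rightarrow> nat) \<Rightarrow> real" where
  "mi_power x \<alpha> = (\<Prod>i\<in>UNIV. (x $ i) ^ \<alpha> i)"

text \<open>An index type carries no canonical order, so a mixed derivative takes the partial
  derivatives in the order of some fixed enumeration of the indices. For smooth functions, the
  only ones to which it is applied, the order is irrelevant.\<close>

definition enum_indices :: "'i::finite list" where
  "enum_indices = (SOME l. distinct l \<and> set l = UNIV)"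

definition D_x :: "('m \<Rightarrow> nat) \<Rightarrow> ((real ^ 'm::finite) \<times> (real ^ 'n::finite) \<Rightarrow> complex)
    \<Rightarrow> (real ^ 'm) \<times> (real ^ 'n) \<Rightarrow> complex" where
  "D_x \<beta> g = foldr (\<lambda>i. dir_deriv (axis i 1, 0) ^^ \<beta> i) enum_indices g"

definition D_y :: "('n \<Rightarrow> nat) \<Rightarrow> ((real ^ 'm::finite) \<times> (real ^ 'n::finite) \<Rightarrow> complex)
    \<Rightarrow> (real ^ 'm) \<times> (real ^ 'n) \<Rightarrow> complex" where
  "D_y \<gamma> g = foldr (\<lambda>j. dir_deriv (0, axis j 1) ^^ \<gamma> j) enum_indices g"

subsection \<open>Weighted Lebesgue spaces, Fourier transform and convolution\<close>

definition weighted_L1 :: "('a::euclidean_space \<Rightarrow> real) \<Rightarrow> ('a \<Rightarrow> complex) set" where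
  "weighted_L1 w =
     {f. f \<in> borel_measurable lebesgue \<and> integrable lebesgue (\<lambda>z. norm (f z) * w z)}"

text \<open>A Bochner integral is \<open>0\<close> when the integrand is not integrable, so \<open>L1_norm\<close> is only
  meaningful for integrable functions.\<close>

definition L1_norm :: "('a::euclidean_space \<Rightarrow> complex) \<Rightarrow> real" where
  "L1_norm g = (LINT z|lebesgue. norm (g z))"

definition fourier :: "('a::euclidean_space \<Rightarrow> complex) \<Rightarrow> 'a \<Rightarrow> complex" where
  "fourier g \<zeta> = (LINT z|lebesgue. g z * exp (- \<i> * complex_of_real (z \<bullet> \<zeta>)))"

definition convolution ::
    "('a::euclidean_space \<Rightarrow> complex) \<Rightarrow> ('a \<Rightarrow> complex) \<Rightarrow> 'a \<Rightarrow> complex" where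
  "convolution g f z = (LINT w|lebesgue. g (z - w) * f w)"

subsection \<open>Fundamental solution\<close>

definition G1 :: "(real ^ 'm::finite) \<times> (real ^ 'n::finite) \<Rightarrow> complex" where
  "G1 = (THE g. smooth g \<and> integrable lebesgue g \<and>
           (\<forall>\<xi> \<eta>. fourier g (\<xi>, \<eta>) = exp (complex_of_real (- (norm \<xi> ^ 4) - norm \<eta> ^ 2))))"

definition G :: "real \<Rightarrow> (real ^ 'm::finite) \<times> (real ^ 'n::finite) \<Rightarrow> complex" where
  "G t = (\<lambda>(x, y). complex_of_real (t powr (- real CARD('m) / 4 - real CARD('n) / 2)) *
           G1 (x /\<^sub>R (t powr (1 / 4)), y /\<^sub>R (t powr (1 / 2))))"

definition sol :: "((real ^ 'm::finite) \<times> (real ^ 'n::finite) \<Rightarrow> complex)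
    \<Rightarrow> (real ^ 'm) \<times> (real ^ 'n) \<Rightarrow> real \<Rightarrow> complex" where
  "sol f z t = convolution (G t) f z"

subsection \<open>Weight, moments and asymptotic expansion\<close>

text \<open>Only used for odd \<open>k\<close>, so that \<open>(k + 1) div 2\<close> is the exact half.\<close>

definition weight :: "nat \<Rightarrow> (real ^ 'm::finite) \<times> (real ^ 'n::finite) \<Rightarrow> real" where
  "weight k = (\<lambda>(x, y). 1 + norm x ^ (k + 1) + norm y ^ ((k + 1) div 2))"

definition moment :: "((real ^ 'm::finite) \<times> (real ^ 'n::finite) \<Rightarrow> complex)
    \<Rightarrow> ('m \<Rightarrow> nat) \<Rightarrow> ('n \<Rightarrow> nat) \<Rightarrow> complex" where
  "moment f \<beta> \<gamma> =
     (LINT z|lebesgue. f z * complex_of_real (mi_power (fst z) \<beta> * mi_power (snd z) \<gamma>))"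

definition expansion :: "nat \<Rightarrow> ((real ^ 'm::finite) \<times> (real ^ 'n::finite) \<Rightarrow> complex)
    \<Rightarrow> (real ^ 'm) \<times> (real ^ 'n) \<Rightarrow> real \<Rightarrow> complex" where
  "expansion k f z t =
     (\<Sum>(\<beta>, \<gamma>) \<in> {(\<beta>, \<gamma>). mi_abs \<beta> + 2 * mi_abs \<gamma> \<le> k}.
        (-1) ^ (mi_abs \<beta> + mi_abs \<gamma>) / of_nat (mi_fact \<beta> * mi_fact \<gamma>) *
        moment f \<beta> \<gamma> * D_x \<beta> (D_y \<gamma> (G t)) z)"

end

theory Submission
  imports Defs "HOL-Probability.Characteristic_Functions" "HOL-Probability.Sinc_Integral"
begin

text \<open>By Fourier inversion \<open>G1\<close> is the transform of \<open>exp (-\<bar>\<xi>\<bar>^4 - \<bar>\<eta>\<bar>^2)\<close> up to a constant, so all its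
  derivatives are transforms of a polynomial times this exponential and are integrable. The
  difference \<open>u - expansion\<close> is the integral of \<open>f w\<close> against the Taylor remainder of \<open>G t (z - w)\<close>
  in \<open>w\<close>. Expanding one coordinate at a time, first in \<open>y\<close> and then in \<open>x\<close>, the remainder
  at \<open>t = 1\<close> has \<open>L\<^sup>1\<close>-norm in \<open>z\<close> at most a constant times \<open>\<bar>x\<bar>^(k+1) + \<bar>y\<bar>^((k+1)/2)\<close> for
  \<open>w = (x, y)\<close>, without any smallness of \<open>w\<close>. Parabolic scaling produces the factor
  \<open>t^(-(k+1)/4)\<close> for general \<open>t\<close>, and Tonelli's theorem gives the claim.\<close>

subsection \<open>Gaussian integrals\<close>

text \<open>\<open>G1\<close> is a definite description, so nothing is known about it before
  existence and uniqueness are settled. Fourier inversion at points of continuity provides both, and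
  continuity makes the uniqueness pointwise. Large \<open>w\<close> do no harm because the L^1 norm
  is translation invariant: the integral form of a Taylor remainder evaluates a derivative at
  shifted points, and the norm does not see the shift. The weights 1 for \<open>x\<close> and 2 for
  \<open>y\<close> come from the symbol |xi|^4 + |eta|^2. For odd \<open>k\<close> the order
  \<open>k + 1\<close> equals \<open>2 * p\<close>, so the y-expansion alone reaches it at the
  integer order \<open>p\<close>, and the mixed terms |x|^(2p-2j) |y|^j are absorbed by |x|^(2p) +
  |y|^p. The datum is only Lebesgue measurable, so the final exchange of integrals takes place over
  \<open>lebesgue \<Otimes>\<^sub>M lebesgue\<close>, while the estimates for the continuous kernel
  live over \<open>lborel\<close>.\<close>

lemma lborel_affine_integrable_iff:
  fixes f :: "'a::euclidean_space \<Rightarrow> 'b::{banach, second_countable_topology}"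
  assumes "c \<noteq> 0" and [measurable]: "f \<in> borel_measurable borel"
  shows "integrable lborel (\<lambda>x. f (a + c *\<^sub>R x)) \<longleftrightarrow> integrable lborel f"
proof -
  have "integrable lborel f \<longleftrightarrow>
      integrable (density (distr lborel borel (\<lambda>x. a + c *\<^sub>R x)) (\<lambda>_. \<bar>c\<bar> ^ DIM('a))) f"
    using lborel_affine[OF assms(1), of a] by (rule arg_cong[of _ _ "\<lambda>M. integrable M f"])
  also have "\<dots> \<longleftrightarrow> integrable lborel (\<lambda>x. \<bar>c\<bar> ^ DIM('a) *\<^sub>R f (a + c *\<^sub>R x))"
    by (subst integrable_density) (auto simp: integrable_distr_eq)
  also have "\<dots> \<longleftrightarrow> integrable lborel (\<lambda>x. f (a + c *\<^sub>R x))"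
    using integrable_scaleR_right[of "\<bar>c\<bar> ^ DIM('a)" lborel "\<lambda>x. f (a + c *\<^sub>R x)"]
      integrable_scaleR_right[of "inverse (\<bar>c\<bar> ^ DIM('a))" lborel
        "\<lambda>x. \<bar>c\<bar> ^ DIM('a) *\<^sub>R f (a + c *\<^sub>R x)"] assms(1)
    by (auto simp del: integrable_scaleR_right)
  finally show ?thesis by simp
qed

lemma lborel_affine_integral:
  fixes f :: "'a::euclidean_space \<Rightarrow> 'b::{banach, second_countable_topology}"
  assumes "c \<noteq> 0" and [measurable]: "f \<in> borel_measurable borel"
  shows "integral\<^sup>L lborel f = \<bar>c\<bar> ^ DIM('a) *\<^sub>R (LINT x|lborel. f (a + c *\<^sub>R x))"
proof -
  have "integral\<^sup>L lborel f =
      integral\<^sup>L (density (distr lborel borel (\<lambda>x. a + c *\<^sub>R x)) (\<lambda>_. \<bar>c\<bar> ^ DIM('a))) f"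
    using lborel_affine[OF assms(1), of a] by (rule arg_cong[of _ _ "\<lambda>M. integral\<^sup>L M f"])
  also have "\<dots> = (LINT x|lborel. \<bar>c\<bar> ^ DIM('a) *\<^sub>R f (a + c *\<^sub>R x))"
    by (subst integral_density) (auto simp: integral_distr)
  finally show ?thesis by simp
qed

text \<open>By \<open>lborel_eq\<close>, \<open>lborel\<close> is the image of the product measure
  indexed by \<open>Basis\<close>, so this is Fubini for products of one-variable functions. It
  serves both the Gaussian and the decay criterion \<open>integrable_lborel_decay\<close>.\<close>

lemma
  fixes f :: "'a::euclidean_space \<Rightarrow> real \<Rightarrow> 'b::{real_normed_field, banach, second_countable_topology}"
  assumes int: "\<And>b. b \<in> Basis \<Longrightarrow> integrable lborel (f b)"
  shows integrable_lborel_prod_Basis: "integrable lborel (\<lambda>z. \<Prod>b\<in>Basis. f b (z \<bullet> b))"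
    and integral_lborel_prod_Basis:
      "(LINT z|lborel. (\<Prod>b\<in>Basis. f b (z \<bullet> b))) = (\<Prod>b\<in>Basis. integral\<^sup>L lborel (f b))"
proof -
  interpret product_sigma_finite "\<lambda>b::'a. lborel :: real measure" ..
  have [measurable]: "f b \<in> borel_measurable borel" if "b \<in> Basis" for b
    using int[OF that] borel_measurable_integrable by fastforce
  have *: "(\<Prod>b\<in>Basis. f b ((\<Sum>b\<in>Basis. x b *\<^sub>R b) \<bullet> b)) = (\<Prod>b\<in>Basis. f b (x b))" for x
    by (intro prod.cong) (auto simp: inner_sum_left inner_Basis if_distrib cong: if_cong)
  have 1: "integrable (\<Pi>\<^sub>M b\<in>Basis. lborel) (\<lambda>x. \<Prod>b\<in>Basis. f b (x b))"
    by (rule product_integrable_prod) (auto intro: int)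
  show "integrable lborel (\<lambda>z. \<Prod>b\<in>Basis. f b (z \<bullet> b))"
    by (subst lborel_eq, subst integrable_distr_eq) (use 1 in \<open>auto simp: *\<close>)
  have "(LINT z|lborel. (\<Prod>b\<in>Basis. f b (z \<bullet> b))) =
      (LINT x|(\<Pi>\<^sub>M b\<in>Basis. lborel). (\<Prod>b\<in>Basis. f b (x b)))"
    by (subst lborel_eq, subst integral_distr) (auto simp: *)
  also have "\<dots> = (\<Prod>b\<in>Basis. integral\<^sup>L lborel (f b))"
    by (rule product_integral_prod) (auto intro: int)
  finally show "(LINT z|lborel. (\<Prod>b\<in>Basis. f b (z \<bullet> b))) = (\<Prod>b\<in>Basis. integral\<^sup>L lborel (f b))" .
qed

text \<open>The width is the one for which the Fourier transform of \<open>gauss\<close> is a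
  multiple of \<open>gauss\<close> itself.\<close>

definition gauss :: "'a::euclidean_space \<Rightarrow> real" where
  "gauss v = exp (- (v \<bullet> v) / 2)"

lemma gauss_measurable [measurable]: "gauss \<in> borel_measurable borel"
  unfolding gauss_def by measurable

lemma continuous_on_gauss [continuous_intros]:
  "continuous_on S f \<Longrightarrow> continuous_on S (\<lambda>x. gauss (f x))"
  unfolding gauss_def by (intro continuous_intros) auto

lemma gauss_zero [simp]: "gauss 0 = 1"
  by (simp add: gauss_def)

lemma gauss_nonneg [simp]: "gauss v \<ge> 0" and gauss_le_1 [simp]: "gauss v \<le> 1"
  by (simp_all add: gauss_def)

text \<open>Up to the factor \<open>sqrt (2 * pi)\<close> the Gaussian is the standard normal
  density, so the value is read off from the characteristic function of the normal
  distribution.\<close>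

lemma
  fixes t :: real
  shows integrable_gauss_iexp: "integrable lborel (\<lambda>x. of_real (exp (- x\<^sup>2 / 2)) * iexp (t * x))"
    and integral_gauss_iexp: "(LINT x|lborel. of_real (exp (- x\<^sup>2 / 2)) * iexp (t * x)) =
      complex_of_real (sqrt (2 * pi) * exp (- t\<^sup>2 / 2))"
proof -
  have *: "exp (- x\<^sup>2 / 2) = sqrt (2 * pi) * std_normal_density x" for x :: real
    by (simp add: std_normal_density_def)
  have "integrable lborel std_normal_density"
    by simp
  hence 0: "integrable lborel (\<lambda>x::real. exp (- x\<^sup>2 / 2))"
    unfolding * by (rule integrable_mult_right)
  show "integrable lborel (\<lambda>x. of_real (exp (- x\<^sup>2 / 2)) * iexp (t * x))"
    by (rule Bochner_Integration.integrable_bound[OF 0]) (auto simp: norm_mult)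
  have "complex_of_real (exp (- t\<^sup>2 / 2)) = char std_normal_distribution t"
    by (simp add: char_std_normal_distribution)
  also have "\<dots> = (LINT x|lborel. std_normal_density x *\<^sub>R iexp (t * x))"
    unfolding char_def
    by (subst integral_density) (auto simp: normal_density_nonneg)
  finally have "complex_of_real (sqrt (2 * pi) * exp (- t\<^sup>2 / 2)) =
      sqrt (2 * pi) * (LINT x|lborel. std_normal_density x *\<^sub>R iexp (t * x))"
    by simp
  also have "\<dots> = (LINT x|lborel. of_real (exp (- x\<^sup>2 / 2)) * iexp (t * x))"
    unfolding * by (subst integral_mult_right_zero[symmetric])
      (simp add: scaleR_conv_of_real mult_ac)
  finally show "(LINT x|lborel. of_real (exp (- x\<^sup>2 / 2)) * iexp (t * x)) =
      complex_of_real (sqrt (2 * pi) * exp (- t\<^sup>2 / 2))" by simp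
qed

lemma gauss_eq_prod: "gauss v = (\<Prod>b\<in>Basis. exp (- (v \<bullet> b)\<^sup>2 / 2))"
proof -
  have "- (v \<bullet> v) / 2 = (\<Sum>b\<in>Basis. - (v \<bullet> b)\<^sup>2 / 2)"
    by (subst euclidean_inner) (simp add: sum_divide_distrib sum_negf power2_eq_square)
  thus ?thesis by (simp add: gauss_def exp_sum)
qed

lemma iexp_inner_eq_prod: "iexp (\<xi> \<bullet> v) = (\<Prod>b\<in>Basis. iexp ((\<xi> \<bullet> b) * (v \<bullet> b)))"
proof -
  have "\<i> * complex_of_real (\<xi> \<bullet> v) = (\<Sum>b\<in>Basis. \<i> * of_real ((\<xi> \<bullet> b) * (v \<bullet> b)))"
    by (subst euclidean_inner) (simp add: sum_distrib_left)
  thus ?thesis by (simp add: exp_sum)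
qed

lemma gauss_iexp_eq_prod:
  "of_real (gauss v) * iexp (\<xi> \<bullet> v) =
    (\<Prod>b\<in>Basis. of_real (exp (- (v \<bullet> b)\<^sup>2 / 2)) * iexp ((\<xi> \<bullet> b) * (v \<bullet> b)))"
  unfolding gauss_eq_prod iexp_inner_eq_prod of_real_prod prod.distrib ..

lemma
  fixes \<xi> :: "'a::euclidean_space"
  shows integrable_gauss_fourier: "integrable lborel (\<lambda>v. of_real (gauss v) * iexp (\<xi> \<bullet> v))"
    and integral_gauss_fourier: "(LINT v|lborel. of_real (gauss v) * iexp (\<xi> \<bullet> v)) =
      complex_of_real (sqrt (2 * pi) ^ DIM('a) * gauss \<xi>)"
proof -
  show "integrable lborel (\<lambda>v. of_real (gauss v) * iexp (\<xi> \<bullet> v))"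
    unfolding gauss_iexp_eq_prod
    by (intro integrable_lborel_prod_Basis integrable_gauss_iexp)
  have "(LINT v|lborel. of_real (gauss v) * iexp (\<xi> \<bullet> v)) =
      (\<Prod>b\<in>Basis. complex_of_real (sqrt (2 * pi) * exp (- (\<xi> \<bullet> b)\<^sup>2 / 2)))"
    unfolding gauss_iexp_eq_prod
    by (subst integral_lborel_prod_Basis[OF integrable_gauss_iexp], subst integral_gauss_iexp) auto
  also have "\<dots> = complex_of_real (sqrt (2 * pi) ^ DIM('a) * gauss \<xi>)"
    by (simp add: gauss_eq_prod prod.distrib)
  finally show "(LINT v|lborel. of_real (gauss v) * iexp (\<xi> \<bullet> v)) =
      complex_of_real (sqrt (2 * pi) ^ DIM('a) * gauss \<xi>)" .
qed

lemma integrable_gauss: "integrable lborel (gauss :: 'a::euclidean_space \<Rightarrow> real)"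
  and integral_gauss: "integral\<^sup>L lborel (gauss :: 'a \<Rightarrow> real) = sqrt (2 * pi) ^ DIM('a)"
proof -
  have 1: "integrable lborel (\<lambda>v::'a. complex_of_real (gauss v))"
    using integrable_gauss_fourier[of "0::'a"] by simp
  thus "integrable lborel (gauss :: 'a::euclidean_space \<Rightarrow> real)"
    by (simp add: complex_of_real_integrable_eq)
  have "complex_of_real (integral\<^sup>L lborel (gauss :: 'a \<Rightarrow> real)) = of_real (sqrt (2 * pi) ^ DIM('a))"
    using integral_gauss_fourier[of "0::'a"] by simp
  thus "integral\<^sup>L lborel (gauss :: 'a \<Rightarrow> real) = sqrt (2 * pi) ^ DIM('a)"
    using of_real_eq_iff by blast
qed

text \<open>Positive sign in the exponent, no normalising factor, and \<open>lborel\<close> in place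
  of \<open>lebesgue\<close>, so that Fubini for product measures applies.
  \<open>fourier_eq_FT\<close> links it to \<open>fourier\<close>, whose sign is opposite.\<close>

definition FT :: "('a::euclidean_space \<Rightarrow> complex) \<Rightarrow> 'a \<Rightarrow> complex" where
  "FT \<psi> z = (LINT \<zeta>|lborel. \<psi> \<zeta> * iexp (z \<bullet> \<zeta>))"

lemma integrable_mult_iexp:
  assumes "integrable lborel \<psi>"
  shows "integrable lborel (\<lambda>\<zeta>. \<psi> \<zeta> * iexp (z \<bullet> \<zeta>))"
  by (rule Bochner_Integration.integrable_bound[OF assms])
    (use assms in \<open>auto simp: norm_mult borel_measurable_integrable\<close>)

section \<open>Gaussian approximate identity\<close>

lemma gauss_scale_le:
  assumes "\<delta> \<le> norm u" "\<delta> \<ge> 0"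
  shows "gauss (c *\<^sub>R u) \<le> exp (- (c\<^sup>2 * \<delta>\<^sup>2) / 2)"
proof -
  have "\<delta>\<^sup>2 \<le> u \<bullet> u"
    unfolding power2_norm_eq_inner[symmetric] using assms by (intro power_mono)
  hence "c\<^sup>2 * \<delta>\<^sup>2 \<le> c\<^sup>2 * (u \<bullet> u)"
    by (intro mult_left_mono) auto
  thus ?thesis by (simp add: gauss_def power2_eq_square mult_ac)
qed

text \<open>This is the supremum bound for the rescaled Gaussian outside the ball of radius
  \<open>\<delta>\<close>. As \<open>Suc n\<close> is at most its square, the decay reduces to that
  of \<open>x ^ d / exp x\<close>.\<close>

lemma power_times_exp_minus_square_tendsto_0:
  assumes "\<delta> > 0"
  shows "(\<lambda>n. real (Suc n) ^ d * exp (- ((real (Suc n))\<^sup>2 * \<delta>\<^sup>2) / 2)) \<longlonglongrightarrow> 0"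
proof -
  define a where "a = \<delta>\<^sup>2 / 2"
  have "a > 0" using assms by (simp add: a_def)
  have "((\<lambda>x. x ^ d / exp x) \<longlongrightarrow> (0::real)) at_top"
    by (rule tendsto_power_div_exp_0)
  moreover have "filterlim (\<lambda>n. a * real (Suc n)) at_top sequentially"
    using \<open>a > 0\<close> by (intro filterlim_tendsto_pos_mult_at_top[OF tendsto_const]
      filterlim_compose[OF filterlim_real_sequentially filterlim_Suc]) auto
  ultimately have "(\<lambda>n. (a * real (Suc n)) ^ d / exp (a * real (Suc n))) \<longlonglongrightarrow> 0"
    by (rule filterlim_compose)
  hence "(\<lambda>n. (1 / a ^ d) * ((a * real (Suc n)) ^ d / exp (a * real (Suc n)))) \<longlonglongrightarrow> (1 / a ^ d) * 0"
    by (intro tendsto_intros)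
  hence lim: "(\<lambda>n. real (Suc n) ^ d * exp (- (a * real (Suc n)))) \<longlonglongrightarrow> 0"
    using \<open>a > 0\<close> by (simp add: power_mult_distrib exp_minus field_simps del: of_nat_Suc)
  show ?thesis
  proof (rule tendsto_sandwich[OF _ _ tendsto_const lim])
    show "\<forall>\<^sub>F n in sequentially. real (Suc n) ^ d * exp (- ((real (Suc n))\<^sup>2 * \<delta>\<^sup>2) / 2)
        \<le> real (Suc n) ^ d * exp (- (a * real (Suc n)))"
    proof (intro always_eventually allI mult_left_mono)
      fix n
      have "a * (real (Suc n) * 1) \<le> a * (real (Suc n) * real (Suc n))"
        using \<open>a > 0\<close> by (intro mult_left_mono) auto
      thus "exp (- ((real (Suc n))\<^sup>2 * \<delta>\<^sup>2) / 2) \<le> exp (- (a * real (Suc n)))"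
        by (simp add: a_def power2_eq_square mult_ac del: of_nat_Suc)
    qed auto
  qed auto
qed

text \<open>Since \<open>h\<close> may be unbounded away from \<open>z\<close>, the integral is
  split at a ball around the origin. Outside, the kernel tends to 0 uniformly and \<open>h\<close>
  is integrable; inside, \<open>h\<close> is bounded and dominated convergence applies after
  rescaling.\<close>

lemma gauss_approximate_identity:
  fixes h :: "'a::euclidean_space \<Rightarrow> complex"
  assumes h: "integrable lborel h" and cont: "isCont h z"
  shows "(\<lambda>n. LINT u|lborel. h (z + u) * of_real (real (Suc n) ^ DIM('a) * gauss (real (Suc n) *\<^sub>R u)))
    \<longlonglongrightarrow> of_real (sqrt (2 * pi) ^ DIM('a)) * h z"
proof -
  have [measurable]: "h \<in> borel_measurable borel"
    using h borel_measurable_integrable by fastforce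
  have hz: "integrable lborel (\<lambda>u. h (z + u))"
    using lborel_affine_integrable_iff[of 1 h z] h by simp
  \<comment> \<open>The radius only has to make \<open>h\<close> bounded near \<open>z\<close>; the
    convergence itself comes later from continuity along the rescaled points.\<close>
  from cont obtain \<delta> where \<delta>: "\<delta> > 0" "\<And>u. norm u < \<delta> \<Longrightarrow> norm (h (z + u)) \<le> norm (h z) + 1"
  proof -
    from cont obtain d where "d > 0" "\<And>x. dist x z < d \<Longrightarrow> dist (h x) (h z) < 1"
      unfolding continuous_at_eps_delta by (metis zero_less_one)
    moreover have "norm (h x) \<le> norm (h z) + 1" if "dist (h x) (h z) < 1" for x
      using that norm_triangle_sub[of "h x" "h z"] by (simp add: dist_norm)
    ultimately show thesis
      by (intro that[of d]) (auto simp: dist_norm)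
  qed
  let ?K = "\<lambda>n u. of_real (real (Suc n) ^ DIM('a) * gauss (real (Suc n) *\<^sub>R u)) :: complex"
  let ?near = "\<lambda>u. h (z + u) * indicator (ball 0 \<delta>) u"
  let ?far = "\<lambda>u. h (z + u) * indicator (- ball 0 \<delta>) u"
  have K_meas [measurable]: "?K n \<in> borel_measurable borel" for n
    by (intro borel_measurable_continuous_onI continuous_intros)
  have [measurable]: "ball 0 \<delta> \<in> sets (borel :: 'a measure)"
    by simp
  have K_le: "norm (?K n u) \<le> real (Suc n) ^ DIM('a)" for n u
    by (simp add: norm_mult norm_power mult_left_le del: of_nat_Suc)
  have intK: "integrable lborel (\<lambda>u. g u * ?K n u)" if "integrable lborel g" for g n
  proof (rule Bochner_Integration.integrable_bound)
    show "integrable lborel (\<lambda>u. real (Suc n) ^ DIM('a) *\<^sub>R g u)"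
      using that by simp
    show "AE u in lborel. norm (g u * ?K n u) \<le> norm (real (Suc n) ^ DIM('a) *\<^sub>R g u)"
      using mult_left_mono[OF K_le norm_ge_zero]
      by (intro AE_I2) (simp add: norm_mult mult_ac norm_power del: of_nat_Suc)
  qed (use that in \<open>auto simp: borel_measurable_integrable\<close>)
  have near_int: "integrable lborel ?near" and far_int: "integrable lborel ?far"
    by (rule Bochner_Integration.integrable_bound[OF hz], measurable, auto split: split_indicator)+

  have "(\<lambda>n. LINT u|lborel. ?far u * ?K n u) \<longlonglongrightarrow> 0"
  proof (rule Lim_null_comparison)
    let ?c = "\<lambda>n. real (Suc n) ^ DIM('a) * exp (- ((real (Suc n))\<^sup>2 * \<delta>\<^sup>2) / 2)"
    show "\<forall>\<^sub>F n in sequentially. norm (LINT u|lborel. ?far u * ?K n u)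
        \<le> (LINT u|lborel. norm (h (z + u))) * ?c n"
    proof (intro always_eventually allI)
      fix n
      have "norm (LINT u|lborel. ?far u * ?K n u) \<le> (LINT u|lborel. norm (h (z + u)) * ?c n)"
      proof (rule Bochner_Integration.integral_norm_bound_integral)
        fix u :: 'a
        show "norm (?far u * ?K n u) \<le> norm (h (z + u)) * ?c n"
          using gauss_scale_le[of \<delta> u "real (Suc n)"] \<delta>(1)
          by (auto split: split_indicator simp: norm_mult norm_power intro!: mult_left_mono simp del: of_nat_Suc)
      qed (use intK[OF far_int] hz in auto)
      thus "norm (LINT u|lborel. ?far u * ?K n u) \<le> (LINT u|lborel. norm (h (z + u))) * ?c n"
        by simp
    qed
    show "(\<lambda>n. (LINT u|lborel. norm (h (z + u))) * ?c n) \<longlonglongrightarrow> 0"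
      using tendsto_mult_left[OF power_times_exp_minus_square_tendsto_0[OF \<delta>(1)]] by simp
  qed
  moreover have "(\<lambda>n. LINT u|lborel. ?near u * ?K n u) \<longlonglongrightarrow> of_real (sqrt (2 * pi) ^ DIM('a)) * h z"
  proof -
    \<comment> \<open>The substitution u = v / (n + 1) cancels the power of n + 1 in the kernel and
      leaves a fixed Gaussian as weight, which then supplies the integrable majorant.\<close>
    have eq: "(LINT u|lborel. ?near u * ?K n u) =
        (LINT v|lborel. ?near (v /\<^sub>R real (Suc n)) * of_real (gauss v))" for n
    proof -
      have "(LINT u|lborel. ?near u * ?K n u) = \<bar>1 / real (Suc n)\<bar> ^ DIM('a) *\<^sub>R
          (LINT v|lborel. ?near (0 + (1 / real (Suc n)) *\<^sub>R v) * ?K n (0 + (1 / real (Suc n)) *\<^sub>R v))"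
        by (rule lborel_affine_integral, simp, measurable)
      also have "\<dots> = (LINT v|lborel. ?near (v /\<^sub>R real (Suc n)) * of_real (gauss v))"
      proof -
        define s where "s = real (Suc n)"
        have "s > 0" by (simp add: s_def)
        have "\<bar>1 / s\<bar> ^ DIM('a) *\<^sub>R (a * of_real (s ^ DIM('a) * gauss (s *\<^sub>R (0 + (1 / s) *\<^sub>R v)))) =
            a * of_real (gauss v)" for a :: complex and v :: 'a
          using \<open>s > 0\<close> by (simp add: scaleR_conv_of_real power_divide)
        thus ?thesis
          unfolding s_def[symmetric]
          by (subst integral_scaleR_right[symmetric]) (simp add: inverse_eq_divide)
      qed
      finally show ?thesis .
    qed
    have lim0: "(\<lambda>n. v /\<^sub>R real (Suc n)) \<longlonglongrightarrow> 0" for v :: 'a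
      using tendsto_scaleR[OF LIMSEQ_inverse_real_of_nat tendsto_const[of v]] by simp
    have "(\<lambda>n. LINT v|lborel. ?near (v /\<^sub>R real (Suc n)) * of_real (gauss v)) \<longlonglongrightarrow>
        (LINT v|lborel. h z * of_real (gauss (v::'a)))"
    proof (rule integral_dominated_convergence[where w = "\<lambda>v. (norm (h z) + 1) * gauss v"])
      show "AE v in lborel. (\<lambda>n. ?near (v /\<^sub>R real (Suc n)) * of_real (gauss v)) \<longlonglongrightarrow> h z * of_real (gauss v)"
      proof (rule AE_I2)
        fix v :: 'a
        have "(\<lambda>n. h (z + v /\<^sub>R real (Suc n))) \<longlonglongrightarrow> h z"
          using tendsto_add[OF tendsto_const[of z] lim0[of v]]
          by (intro isCont_tendsto_compose[OF cont]) simp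
        moreover have "\<forall>\<^sub>F n in sequentially. v /\<^sub>R real (Suc n) \<in> ball 0 \<delta>"
          using lim0[of v] \<delta>(1) by (intro topological_tendstoD) auto
        hence "\<forall>\<^sub>F n in sequentially. h (z + v /\<^sub>R real (Suc n)) = ?near (v /\<^sub>R real (Suc n))"
          by eventually_elim simp
        ultimately have "(\<lambda>n. ?near (v /\<^sub>R real (Suc n))) \<longlonglongrightarrow> h z"
          by (rule Lim_transform_eventually)
        thus "(\<lambda>n. ?near (v /\<^sub>R real (Suc n)) * of_real (gauss v)) \<longlonglongrightarrow> h z * of_real (gauss v)"
          by (intro tendsto_intros)
      qed
      show "AE v in lborel. norm (?near (v /\<^sub>R real (Suc n)) * of_real (gauss v)) \<le> (norm (h z) + 1) * gauss v" for n
        using \<delta>(2) by (intro AE_I2) (auto split: split_indicator simp: norm_mult intro!: mult_right_mono simp del: of_nat_Suc)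
    qed (measurable, measurable, auto intro: integrable_gauss)
    also have "(LINT v|lborel. h z * of_real (gauss (v::'a))) = of_real (sqrt (2 * pi) ^ DIM('a)) * h z"
      using integral_gauss[where 'a='a] by simp
    finally show ?thesis unfolding eq .
  qed
  ultimately have "(\<lambda>n. (LINT u|lborel. ?far u * ?K n u) + (LINT u|lborel. ?near u * ?K n u))
      \<longlonglongrightarrow> 0 + of_real (sqrt (2 * pi) ^ DIM('a)) * h z"
    by (rule tendsto_add)
  moreover have "(LINT u|lborel. ?far u * ?K n u) + (LINT u|lborel. ?near u * ?K n u) =
      (LINT u|lborel. h (z + u) * ?K n u)" for n
    by (subst Bochner_Integration.integral_add[OF intK[OF far_int] intK[OF near_int], symmetric])
      (auto intro!: Bochner_Integration.integral_cong split: split_indicator)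
  ultimately show ?thesis by simp
qed

subsection \<open>Fourier inversion\<close>

text \<open>The transform of a Gaussian of width \<open>s\<close> is the concentrated kernel of
  \<open>gauss_approximate_identity\<close>; this is how the damping in \<open>FT_inversion\<close>
  becomes an approximate identity.\<close>

lemma integral_gauss_scaled_fourier:
  fixes \<xi> :: "'a::euclidean_space"
  assumes "s > 0"
  shows "integrable lborel (\<lambda>\<zeta>. of_real (gauss (\<zeta> /\<^sub>R s)) * iexp (\<xi> \<bullet> \<zeta>))"
    and "(LINT \<zeta>|lborel. of_real (gauss (\<zeta> /\<^sub>R s)) * iexp (\<xi> \<bullet> \<zeta>)) =
      complex_of_real (sqrt (2 * pi) ^ DIM('a) * (s ^ DIM('a) * gauss (s *\<^sub>R \<xi>)))"
proof -
  let ?f = "\<lambda>\<zeta>. of_real (gauss (\<zeta> /\<^sub>R s)) * iexp (\<xi> \<bullet> \<zeta>)"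
  have meas: "?f \<in> borel_measurable borel"
    by (intro borel_measurable_continuous_onI continuous_intros)
  have eq: "?f (0 + s *\<^sub>R v) = of_real (gauss v) * iexp ((s *\<^sub>R \<xi>) \<bullet> v)" for v
    using assms by simp
  show "integrable lborel ?f"
    using lborel_affine_integrable_iff[OF _ meas, of s 0] assms integrable_gauss_fourier[of "s *\<^sub>R \<xi>"]
    unfolding eq by simp
  show "integral\<^sup>L lborel ?f =
      complex_of_real (sqrt (2 * pi) ^ DIM('a) * (s ^ DIM('a) * gauss (s *\<^sub>R \<xi>)))"
    using lborel_affine_integral[OF _ meas, of s 0] assms
    unfolding eq integral_gauss_fourier by (simp add: scaleR_conv_of_real mult_ac)
qed

text \<open>The double integral defining \<open>FT (FT h)\<close> need not converge absolutely.
  Damping the outer integrand by a wide Gaussian permits Fubini, which turns the damped integral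
  into an average of \<open>h\<close> against an approximate identity. Letting the width tend to
  infinity evaluates \<open>A\<close> in two ways.\<close>

theorem FT_inversion:
  fixes h :: "'a::euclidean_space \<Rightarrow> complex"
  assumes h: "integrable lborel h" and Fh: "integrable lborel (FT h)" and cont: "isCont h z"
  shows "FT (FT h) (- z) = of_real ((2 * pi) ^ DIM('a)) * h z"
proof -
  have h_meas [measurable]: "h \<in> borel_measurable borel"
    using h borel_measurable_integrable by fastforce
  define A where "A = (\<lambda>n. LINT \<zeta>|lborel. FT h \<zeta> * iexp (- z \<bullet> \<zeta>) * of_real (gauss (\<zeta> /\<^sub>R real (Suc n))))"
  have "A \<longlonglongrightarrow> (LINT \<zeta>|lborel. FT h \<zeta> * iexp (- z \<bullet> \<zeta>))"
    unfolding A_def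
  proof (rule integral_dominated_convergence[where w = "\<lambda>\<zeta>. norm (FT h \<zeta>)"])
    show "AE \<zeta> in lborel. (\<lambda>n. FT h \<zeta> * iexp (- z \<bullet> \<zeta>) * of_real (gauss (\<zeta> /\<^sub>R real (Suc n))))
        \<longlonglongrightarrow> FT h \<zeta> * iexp (- z \<bullet> \<zeta>)"
    proof (rule AE_I2)
      fix \<zeta> :: 'a
      have "isCont gauss (0::'a)"
        using continuous_on_gauss[of UNIV "\<lambda>x::'a. x"] by (simp add: continuous_on_eq_continuous_at)
      moreover have "(\<lambda>n. \<zeta> /\<^sub>R real (Suc n)) \<longlonglongrightarrow> 0"
        using tendsto_scaleR[OF LIMSEQ_inverse_real_of_nat tendsto_const[of \<zeta>]] by simp
      ultimately have "(\<lambda>n. gauss (\<zeta> /\<^sub>R real (Suc n))) \<longlonglongrightarrow> gauss (0::'a)"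
        by (rule isCont_tendsto_compose)
      hence "(\<lambda>n. FT h \<zeta> * iexp (- z \<bullet> \<zeta>) * of_real (gauss (\<zeta> /\<^sub>R real (Suc n))))
          \<longlonglongrightarrow> FT h \<zeta> * iexp (- z \<bullet> \<zeta>) * of_real (gauss (0::'a))"
        by (intro tendsto_intros)
      thus "(\<lambda>n. FT h \<zeta> * iexp (- z \<bullet> \<zeta>) * of_real (gauss (\<zeta> /\<^sub>R real (Suc n))))
          \<longlonglongrightarrow> FT h \<zeta> * iexp (- z \<bullet> \<zeta>)" by simp
    qed
    show "AE \<zeta> in lborel. norm (FT h \<zeta> * iexp (- z \<bullet> \<zeta>) * of_real (gauss (\<zeta> /\<^sub>R real (Suc n)))) \<le> norm (FT h \<zeta>)" for n
      by (intro AE_I2) (simp add: norm_mult mult_left_le del: of_nat_Suc)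
    show "integrable lborel (\<lambda>\<zeta>. norm (FT h \<zeta>))"
      using Fh by simp
    have [measurable]: "FT h \<in> borel_measurable borel"
      using Fh borel_measurable_integrable by fastforce
    show "(\<lambda>\<zeta>. FT h \<zeta> * iexp (- z \<bullet> \<zeta>)) \<in> borel_measurable lborel" by measurable
    show "(\<lambda>\<zeta>. FT h \<zeta> * iexp (- z \<bullet> \<zeta>) * of_real (gauss (\<zeta> /\<^sub>R real (Suc n)))) \<in> borel_measurable lborel" for n
      by measurable
  qed
  moreover have "A = (\<lambda>n. of_real (sqrt (2 * pi) ^ DIM('a)) *
      (LINT u|lborel. h (z + u) * of_real (real (Suc n) ^ DIM('a) * gauss (real (Suc n) *\<^sub>R u))))"
  proof
    fix n
    define s where "s = real (Suc n)"
    have "s > 0" by (simp add: s_def)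
    define f where "f \<zeta> w = h w * (of_real (gauss (\<zeta> /\<^sub>R s)) * iexp ((w - z) \<bullet> \<zeta>))" for \<zeta> w
    have gauss_int: "integrable lborel (\<lambda>\<zeta>. gauss (\<zeta> /\<^sub>R s :: 'a))"
      using lborel_affine_integrable_iff[of "inverse s" gauss "0::'a"] integrable_gauss \<open>s > 0\<close> by simp
    \<comment> \<open>Here the damping matters: the integrand is dominated by an integrable Gaussian
      in \<open>\<zeta>\<close> times the integrable \<open>norm (h w)\<close>.\<close>
    have int: "integrable (lborel \<Otimes>\<^sub>M lborel) (case_prod f)"
    proof (rule lborel_pair.Fubini_integrable)
      have [measurable]: "(\<lambda>x::'a \<times> 'a. of_real (gauss (fst x /\<^sub>R s)) * iexp ((snd x - z) \<bullet> fst x)) \<in>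
          borel_measurable (borel \<Otimes>\<^sub>M borel)"
        unfolding borel_prod by (intro borel_measurable_continuous_onI continuous_intros)
      show "case_prod f \<in> borel_measurable (lborel \<Otimes>\<^sub>M lborel)"
        unfolding f_def split_beta' by measurable
      have "integrable lborel (\<lambda>\<zeta>::'a. gauss (\<zeta> /\<^sub>R s) * (LINT w|lborel. norm (h w)))"
        using gauss_int by simp
      also have "(\<lambda>\<zeta>::'a. gauss (\<zeta> /\<^sub>R s) * (LINT w|lborel. norm (h w))) =
          (\<lambda>\<zeta>. LINT w|lborel. norm (case_prod f (\<zeta>, w)))"
        by (simp add: f_def norm_mult mult.commute)
      finally show "integrable lborel (\<lambda>\<zeta>. LINT w|lborel. norm (case_prod f (\<zeta>, w)))" .
      have "integrable lborel (f \<zeta>)" for \<zeta>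
        by (rule Bochner_Integration.integrable_bound[OF h])
          (unfold f_def, measurable, auto simp: norm_mult mult_left_le)
      thus "AE \<zeta> in lborel. integrable lborel (\<lambda>w. case_prod f (\<zeta>, w))"
        by simp
    qed
    have "A n = (LINT \<zeta>|lborel. LINT w|lborel. f \<zeta> w)"
      unfolding A_def
    proof (rule Bochner_Integration.integral_cong[OF refl])
      fix \<zeta> :: 'a
      have "FT h \<zeta> * iexp (- z \<bullet> \<zeta>) * of_real (gauss (\<zeta> /\<^sub>R s)) =
          (LINT w|lborel. h w * iexp (\<zeta> \<bullet> w) * (iexp (- z \<bullet> \<zeta>) * of_real (gauss (\<zeta> /\<^sub>R s))))"
        by (simp add: FT_def)
      also have "(\<lambda>w. h w * iexp (\<zeta> \<bullet> w) * (iexp (- z \<bullet> \<zeta>) * of_real (gauss (\<zeta> /\<^sub>R s)))) = f \<zeta>"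
      proof
        fix w
        have "\<i> * complex_of_real ((w - z) \<bullet> \<zeta>) = \<i> * of_real (\<zeta> \<bullet> w) + \<i> * of_real (- z \<bullet> \<zeta>)"
          by (simp add: inner_diff_left inner_commute algebra_simps)
        thus "h w * iexp (\<zeta> \<bullet> w) * (iexp (- z \<bullet> \<zeta>) * of_real (gauss (\<zeta> /\<^sub>R s))) = f \<zeta> w"
          unfolding f_def by (simp only: exp_add mult_ac)
      qed
      finally show "FT h \<zeta> * iexp (- z \<bullet> \<zeta>) * of_real (gauss (\<zeta> /\<^sub>R real (Suc n))) = (LINT w|lborel. f \<zeta> w)"
        unfolding s_def .
    qed
    also have "\<dots> = (LINT w|lborel. LINT \<zeta>|lborel. f \<zeta> w)"
      by (rule lborel_pair.Fubini_integral[OF int, symmetric])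
    also have "\<dots> = (LINT w|lborel. h w * of_real (sqrt (2 * pi) ^ DIM('a) * (s ^ DIM('a) * gauss (s *\<^sub>R (w - z)))))"
      unfolding f_def by (simp add: integral_gauss_scaled_fourier[OF \<open>s > 0\<close>])
    also have "\<dots> = (LINT u|lborel. h (z + u) * of_real (sqrt (2 * pi) ^ DIM('a) * (s ^ DIM('a) * gauss (s *\<^sub>R u))))"
    proof -
      have [measurable]: "(\<lambda>w. complex_of_real (sqrt (2 * pi) ^ DIM('a) * (s ^ DIM('a) * gauss (s *\<^sub>R (w - z))))) \<in> borel_measurable borel"
        by (intro borel_measurable_continuous_onI continuous_intros)
      show ?thesis
        by (subst lborel_affine_integral[of 1 _ z])
          (auto intro!: borel_measurable_times borel_measurable_continuous_onI[of "\<lambda>w. complex_of_real (g w)" for g] continuous_intros)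
    qed
    also have "\<dots> = of_real (sqrt (2 * pi) ^ DIM('a)) * (LINT u|lborel. h (z + u) * of_real (s ^ DIM('a) * gauss (s *\<^sub>R u)))"
      by (subst integral_mult_right_zero[symmetric]) (simp add: mult_ac)
    finally show "A n = of_real (sqrt (2 * pi) ^ DIM('a)) *
      (LINT u|lborel. h (z + u) * of_real (real (Suc n) ^ DIM('a) * gauss (real (Suc n) *\<^sub>R u)))"
      unfolding s_def .
  qed
  hence "A \<longlonglongrightarrow> of_real (sqrt (2 * pi) ^ DIM('a)) * (of_real (sqrt (2 * pi) ^ DIM('a)) * h z)"
    using tendsto_mult_left[OF gauss_approximate_identity[OF h cont]] by simp
  ultimately have "FT (FT h) (- z) = of_real (sqrt (2 * pi) ^ DIM('a)) * (of_real (sqrt (2 * pi) ^ DIM('a)) * h z)"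
    unfolding FT_def[of "FT h"] by (rule LIMSEQ_unique)
  \<comment> \<open>One factor \<open>sqrt (2 * pi) ^ DIM('a)\<close> comes from transforming the
    damping Gaussian, the other from the total mass of \<open>gauss\<close>.\<close>
  also have "\<dots> = of_real ((sqrt (2 * pi) * sqrt (2 * pi)) ^ DIM('a)) * h z"
    by (simp only: power_mult_distrib of_real_mult mult.assoc)
  finally show ?thesis by (simp only: real_sqrt_mult_self) simp
qed

text \<open>Each factor 1 + (z . b)^2 is at most 1 + |z|^2, so the hypothesis bounds
  \<open>g\<close> by \<open>C\<close> times a product of the integrable functions 1 / (1 + x^2),
  one per coordinate.\<close>

lemma integrable_lborel_decay:
  fixes g :: "'a::euclidean_space \<Rightarrow> 'b::{banach, second_countable_topology}"
  assumes [measurable]: "g \<in> borel_measurable borel"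
    and bound: "\<And>z. norm (g z) * (1 + z \<bullet> z) ^ DIM('a) \<le> C"
  shows "integrable lborel g"
proof -
  have "integrable lborel (\<lambda>x::real. inverse (1 + x\<^sup>2))"
    using integrable_inverse_1_plus_square by (simp add: set_integrable_def)
  hence int: "integrable lborel (\<lambda>z::'a. C * (\<Prod>b\<in>Basis. inverse (1 + (z \<bullet> b)\<^sup>2)))"
    by (intro integrable_mult_right integrable_lborel_prod_Basis) auto
  show ?thesis
  proof (rule Bochner_Integration.integrable_bound[OF int])
    show "AE z in lborel. norm (g z) \<le> norm (C * (\<Prod>b\<in>Basis. inverse (1 + (z \<bullet> b)\<^sup>2)))"
    proof (rule AE_I2)
      fix z :: 'a
      have pos: "(\<Prod>b\<in>Basis. 1 + (z \<bullet> b)\<^sup>2) > 0"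
        by (intro prod_pos) (auto intro: add_pos_nonneg)
      have "(\<Prod>b\<in>Basis. 1 + (z \<bullet> b)\<^sup>2) \<le> (\<Prod>b\<in>(Basis::'a set). 1 + z \<bullet> z)"
      proof (intro prod_mono conjI)
        fix b :: 'a assume "b \<in> Basis"
        have "\<bar>z \<bullet> b\<bar>\<^sup>2 \<le> (norm z)\<^sup>2"
          using \<open>b \<in> Basis\<close> by (intro power_mono Basis_le_norm) auto
        thus "1 + (z \<bullet> b)\<^sup>2 \<le> 1 + z \<bullet> z"
          by (simp add: power2_norm_eq_inner)
      qed auto
      hence "norm (g z) * (\<Prod>b\<in>Basis. 1 + (z \<bullet> b)\<^sup>2) \<le> norm (g z) * (1 + z \<bullet> z) ^ DIM('a)"
        by (intro mult_left_mono) auto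
      hence "norm (g z) * (\<Prod>b\<in>Basis. 1 + (z \<bullet> b)\<^sup>2) \<le> C"
        using bound[of z] by linarith
      hence "norm (g z) \<le> C / (\<Prod>b\<in>Basis. 1 + (z \<bullet> b)\<^sup>2)"
        using pos by (simp add: pos_le_divide_eq)
      also have "\<dots> = C * (\<Prod>b\<in>Basis. inverse (1 + (z \<bullet> b)\<^sup>2))"
        using prod_inversef[of "\<lambda>b. 1 + (z \<bullet> b)\<^sup>2" Basis] by (simp add: divide_inverse o_def)
      finally show "norm (g z) \<le> norm (C * (\<Prod>b\<in>Basis. inverse (1 + (z \<bullet> b)\<^sup>2)))"
        by simp
    qed
  qed simp
qed

subsection \<open>Differentiation and integration by parts\<close>

lemma dir_deriv_eq:
  assumes "(g has_derivative D) (at z)"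
  shows "dir_deriv v g z = D v"
proof -
  interpret D: bounded_linear D using assms by (rule has_derivative_bounded_linear)
  have "((\<lambda>s. z + s *\<^sub>R v) has_derivative (\<lambda>s. s *\<^sub>R v)) (at 0)"
    by (auto intro!: derivative_eq_intros)
  hence "((\<lambda>s. g (z + s *\<^sub>R v)) has_derivative (\<lambda>s. D (s *\<^sub>R v))) (at 0)"
    using assms by (auto intro: has_derivative_compose)
  hence "((\<lambda>s. g (z + s *\<^sub>R v)) has_vector_derivative D v) (at 0)"
    by (simp add: has_vector_derivative_def D.scaleR)
  thus ?thesis unfolding dir_deriv_def by (rule vector_derivative_at)
qed

lemma has_vector_derivative_dir_deriv:
  assumes "g differentiable (at (z + s *\<^sub>R v))"
  shows "((\<lambda>s. g (z + s *\<^sub>R v)) has_vector_derivative dir_deriv v g (z + s *\<^sub>R v)) (at s within S)"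
proof -
  from assms obtain D where D: "(g has_derivative D) (at (z + s *\<^sub>R v))"
    by (auto simp: differentiable_def)
  interpret D: bounded_linear D using D by (rule has_derivative_bounded_linear)
  have "((\<lambda>s. z + s *\<^sub>R v) has_derivative (\<lambda>s. s *\<^sub>R v)) (at s within S)"
    by (auto intro!: derivative_eq_intros)
  hence "((\<lambda>s. g (z + s *\<^sub>R v)) has_derivative (\<lambda>s. D (s *\<^sub>R v))) (at s within S)"
    using D by (rule has_derivative_compose)
  thus ?thesis
    unfolding has_vector_derivative_def dir_deriv_eq[OF D] by (simp add: D.scaleR)
qed

lemma norm_FT_le: "norm (FT \<psi> z) \<le> (LINT \<zeta>|lborel. norm (\<psi> \<zeta>))"
proof -
  have "norm (FT \<psi> z) \<le> (LINT \<zeta>|lborel. norm (\<psi> \<zeta> * iexp (z \<bullet> \<zeta>)))"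
    unfolding FT_def by (rule integral_norm_bound)
  thus ?thesis by (simp add: norm_mult)
qed

text \<open>The bound |exp(is) - 1 - is| <= s^2 / 2, integrated against \<open>\<psi>\<close>, makes
  the remainder quadratic in the increment. The second moment controls it and, with integrability of
  \<open>\<psi>\<close>, also the first moment in the derivative.\<close>

lemma FT_has_derivative:
  fixes \<psi> :: "'a::euclidean_space \<Rightarrow> complex"
  assumes \<psi>: "integrable lborel \<psi>" and \<psi>2: "integrable lborel (\<lambda>\<zeta>. (\<zeta> \<bullet> \<zeta>) *\<^sub>R \<psi> \<zeta>)"
  shows "(FT \<psi> has_derivative (\<lambda>v. FT (\<lambda>\<zeta>. \<i> * of_real (v \<bullet> \<zeta>) * \<psi> \<zeta>) z)) (at z)"
proof -
  have [measurable]: "\<psi> \<in> borel_measurable borel"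
    using \<psi> borel_measurable_integrable by fastforce
  have inner_le: "\<bar>v \<bullet> \<zeta>\<bar>\<^sup>2 \<le> (norm v)\<^sup>2 * (\<zeta> \<bullet> \<zeta>)" for v \<zeta> :: 'a
    using Cauchy_Schwarz_ineq[of v \<zeta>] by (simp add: power2_norm_eq_inner)
  have int: "integrable lborel (\<lambda>\<zeta>. \<i> * of_real (v \<bullet> \<zeta>) * \<psi> \<zeta>)" for v
  proof (rule Bochner_Integration.integrable_bound)
    show "integrable lborel (\<lambda>\<zeta>. norm (\<psi> \<zeta>) + (norm v)\<^sup>2 * norm ((\<zeta> \<bullet> \<zeta>) *\<^sub>R \<psi> \<zeta>))"
      using \<psi> \<psi>2 by (intro Bochner_Integration.integrable_add integrable_mult_right integrable_norm)
    show "AE \<zeta> in lborel. norm (\<i> * of_real (v \<bullet> \<zeta>) * \<psi> \<zeta>)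
        \<le> norm (norm (\<psi> \<zeta>) + (norm v)\<^sup>2 * norm ((\<zeta> \<bullet> \<zeta>) *\<^sub>R \<psi> \<zeta>))"
    proof (rule AE_I2)
      fix \<zeta> :: 'a
      have "2 * \<bar>v \<bullet> \<zeta>\<bar> \<le> 1 + \<bar>v \<bullet> \<zeta>\<bar>\<^sup>2"
        using zero_le_power2[of "1 - \<bar>v \<bullet> \<zeta>\<bar>"] by (simp add: power2_eq_square algebra_simps)
      hence "\<bar>v \<bullet> \<zeta>\<bar> \<le> 1 + (norm v)\<^sup>2 * (\<zeta> \<bullet> \<zeta>)"
        using inner_le[of v \<zeta>] by linarith
      hence "\<bar>v \<bullet> \<zeta>\<bar> * norm (\<psi> \<zeta>) \<le> (1 + (norm v)\<^sup>2 * (\<zeta> \<bullet> \<zeta>)) * norm (\<psi> \<zeta>)"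
        by (intro mult_right_mono) auto
      thus "norm (\<i> * of_real (v \<bullet> \<zeta>) * \<psi> \<zeta>)
        \<le> norm (norm (\<psi> \<zeta>) + (norm v)\<^sup>2 * norm ((\<zeta> \<bullet> \<zeta>) *\<^sub>R \<psi> \<zeta>))"
        by (simp add: norm_mult algebra_simps)
    qed
  qed measurable
  let ?D = "\<lambda>v. FT (\<lambda>\<zeta>. \<i> * of_real (v \<bullet> \<zeta>) * \<psi> \<zeta>) z"
  have lin: "linear ?D"
  proof (rule linearI)
    fix v w :: 'a
    show "?D (v + w) = ?D v + ?D w"
      unfolding FT_def
      by (subst Bochner_Integration.integral_add[OF integrable_mult_iexp[OF int] integrable_mult_iexp[OF int], symmetric])
        (simp add: inner_add_left algebra_simps)
    fix r :: real
    show "?D (r *\<^sub>R v) = r *\<^sub>R ?D v"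
      unfolding FT_def
      by (subst integral_scaleR_right[symmetric]) (simp add: scaleR_conv_of_real mult_ac)
  qed
  define K where "K = (LINT \<zeta>|lborel. norm ((\<zeta> \<bullet> \<zeta>) *\<^sub>R \<psi> \<zeta>))"
  have rem: "norm (FT \<psi> (z + v) - FT \<psi> z - ?D v) \<le> (norm v)\<^sup>2 * K" for v
  proof -
    note i1 = integrable_mult_iexp[OF \<psi>, of "z + v"] and i2 = integrable_mult_iexp[OF \<psi>, of z]
      and i3 = integrable_mult_iexp[OF int[of v], of z]
    have "FT \<psi> (z + v) - FT \<psi> z - ?D v =
        (LINT \<zeta>|lborel. \<psi> \<zeta> * iexp ((z + v) \<bullet> \<zeta>) - \<psi> \<zeta> * iexp (z \<bullet> \<zeta>)
          - \<i> * of_real (v \<bullet> \<zeta>) * \<psi> \<zeta> * iexp (z \<bullet> \<zeta>))"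
      unfolding FT_def using i1 i2 i3 by simp
    also have "norm \<dots> \<le> (LINT \<zeta>|lborel. (norm v)\<^sup>2 * norm ((\<zeta> \<bullet> \<zeta>) *\<^sub>R \<psi> \<zeta>))"
    proof (rule Bochner_Integration.integral_norm_bound_integral)
      fix \<zeta> :: 'a
      have "norm (iexp (v \<bullet> \<zeta>) - (1 + \<i> * of_real (v \<bullet> \<zeta>))) \<le> \<bar>v \<bullet> \<zeta>\<bar>\<^sup>2 / 2"
        using iexp_approx1[of "v \<bullet> \<zeta>" 1] by (simp add: power2_eq_square)
      also have "\<dots> \<le> (norm v)\<^sup>2 * (\<zeta> \<bullet> \<zeta>)"
        using inner_le[of v \<zeta>] by (smt (verit) zero_le_power2 field_sum_of_halves)
      finally have *: "norm (iexp (v \<bullet> \<zeta>) - (1 + \<i> * of_real (v \<bullet> \<zeta>))) \<le> (norm v)\<^sup>2 * (\<zeta> \<bullet> \<zeta>)" .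
      have "iexp ((z + v) \<bullet> \<zeta>) = iexp (z \<bullet> \<zeta>) * iexp (v \<bullet> \<zeta>)"
        by (simp add: inner_add_left distrib_left exp_add)
      hence "\<psi> \<zeta> * iexp ((z + v) \<bullet> \<zeta>) - \<psi> \<zeta> * iexp (z \<bullet> \<zeta>) - \<i> * of_real (v \<bullet> \<zeta>) * \<psi> \<zeta> * iexp (z \<bullet> \<zeta>)
          = \<psi> \<zeta> * iexp (z \<bullet> \<zeta>) * (iexp (v \<bullet> \<zeta>) - (1 + \<i> * of_real (v \<bullet> \<zeta>)))"
        by (simp only:) (simp only: algebra_simps mult_1_left mult_1_right)
      also have "norm \<dots> = norm (\<psi> \<zeta>) * norm (iexp (v \<bullet> \<zeta>) - (1 + \<i> * of_real (v \<bullet> \<zeta>)))"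
        by (simp only: norm_mult norm_exp_i_times mult_1_right)
      also have "\<dots> \<le> norm (\<psi> \<zeta>) * ((norm v)\<^sup>2 * (\<zeta> \<bullet> \<zeta>))"
        by (intro mult_left_mono *) auto
      finally show "norm (\<psi> \<zeta> * iexp ((z + v) \<bullet> \<zeta>) - \<psi> \<zeta> * iexp (z \<bullet> \<zeta>)
          - \<i> * of_real (v \<bullet> \<zeta>) * \<psi> \<zeta> * iexp (z \<bullet> \<zeta>)) \<le> (norm v)\<^sup>2 * norm ((\<zeta> \<bullet> \<zeta>) *\<^sub>R \<psi> \<zeta>)"
        by (simp add: mult_ac)
    qed (intro Bochner_Integration.integrable_diff i1 i2 i3 integrable_mult_right integrable_norm \<psi>2)+
    finally show ?thesis by (simp add: K_def)
  qed
  show ?thesis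
  proof (rule has_derivativeI_sandwich[where e = 1 and H = "\<lambda>y. norm (y - z) * K"])
    show "bounded_linear ?D" using lin by (rule linear_conv_bounded_linear[THEN iffD1])
    show "((\<lambda>y. norm (y - z) * K) \<longlongrightarrow> 0) (at z)"
      by (auto intro!: tendsto_eq_intros)
    fix y assume "y \<noteq> z"
    thus "norm (FT \<psi> y - FT \<psi> z - ?D (y - z)) / norm (y - z) \<le> norm (y - z) * K"
      using rem[of "y - z"] by (simp add: divide_simps power2_eq_square mult_ac)
  qed simp
qed

text \<open>Translation invariance gives \<open>\<integral> (f (\<zeta> + e) - f \<zeta>) d\<zeta> = 0\<close>; writing the difference as
  the integral of \<open>f'\<close> over the segment and exchanging integrals gives the claim without any
  decay assumption on \<open>f\<close>.\<close>

lemma integral_directional_derivative_eq_0: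
  fixes f f' :: "'a::euclidean_space \<Rightarrow> complex"
  assumes f: "integrable lborel f" and f': "integrable lborel f'" and cont: "continuous_on UNIV f'"
    and deriv: "\<And>\<zeta>. ((\<lambda>s. f (\<zeta> + s *\<^sub>R e)) has_vector_derivative f' \<zeta>) (at 0)"
  shows "integral\<^sup>L lborel f' = 0"
proof -
  have [measurable]: "f \<in> borel_measurable borel" "f' \<in> borel_measurable borel"
    using f f' borel_measurable_integrable by fastforce+
  have deriv': "((\<lambda>s. f (\<zeta> + s *\<^sub>R e)) has_vector_derivative f' (\<zeta> + s *\<^sub>R e)) (at s within S)" for \<zeta> s S
  proof -
    have "((\<lambda>x. f (\<zeta> + s *\<^sub>R e + x *\<^sub>R e)) \<circ> (\<lambda>x. x - s) has_vector_derivative 1 *\<^sub>R f' (\<zeta> + s *\<^sub>R e)) (at s)"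
      using deriv[of "\<zeta> + s *\<^sub>R e"]
      by (intro vector_diff_chain_at) (auto intro!: derivative_eq_intros simp: has_vector_derivative_def)
    moreover have "(\<lambda>x. f (\<zeta> + s *\<^sub>R e + x *\<^sub>R e)) \<circ> (\<lambda>x. x - s) = (\<lambda>x. f (\<zeta> + x *\<^sub>R e))"
      by (auto simp: fun_eq_iff algebra_simps)
    ultimately show ?thesis by (auto intro: has_vector_derivative_at_within)
  qed
  define F where "F s \<zeta> = indicator {0..1} s *\<^sub>R f' (\<zeta> + s *\<^sub>R e)" for s :: real and \<zeta>
  have trans: "integrable lborel (\<lambda>\<zeta>. g (\<zeta> + a))" "(LINT \<zeta>|lborel. g (\<zeta> + a)) = integral\<^sup>L lborel g"
    if "integrable lborel g" for g :: "'a \<Rightarrow> complex" and a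
    using lborel_affine_integrable_iff[of 1 g a] lborel_affine_integral[of 1 g a] that
      borel_measurable_integrable[OF that] by (auto simp: add.commute)
  have "integrable (lborel \<Otimes>\<^sub>M lborel) (case_prod F)"
  proof (rule lborel_pair.Fubini_integrable)
    show "case_prod F \<in> borel_measurable (lborel \<Otimes>\<^sub>M lborel)"
      unfolding F_def split_beta' by measurable
    have "(LINT \<zeta>|lborel. norm (F s \<zeta>)) = indicator {0..1} s * (LINT \<zeta>|lborel. norm (f' \<zeta>))" for s
    proof -
      have "(LINT \<zeta>|lborel. norm (f' (\<zeta> + s *\<^sub>R e))) = (LINT \<zeta>|lborel. norm (f' \<zeta>))"
        using lborel_affine_integral[of 1 "\<lambda>\<zeta>. norm (f' \<zeta>)" "s *\<^sub>R e"] by (simp add: add.commute)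
      thus ?thesis by (simp add: F_def)
    qed
    thus "integrable lborel (\<lambda>s. LINT \<zeta>|lborel. norm (case_prod F (s, \<zeta>)))"
      by simp
    show "AE s in lborel. integrable lborel (\<lambda>\<zeta>. case_prod F (s, \<zeta>))"
      unfolding F_def using trans(1)[OF f'] by simp
  qed
  hence "(LINT \<zeta>|lborel. LINT s|lborel. F s \<zeta>) = (LINT s|lborel. LINT \<zeta>|lborel. F s \<zeta>)"
    by (rule lborel_pair.Fubini_integral)
  also have "\<dots> = (LINT s|lborel. indicator {0..1} (s::real) *\<^sub>R integral\<^sup>L lborel f')"
    unfolding F_def using trans(2)[OF f'] by simp
  also have "\<dots> = integral\<^sup>L lborel f'"
    by simp
  finally have "integral\<^sup>L lborel f' = (LINT \<zeta>|lborel. LINT s|lborel. F s \<zeta>)" ..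
  also have "(\<lambda>\<zeta>. LINT s|lborel. F s \<zeta>) = (\<lambda>\<zeta>. f (\<zeta> + e) - f \<zeta>)"
  proof
    fix \<zeta>
    have "(LINT s|lborel. F s \<zeta>) = f (\<zeta> + 1 *\<^sub>R e) - f (\<zeta> + 0 *\<^sub>R e)"
      unfolding F_def
      by (rule integral_FTC_atLeastAtMost)
        (auto intro!: deriv' continuous_on_compose2[OF cont] continuous_intros)
    thus "(LINT s|lborel. F s \<zeta>) = f (\<zeta> + e) - f \<zeta>" by simp
  qed
  also have "(LINT \<zeta>|lborel. f (\<zeta> + e) - f \<zeta>) = 0"
    using trans[OF f, of e] f by simp
  finally show ?thesis .
qed

subsection \<open>Fourier transforms of polynomially weighted exponentials\<close>

text \<open>Polynomial functions, generated so that continuity, polynomial growth and polynomiality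
  of derivatives all follow by rule induction. Linear forms in arbitrary directions are generators,
  as differentiating \<open>FT\<close> along \<open>v\<close> multiplies the integrand by such a
  form.\<close>

inductive cpoly :: "('a::euclidean_space \<Rightarrow> complex) \<Rightarrow> bool" where
  const: "cpoly (\<lambda>\<zeta>. c)"
| inner: "cpoly (\<lambda>\<zeta>. of_real (v \<bullet> \<zeta>))"
| add: "cpoly P \<Longrightarrow> cpoly Q \<Longrightarrow> cpoly (\<lambda>\<zeta>. P \<zeta> + Q \<zeta>)"
| mult: "cpoly P \<Longrightarrow> cpoly Q \<Longrightarrow> cpoly (\<lambda>\<zeta>. P \<zeta> * Q \<zeta>)"

lemma cpoly_diff: "cpoly P \<Longrightarrow> cpoly Q \<Longrightarrow> cpoly (\<lambda>\<zeta>. P \<zeta> - Q \<zeta>)"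
  using cpoly.add[OF _ cpoly.mult[OF cpoly.const[of "-1"]], of P Q] by simp

lemma cpoly_sum: "(\<And>i. i \<in> I \<Longrightarrow> cpoly (P i)) \<Longrightarrow> cpoly (\<lambda>\<zeta>. \<Sum>i\<in>I. P i \<zeta>)"
  by (induction I rule: infinite_finite_induct) (auto intro: cpoly.intros)

lemma cpoly_power: "cpoly P \<Longrightarrow> cpoly (\<lambda>\<zeta>. P \<zeta> ^ n)"
  by (induction n) (auto intro: cpoly.intros)

lemma cpoly_inner_self: "cpoly (\<lambda>\<zeta>. of_real (\<zeta> \<bullet> \<zeta>))"
proof -
  have "cpoly (\<lambda>\<zeta>::'a. \<Sum>b\<in>Basis. of_real (b \<bullet> \<zeta>) * of_real (b \<bullet> \<zeta>))"
    by (intro cpoly_sum cpoly.intros)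
  also have "(\<lambda>\<zeta>::'a. \<Sum>b\<in>Basis. of_real (b \<bullet> \<zeta>) * of_real (b \<bullet> \<zeta>)) = (\<lambda>\<zeta>. complex_of_real (\<zeta> \<bullet> \<zeta>))"
    by (rule ext, subst (3) euclidean_inner) (simp add: inner_commute)
  finally show ?thesis .
qed

lemma cpoly_continuous: "cpoly P \<Longrightarrow> continuous_on UNIV P"
  by (induction rule: cpoly.induct) (auto intro!: continuous_intros)

text \<open>Powers of 1 + |zeta|^2 are at least 1 and increase with the exponent, so adding the
  exponents handles sums as well as products.\<close>

lemma cpoly_growth:
  assumes "cpoly P"
  shows "\<exists>C n. 0 \<le> C \<and> (\<forall>\<zeta>. norm (P \<zeta>) \<le> C * (1 + \<zeta> \<bullet> \<zeta>) ^ n)"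
  using assms
proof (induction rule: cpoly.induct)
  case (const c)
  show ?case by (rule exI[of _ "norm c"], rule exI[of _ 0]) auto
next
  case (inner v)
  have "norm (complex_of_real (v \<bullet> \<zeta>)) \<le> norm v * (1 + \<zeta> \<bullet> \<zeta>) ^ 1" for \<zeta>
  proof -
    have "norm \<zeta> \<le> 1 + (norm \<zeta>)\<^sup>2"
      using zero_le_power2[of "1 / 2 - norm \<zeta>"] unfolding power2_diff by (simp add: power_divide)
    hence "norm v * norm \<zeta> \<le> norm v * (1 + (norm \<zeta>)\<^sup>2)"
      by (intro mult_left_mono) auto
    thus ?thesis
      using Cauchy_Schwarz_ineq2[of v \<zeta>] by (simp add: power2_norm_eq_inner)
  qed
  thus ?case by (metis norm_ge_zero)
next
  case (add P Q)
  then obtain C n D m where *: "0 \<le> C" "\<And>\<zeta>. norm (P \<zeta>) \<le> C * (1 + \<zeta> \<bullet> \<zeta>) ^ n"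
    "0 \<le> D" "\<And>\<zeta>. norm (Q \<zeta>) \<le> D * (1 + \<zeta> \<bullet> \<zeta>) ^ m" by blast
  have "norm (P \<zeta> + Q \<zeta>) \<le> (C + D) * (1 + \<zeta> \<bullet> \<zeta>) ^ (n + m)" for \<zeta>
  proof -
    have "norm (P \<zeta> + Q \<zeta>) \<le> C * (1 + \<zeta> \<bullet> \<zeta>) ^ n + D * (1 + \<zeta> \<bullet> \<zeta>) ^ m"
      by (intro norm_triangle_le add_mono *)
    also have "\<dots> \<le> C * (1 + \<zeta> \<bullet> \<zeta>) ^ (n + m) + D * (1 + \<zeta> \<bullet> \<zeta>) ^ (n + m)"
      using * by (intro add_mono mult_left_mono power_increasing) auto
    finally show ?thesis by (simp add: algebra_simps)
  qed
  thus ?case using * by (metis add_nonneg_nonneg)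
next
  case (mult P Q)
  then obtain C n D m where *: "0 \<le> C" "\<And>\<zeta>. norm (P \<zeta>) \<le> C * (1 + \<zeta> \<bullet> \<zeta>) ^ n"
    "0 \<le> D" "\<And>\<zeta>. norm (Q \<zeta>) \<le> D * (1 + \<zeta> \<bullet> \<zeta>) ^ m" by blast
  have "norm (P \<zeta> * Q \<zeta>) \<le> (C * D) * (1 + \<zeta> \<bullet> \<zeta>) ^ (n + m)" for \<zeta>
  proof -
    have "norm (P \<zeta> * Q \<zeta>) \<le> (C * (1 + \<zeta> \<bullet> \<zeta>) ^ n) * (D * (1 + \<zeta> \<bullet> \<zeta>) ^ m)"
      unfolding norm_mult using * by (intro mult_mono) auto
    thus ?thesis by (simp add: power_add mult_ac)
  qed
  thus ?case using * by (metis mult_nonneg_nonneg)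
qed

lemma cpoly_deriv:
  assumes "cpoly P"
  shows "\<exists>P'. cpoly P' \<and> (\<forall>\<zeta>. ((\<lambda>s. P (\<zeta> + s *\<^sub>R e)) has_vector_derivative P' \<zeta>) (at 0))"
  using assms
proof (induction rule: cpoly.induct)
  case (const c)
  show ?case by (rule exI[of _ "\<lambda>_. 0"]) (auto intro: cpoly.intros)
next
  case (inner v)
  have "((\<lambda>s. complex_of_real (v \<bullet> (\<zeta> + s *\<^sub>R e))) has_vector_derivative of_real (v \<bullet> e)) (at 0)" for \<zeta>
    unfolding has_vector_derivative_def
    by (auto intro!: derivative_eq_intros simp: scaleR_conv_of_real)
  thus ?case by (intro exI[of _ "\<lambda>_. of_real (v \<bullet> e)"]) (auto intro: cpoly.intros)
next
  case (add P Q)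
  then obtain P' Q' where *: "cpoly P'" "cpoly Q'"
    "\<And>\<zeta>. ((\<lambda>s. P (\<zeta> + s *\<^sub>R e)) has_vector_derivative P' \<zeta>) (at 0)"
    "\<And>\<zeta>. ((\<lambda>s. Q (\<zeta> + s *\<^sub>R e)) has_vector_derivative Q' \<zeta>) (at 0)" by blast
  show ?case
    by (intro exI[of _ "\<lambda>\<zeta>. P' \<zeta> + Q' \<zeta>"] conjI allI has_vector_derivative_add * cpoly.intros)
next
  case (mult P Q)
  then obtain P' Q' where *: "cpoly P'" "cpoly Q'"
    "\<And>\<zeta>. ((\<lambda>s. P (\<zeta> + s *\<^sub>R e)) has_vector_derivative P' \<zeta>) (at 0)"
    "\<And>\<zeta>. ((\<lambda>s. Q (\<zeta> + s *\<^sub>R e)) has_vector_derivative Q' \<zeta>) (at 0)" by blast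
  have "((\<lambda>s. P (\<zeta> + s *\<^sub>R e) * Q (\<zeta> + s *\<^sub>R e)) has_vector_derivative P \<zeta> * Q' \<zeta> + P' \<zeta> * Q \<zeta>) (at 0)" for \<zeta>
    using has_vector_derivative_mult[OF *(3)[of \<zeta>] *(4)[of \<zeta>]] by simp
  thus ?case
    using * mult by (intro exI[of _ "\<lambda>\<zeta>. P \<zeta> * Q' \<zeta> + P' \<zeta> * Q \<zeta>"]) (auto intro: cpoly.intros)
qed

section \<open>Transforms of a polynomial times exp(-q)\<close>

lemma power_le_fact_mult_exp:
  assumes "(0::real) \<le> x"
  shows "x ^ n \<le> fact n * exp x"
proof -
  have "(\<Sum>k\<in>{n}. x ^ k /\<^sub>R fact k) \<le> (\<Sum>k. x ^ k /\<^sub>R fact k)"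
    using assms summable_exp_generic[of x] by (intro sum_le_suminf) auto
  thus ?thesis by (simp add: exp_def divide_simps mult.commute)
qed

text \<open>The class in which the Taylor argument runs: it is closed under coordinate derivatives,
  and a remainder of order \<open>r\<close> is measured by the L^1 norm of a derivative of order
  \<open>r\<close>.\<close>

definition L1_smooth :: "('a::euclidean_space \<Rightarrow> complex) \<Rightarrow> bool" where
  "L1_smooth g \<longleftrightarrow> (\<forall>vs \<in> lists Basis. (\<forall>z. foldr dir_deriv vs g differentiable (at z)) \<and>
     integrable lborel (foldr dir_deriv vs g))"

lemma L1_smooth_imp_smooth: "L1_smooth g \<Longrightarrow> smooth g"
  by (auto simp: L1_smooth_def smooth_def)

text \<open>A quadratic lower bound already makes exp(-q) decay faster than any power, and it holds
  uniformly in both groups of variables although the actual symbol has different orders in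
  them.\<close>

locale elliptic_symbol =
  fixes q :: "'a::euclidean_space \<Rightarrow> real"
  assumes cpoly_q: "cpoly (\<lambda>\<zeta>. of_real (q \<zeta>))"
    and q_ge: "\<zeta> \<bullet> \<zeta> - 1 \<le> q \<zeta>"
begin

definition E :: "('a \<Rightarrow> complex) \<Rightarrow> 'a \<Rightarrow> complex" where
  "E P \<zeta> = P \<zeta> * exp (- of_real (q \<zeta>))"

lemma continuous_E: "cpoly P \<Longrightarrow> continuous_on UNIV (E P)"
  unfolding E_def by (intro continuous_intros cpoly_continuous cpoly_q)

lemma measurable_E: "cpoly P \<Longrightarrow> E P \<in> borel_measurable borel"
  by (intro borel_measurable_continuous_onI continuous_E)

text \<open>With r = 1 + |zeta|^2 the lower bound reads q >= r - 2, and r^j exp(-r) <= j! absorbs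
  both the growth of \<open>P\<close> and the weight of the decay criterion.\<close>

lemma integrable_E:
  assumes "cpoly P"
  shows "integrable lborel (E P)"
proof -
  from cpoly_growth[OF assms] obtain C n
    where C: "0 \<le> C" "\<And>\<zeta>. norm (P \<zeta>) \<le> C * (1 + \<zeta> \<bullet> \<zeta>) ^ n" by blast
  show ?thesis
  proof (rule integrable_lborel_decay[OF measurable_E[OF assms]])
    fix \<zeta> :: 'a
    define r where "r = 1 + \<zeta> \<bullet> \<zeta>"
    have "r \<ge> 0" by (simp add: r_def)
    let ?k = "n + DIM('a)"
    have "norm (E P \<zeta>) = norm (P \<zeta>) * exp (- q \<zeta>)"
      by (simp add: E_def norm_mult)
    also have "\<dots> \<le> (C * r ^ n) * exp (2 - r)"
      using C(2)[of \<zeta>] q_ge[of \<zeta>] C(1) \<open>r \<ge> 0\<close> unfolding r_def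
      by (intro mult_mono) auto
    finally have "norm (E P \<zeta>) * r ^ DIM('a) \<le> (C * r ^ n) * exp (2 - r) * r ^ DIM('a)"
      using \<open>r \<ge> 0\<close> by (intro mult_right_mono) auto
    also have "\<dots> = C * exp (2 - r) * r ^ ?k"
      by (simp add: power_add mult_ac)
    also have "\<dots> \<le> C * exp (2 - r) * (fact ?k * exp r)"
      using C(1) \<open>r \<ge> 0\<close> by (intro mult_left_mono power_le_fact_mult_exp) auto
    also have "\<dots> = C * exp 2 * fact ?k"
      by (simp add: exp_diff)
    finally show "norm (E P \<zeta>) * (1 + \<zeta> \<bullet> \<zeta>) ^ DIM('a) \<le> C * exp 2 * fact ?k"
      by (simp add: r_def)
  qed
qed

text \<open>The product rule gives the polynomial \<open>P' - P Q'\<close>, where \<open>Q'\<close>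
  is the derivative of \<open>q\<close>: the class of all \<open>E P\<close> is closed under
  differentiation.\<close>

lemma E_deriv:
  assumes "cpoly P"
  shows "\<exists>P'. cpoly P' \<and> (\<forall>\<zeta>. ((\<lambda>s. E P (\<zeta> + s *\<^sub>R e)) has_vector_derivative E P' \<zeta>) (at 0))"
proof -
  from cpoly_deriv[OF assms] obtain P' where P': "cpoly P'"
    "\<And>\<zeta>. ((\<lambda>s. P (\<zeta> + s *\<^sub>R e)) has_vector_derivative P' \<zeta>) (at 0)" by blast
  from cpoly_deriv[OF cpoly_q] obtain Q' where Q': "cpoly Q'"
    "\<And>\<zeta>. ((\<lambda>s. complex_of_real (q (\<zeta> + s *\<^sub>R e))) has_vector_derivative Q' \<zeta>) (at 0)" by blast
  have "((\<lambda>s. E P (\<zeta> + s *\<^sub>R e)) has_vector_derivative E (\<lambda>\<zeta>. P' \<zeta> - P \<zeta> * Q' \<zeta>) \<zeta>) (at 0)" for \<zeta>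
  proof -
    have "((\<lambda>x. exp (- x)) \<circ> (\<lambda>s. complex_of_real (q (\<zeta> + s *\<^sub>R e))) has_vector_derivative
        Q' \<zeta> * (- exp (- complex_of_real (q \<zeta>)))) (at 0)"
      by (rule field_vector_diff_chain_at[OF Q'(2)]) (auto intro!: derivative_eq_intros)
    from has_vector_derivative_mult[OF P'(2) this] show ?thesis
      by (simp add: E_def o_def algebra_simps)
  qed
  thus ?thesis
    using assms P' Q' by (intro exI[of _ "\<lambda>\<zeta>. P' \<zeta> - P \<zeta> * Q' \<zeta>"]) (auto intro!: cpoly.intros cpoly_diff)
qed

text \<open>Integration by parts: the directional derivative of \<open>E P\<close> times the
  exponential has integral zero, so a coordinate factor on the transform side is a derivative of
  \<open>E P\<close>, again of the form \<open>E P'\<close>.\<close>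

lemma FT_E_coordinate:
  assumes "cpoly P"
  shows "\<exists>P'. cpoly P' \<and> (\<forall>z. FT (E P') z = - \<i> * of_real (z \<bullet> e) * FT (E P) z)"
proof -
  from E_deriv[OF assms] obtain P' where P': "cpoly P'"
    "\<And>\<zeta>. ((\<lambda>s. E P (\<zeta> + s *\<^sub>R e)) has_vector_derivative E P' \<zeta>) (at 0)" by blast
  have "FT (E P') z = - \<i> * of_real (z \<bullet> e) * FT (E P) z" for z
  proof -
    note int = integrable_mult_iexp[OF integrable_E[OF assms], of z]
      and int' = integrable_mult_iexp[OF integrable_E[OF P'(1)], of z]
    let ?f' = "\<lambda>\<zeta>. E P' \<zeta> * iexp (z \<bullet> \<zeta>) + \<i> * of_real (z \<bullet> e) * (E P \<zeta> * iexp (z \<bullet> \<zeta>))"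
    have "integral\<^sup>L lborel ?f' = 0"
    proof (rule integral_directional_derivative_eq_0[OF int])
      show "integrable lborel ?f'"
        using int int' by (intro Bochner_Integration.integrable_add integrable_mult_right)
      show "continuous_on UNIV ?f'"
        by (intro continuous_intros continuous_E assms P')
      fix \<zeta>
      have "((\<lambda>x. exp (\<i> * x)) \<circ> (\<lambda>s. complex_of_real (z \<bullet> (\<zeta> + s *\<^sub>R e))) has_vector_derivative
          of_real (z \<bullet> e) * (\<i> * iexp (z \<bullet> \<zeta>))) (at 0)"
        by (rule field_vector_diff_chain_at)
          (auto intro!: derivative_eq_intros simp: has_vector_derivative_def scaleR_conv_of_real)
      from has_vector_derivative_mult[OF P'(2) this]
      show "((\<lambda>s. E P (\<zeta> + s *\<^sub>R e) * iexp (z \<bullet> (\<zeta> + s *\<^sub>R e))) has_vector_derivative ?f' \<zeta>) (at 0)"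
        by (simp add: o_def algebra_simps)
    qed
    moreover have "integral\<^sup>L lborel ?f' = FT (E P') z + \<i> * of_real (z \<bullet> e) * FT (E P) z"
      unfolding FT_def using int int'
      by (subst Bochner_Integration.integral_add) (auto intro!: integrable_mult_right)
    ultimately show ?thesis by (simp add: eq_neg_iff_add_eq_0)
  qed
  thus ?thesis using P'(1) by blast
qed

lemma FT_E_sum:
  assumes "\<And>i. i \<in> I \<Longrightarrow> cpoly (P i)"
  shows "FT (E (\<lambda>\<zeta>. \<Sum>i\<in>I. P i \<zeta>)) z = (\<Sum>i\<in>I. FT (E (P i)) z)"
  unfolding FT_def E_def
  by (subst Bochner_Integration.integral_sum[symmetric])
    (auto simp: sum_distrib_right intro!: integrable_mult_iexp integrable_E[unfolded E_def] assms)

lemma FT_E_diff: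
  assumes "cpoly P" "cpoly Q"
  shows "FT (E (\<lambda>\<zeta>. P \<zeta> - Q \<zeta>)) z = FT (E P) z - FT (E Q) z"
  unfolding FT_def E_def
  by (subst Bochner_Integration.integral_diff[symmetric])
    (auto simp: left_diff_distrib intro!: integrable_mult_iexp integrable_E[unfolded E_def] assms)

text \<open>Two applications of \<open>FT_E_coordinate\<close> in direction \<open>b\<close> give
  the factor (-i)^2 (z . b)^2 = -(z . b)^2. Subtracting these terms over \<open>Basis\<close>
  therefore adds |z|^2.\<close>

lemma FT_E_weight:
  assumes "cpoly P"
  shows "\<exists>P'. cpoly P' \<and> (\<forall>z. FT (E P') z = of_real (1 + z \<bullet> z) * FT (E P) z)"
proof -
  have "\<exists>P2. cpoly P2 \<and> (\<forall>z. FT (E P2) z = - of_real ((z \<bullet> b)\<^sup>2) * FT (E P) z)" for b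
  proof -
    from FT_E_coordinate[OF assms] obtain P1 where P1: "cpoly P1"
      "\<And>z. FT (E P1) z = - \<i> * of_real (z \<bullet> b) * FT (E P) z" by metis
    from FT_E_coordinate[OF P1(1)] obtain P2 where P2: "cpoly P2"
      "\<And>z. FT (E P2) z = - \<i> * of_real (z \<bullet> b) * FT (E P1) z" by metis
    show ?thesis
      by (rule exI[of _ P2]) (simp add: P1 P2 power2_eq_square mult_ac complex_i_mult_minus)
  qed
  then obtain P2 where P2: "\<And>b. cpoly (P2 b)"
    "\<And>b z. FT (E (P2 b)) z = - of_real ((z \<bullet> b)\<^sup>2) * FT (E P) z" by metis
  have "FT (E (\<lambda>\<zeta>. P \<zeta> - (\<Sum>b\<in>Basis. P2 b \<zeta>))) z = of_real (1 + z \<bullet> z) * FT (E P) z" for z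
  proof -
    have "z \<bullet> z = (\<Sum>b\<in>Basis. (z \<bullet> b)\<^sup>2)"
      by (subst euclidean_inner) (simp add: power2_eq_square)
    thus ?thesis
      by (simp add: FT_E_diff FT_E_sum assms P2 cpoly_sum sum_negf algebra_simps sum_distrib_left)
  qed
  thus ?thesis using assms P2 by (blast intro: cpoly_diff cpoly_sum)
qed

lemma FT_E_weight_power:
  assumes "cpoly P"
  shows "\<exists>P'. cpoly P' \<and> (\<forall>z. FT (E P') z = of_real ((1 + z \<bullet> z) ^ n) * FT (E P) z)"
proof (induction n)
  case 0
  show ?case using assms by auto
next
  case (Suc n)
  then obtain P' where P': "cpoly P'" "\<And>z. FT (E P') z = of_real ((1 + z \<bullet> z) ^ n) * FT (E P) z"
    by blast
  from FT_E_weight[OF P'(1)] show ?case by (simp add: P'(2) mult_ac)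
qed

lemma FT_E_has_derivative:
  assumes "cpoly P"
  shows "(FT (E P) has_derivative (\<lambda>v. FT (E (\<lambda>\<zeta>. \<i> * of_real (v \<bullet> \<zeta>) * P \<zeta>)) z)) (at z)"
proof -
  have "(\<lambda>\<zeta>. (\<zeta> \<bullet> \<zeta>) *\<^sub>R E P \<zeta>) = E (\<lambda>\<zeta>. of_real (\<zeta> \<bullet> \<zeta>) * P \<zeta>)"
    by (simp add: E_def fun_eq_iff scaleR_conv_of_real)
  hence "integrable lborel (\<lambda>\<zeta>. (\<zeta> \<bullet> \<zeta>) *\<^sub>R E P \<zeta>)"
    using assms by (simp add: integrable_E cpoly.mult cpoly_inner_self)
  moreover have "(\<lambda>\<zeta>. \<i> * of_real (v \<bullet> \<zeta>) * E P \<zeta>) = E (\<lambda>\<zeta>. \<i> * of_real (v \<bullet> \<zeta>) * P \<zeta>)" for v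
    by (simp add: E_def fun_eq_iff)
  ultimately show ?thesis
    using FT_has_derivative[OF integrable_E[OF assms], of z] by simp
qed

lemma continuous_FT_E: "cpoly P \<Longrightarrow> continuous_on UNIV (FT (E P))"
  by (intro continuous_at_imp_continuous_on ballI has_derivative_continuous[OF FT_E_has_derivative])

text \<open>Multiplied by (1 + |z|^2)^DIM the transform is still the transform of some integrable
  \<open>E P'\<close>, hence bounded, and the decay criterion applies.\<close>

lemma integrable_FT_E:
  assumes "cpoly P"
  shows "integrable lborel (FT (E P))"
proof -
  from FT_E_weight_power[OF assms] obtain P' where P': "cpoly P'"
    "\<And>z. FT (E P') z = of_real ((1 + z \<bullet> z) ^ DIM('a)) * FT (E P) z" by blast
  show ?thesis
  proof (rule integrable_lborel_decay)
    show "FT (E P) \<in> borel_measurable borel"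
      by (intro borel_measurable_continuous_onI continuous_FT_E assms)
    fix z
    have "norm (FT (E P) z) * (1 + z \<bullet> z) ^ DIM('a) = norm (FT (E P') z)"
      unfolding P'(2) norm_mult norm_of_real by simp
    also have "\<dots> \<le> (LINT \<zeta>|lborel. norm (E P' \<zeta>))"
      by (rule norm_FT_le)
    finally show "norm (FT (E P) z) * (1 + z \<bullet> z) ^ DIM('a) \<le> (LINT \<zeta>|lborel. norm (E P' \<zeta>))" .
  qed
qed

text \<open>Differentiation along \<open>v\<close> multiplies the integrand by i (v . zeta), so
  every iterated derivative is again some \<open>FT (E P')\<close>.\<close>

lemma L1_smooth_FT_E:
  assumes "cpoly P"
  shows "L1_smooth (FT (E P))"
proof -
  have *: "\<exists>P'. cpoly P' \<and> foldr dir_deriv vs (FT (E P)) = FT (E P')" for vs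
  proof (induction vs)
    case Nil
    show ?case using assms by auto
  next
    case (Cons v vs)
    then obtain P' where P': "cpoly P'" "foldr dir_deriv vs (FT (E P)) = FT (E P')" by blast
    have "dir_deriv v (FT (E P')) = FT (E (\<lambda>\<zeta>. \<i> * of_real (v \<bullet> \<zeta>) * P' \<zeta>))"
      by (rule ext) (rule dir_deriv_eq[OF FT_E_has_derivative[OF P'(1)]])
    moreover have "cpoly (\<lambda>\<zeta>. \<i> * of_real (v \<bullet> \<zeta>) * P' \<zeta>)"
      by (intro cpoly.mult cpoly.const cpoly.inner P')
    ultimately show ?case
      using P'(2) by auto
  qed
  show ?thesis
    unfolding L1_smooth_def
  proof (intro ballI conjI allI)
    fix vs and z :: 'a
    from * obtain P' where P': "cpoly P'" "foldr dir_deriv vs (FT (E P)) = FT (E P')" by blast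
    show "foldr dir_deriv vs (FT (E P)) differentiable (at z)"
      unfolding P'(2) differentiable_def using FT_E_has_derivative[OF P'(1)] by blast
    show "integrable lborel (foldr dir_deriv vs (FT (E P)))"
      unfolding P'(2) by (rule integrable_FT_E[OF P'(1)])
  qed
qed

end

section \<open>Identification of the kernel \<open>G1\<close>\<close>

lemma smooth_imp_continuous:
  assumes "smooth g"
  shows "continuous_on UNIV g"
proof -
  have "g differentiable (at z)" for z
    using assms unfolding smooth_def by (elim ballE[of _ _ "[]"]) auto
  thus ?thesis
    by (auto intro: continuous_at_imp_continuous_on differentiable_imp_continuous_within)
qed

lemma fourier_eq_FT:
  assumes "g \<in> borel_measurable borel"
  shows "fourier g \<zeta> = FT g (- \<zeta>)"
proof -
  have "(\<lambda>z. g z * exp (- \<i> * complex_of_real (z \<bullet> \<zeta>))) \<in> borel_measurable lborel"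
    using assms by (intro borel_measurable_times borel_measurable_continuous_onI
      [of "\<lambda>z. exp (- \<i> * complex_of_real (z \<bullet> \<zeta>))"] continuous_intros) auto
  thus ?thesis
    by (simp add: fourier_def FT_def integral_completion inner_commute)
qed

text \<open>Even powers of the norm are polynomials in the coordinates, and expanding (1/2 -
  |xi|^2)^2 >= 0 yields |xi|^2 <= 1 + |xi|^4.\<close>

lemma elliptic_symbol_quartic_quadratic:
  "elliptic_symbol (\<lambda>(\<xi>::'a::euclidean_space, \<eta>::'b::euclidean_space). norm \<xi> ^ 4 + norm \<eta> ^ 2)"
proof
  have "cpoly (\<lambda>\<zeta>::'a \<times> 'b. (\<Sum>b\<in>Basis. of_real ((b, 0) \<bullet> \<zeta>) ^ 2) ^ 2 + (\<Sum>b\<in>Basis. of_real ((0, b) \<bullet> \<zeta>) ^ 2))"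
    by (intro cpoly_power cpoly_sum cpoly.intros)
  also have "(\<lambda>\<zeta>::'a \<times> 'b. (\<Sum>b\<in>Basis. of_real ((b, 0) \<bullet> \<zeta>) ^ 2) ^ 2 + (\<Sum>b\<in>Basis. of_real ((0, b) \<bullet> \<zeta>) ^ 2)) =
      (\<lambda>\<zeta>. complex_of_real (case \<zeta> of (\<xi>, \<eta>) \<Rightarrow> norm \<xi> ^ 4 + norm \<eta> ^ 2))"
  proof
    fix \<zeta> :: "'a \<times> 'b"
    have *: "(\<Sum>b\<in>Basis. complex_of_real (b \<bullet> v) ^ 2) = of_real (norm v ^ 2)" for v :: "'c::euclidean_space"
      unfolding power2_norm_eq_inner
      by (subst euclidean_inner) (simp add: power2_eq_square inner_commute)
    show "(\<Sum>b\<in>Basis. of_real ((b, 0) \<bullet> \<zeta>) ^ 2) ^ 2 + (\<Sum>b\<in>Basis. of_real ((0, b) \<bullet> \<zeta>) ^ 2) =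
        complex_of_real (case \<zeta> of (\<xi>, \<eta>) \<Rightarrow> norm \<xi> ^ 4 + norm \<eta> ^ 2)"
      unfolding inner_prod_def fst_conv snd_conv inner_zero_left add_0_left add_0_right *
      by (simp add: split_beta power_mult[symmetric])
  qed
  finally show "cpoly (\<lambda>\<zeta>::'a \<times> 'b. of_real (case \<zeta> of (\<xi>, \<eta>) \<Rightarrow> norm \<xi> ^ 4 + norm \<eta> ^ 2))" .
next
  fix \<zeta> :: "'a \<times> 'b"
  have "norm (fst \<zeta>) ^ 2 \<le> 1 + norm (fst \<zeta>) ^ 4"
    using zero_le_power2[of "1 / 2 - norm (fst \<zeta>) ^ 2"] unfolding power2_diff
    by (simp add: power_divide power_mult[symmetric])
  thus "\<zeta> \<bullet> \<zeta> - 1 \<le> (case \<zeta> of (\<xi>, \<eta>) \<Rightarrow> norm \<xi> ^ 4 + norm \<eta> ^ 2)"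
    by (simp add: split_beta' inner_prod_def power2_norm_eq_inner)
qed

text \<open>Inversion recovers both functions from the common transform; continuity upgrades this to
  equality at every point, as the definite description of \<open>G1\<close> demands.\<close>

lemma FT_injective:
  fixes g h :: "'a::euclidean_space \<Rightarrow> complex"
  assumes "integrable lborel g" "continuous_on UNIV g" "integrable lborel h" "continuous_on UNIV h"
    and FT: "FT g = FT h" "integrable lborel (FT h)"
  shows "g = h"
proof
  fix z
  have "of_real ((2 * pi) ^ DIM('a)) * g z = FT (FT g) (- z)"
    by (rule FT_inversion[symmetric]) (use assms in \<open>auto simp: continuous_on_eq_continuous_at\<close>)
  also have "\<dots> = of_real ((2 * pi) ^ DIM('a)) * h z"
    unfolding FT(1) by (rule FT_inversion) (use assms in \<open>auto simp: continuous_on_eq_continuous_at\<close>)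
  finally show "g z = h z" by simp
qed

text \<open>Any property of \<open>G1\<close> presupposes that its description has exactly one
  solution. The candidate \<open>g\<close> is an explicit transform, and \<open>FT_injective\<close>
  excludes all others; regularity and boundedness are then those of \<open>g\<close>.\<close>

lemma
  shows L1_smooth_G1: "L1_smooth (G1 :: (real ^ 'm::finite) \<times> (real ^ 'n::finite) \<Rightarrow> complex)"
    and G1_bounded: "\<exists>B. \<forall>z :: (real ^ 'm) \<times> (real ^ 'n). norm (G1 z) \<le> B"
proof -
  interpret elliptic_symbol "\<lambda>(\<xi>::real ^ 'm, \<eta>::real ^ 'n). norm \<xi> ^ 4 + norm \<eta> ^ 2"
    by (rule elliptic_symbol_quartic_quadratic)
  define c where "c = complex_of_real ((2 * pi) ^ DIM((real ^ 'm) \<times> (real ^ 'n)))"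
  have "c \<noteq> 0" by (simp add: c_def)
  \<comment> \<open>\<open>c\<close> is the factor produced by \<open>FT_inversion\<close>; dividing
    the symbol by it in advance makes \<open>fourier g\<close> exactly the prescribed
    exponential.\<close>
  define g where "g = FT (E (\<lambda>_. 1 / c))"
  have E_eq: "E (\<lambda>_. 1) (\<xi>, \<eta>) = exp (complex_of_real (- (norm \<xi> ^ 4) - norm \<eta> ^ 2))" for \<xi> \<eta>
    by (simp add: E_def)
  have L1: "L1_smooth g" and int: "integrable lborel g" and cont: "continuous_on UNIV g"
    unfolding g_def by (intro L1_smooth_FT_E integrable_FT_E continuous_FT_E cpoly.const)+
  have fourier_g: "fourier g (\<xi>, \<eta>) = exp (complex_of_real (- (norm \<xi> ^ 4) - norm \<eta> ^ 2))" for \<xi> \<eta>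
  proof -
    have "fourier g (\<xi>, \<eta>) = FT g (- (\<xi>, \<eta>))"
      by (intro fourier_eq_FT borel_measurable_continuous_onI cont)
    also have "\<dots> = c * E (\<lambda>_. 1 / c) (\<xi>, \<eta>)"
      unfolding g_def c_def
      by (intro FT_inversion integrable_E integrable_FT_E cpoly.const)
        (use continuous_E[OF cpoly.const] in \<open>auto simp: continuous_on_eq_continuous_at\<close>)
    finally show ?thesis using \<open>c \<noteq> 0\<close> by (simp add: E_def)
  qed
  \<comment> \<open>The symbol is even, so passing from \<open>fourier\<close> to \<open>FT\<close>,
    a reflection of the argument, leaves it unchanged.\<close>
  have FT_eq: "FT h = E (\<lambda>_. 1)" if "continuous_on UNIV h"
    "\<And>\<xi> \<eta>. fourier h (\<xi>, \<eta>) = exp (complex_of_real (- (norm \<xi> ^ 4) - norm \<eta> ^ 2))" for h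
  proof
    fix \<zeta> :: "(real ^ 'm) \<times> (real ^ 'n)"
    have "FT h \<zeta> = fourier h (- fst \<zeta>, - snd \<zeta>)"
      using that(1) by (simp add: fourier_eq_FT borel_measurable_continuous_onI uminus_prod_def)
    also have "\<dots> = E (\<lambda>_. 1) (fst \<zeta>, snd \<zeta>)"
      unfolding E_eq that(2) by simp
    finally show "FT h \<zeta> = E (\<lambda>_. 1) \<zeta>" by simp
  qed
  have "h = g" if h: "smooth h" "integrable lebesgue h"
    "\<forall>\<xi> \<eta>. fourier h (\<xi>, \<eta>) = exp (complex_of_real (- (norm \<xi> ^ 4) - norm \<eta> ^ 2))" for h
  proof (rule FT_injective)
    show cont_h: "continuous_on UNIV h" using h(1) by (rule smooth_imp_continuous)
    show "integrable lborel h"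
      using h(2) cont_h by (simp add: integrable_completion borel_measurable_continuous_onI)
    show "FT h = FT g" "integrable lborel (FT g)"
      using FT_eq[OF cont_h] FT_eq[OF cont fourier_g] h(3) integrable_E[OF cpoly.const] by auto
  qed (fact int cont)+
  hence "G1 = g"
    unfolding G1_def using L1 int cont fourier_g
    by (intro the_equality) (auto intro: L1_smooth_imp_smooth simp: integrable_completion borel_measurable_continuous_onI)
  thus "L1_smooth (G1 :: (real ^ 'm) \<times> (real ^ 'n) \<Rightarrow> complex)"
    using L1 by simp
  show "\<exists>B. \<forall>z :: (real ^ 'm) \<times> (real ^ 'n). norm (G1 z) \<le> B"
    unfolding \<open>G1 = g\<close> g_def using norm_FT_le by blast
qed

subsection \<open>Taylor expansion in the integral norm\<close>

lemma L1_smoothD: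
  assumes "L1_smooth g"
  shows "g differentiable (at z)" "continuous_on UNIV g" "g \<in> borel_measurable borel" "integrable lborel g"
proof -
  show diff: "g differentiable (at z)" for z
    using assms unfolding L1_smooth_def by (elim ballE[of _ _ "[]"]) auto
  show cont: "continuous_on UNIV g"
    using assms by (intro smooth_imp_continuous L1_smooth_imp_smooth)
  show "g \<in> borel_measurable borel"
    by (rule borel_measurable_continuous_onI[OF cont])
  show "integrable lborel g"
    using assms unfolding L1_smooth_def by (elim ballE[of _ _ "[]"]) auto
qed

lemma L1_smooth_dir_deriv:
  assumes "L1_smooth g" "e \<in> Basis"
  shows "L1_smooth (dir_deriv e g)"
  unfolding L1_smooth_def
proof (rule ballI)
  fix vs :: "'a list" assume "vs \<in> lists Basis"
  hence "vs @ [e] \<in> lists Basis" using assms(2) by auto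
  thus "(\<forall>z. foldr dir_deriv vs (dir_deriv e g) differentiable at z) \<and>
      integrable lborel (foldr dir_deriv vs (dir_deriv e g))"
    using assms(1) unfolding L1_smooth_def by (elim ballE[of _ _ "vs @ [e]"]) auto
qed

lemma L1_smooth_funpow: "L1_smooth g \<Longrightarrow> e \<in> Basis \<Longrightarrow> L1_smooth ((dir_deriv e ^^ n) g)"
  by (induction n) (auto intro: L1_smooth_dir_deriv)

lemma L1_smooth_foldr:
  "L1_smooth g \<Longrightarrow> (\<And>i. i \<in> set L \<Longrightarrow> b i \<in> Basis) \<Longrightarrow>
    L1_smooth (foldr (\<lambda>i. dir_deriv (b i) ^^ \<alpha> i) L g)"
  by (induction L) (auto intro: L1_smooth_funpow)

section \<open>Taylor remainder in one coordinate direction\<close>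

lemma nn_integral_lborel_diff:
  fixes f :: "'a::euclidean_space \<Rightarrow> ennreal"
  assumes [measurable]: "f \<in> borel_measurable borel"
  shows "(\<integral>\<^sup>+z. f (z - a) \<partial>lborel) = (\<integral>\<^sup>+z. f z \<partial>lborel)"
proof -
  have "(\<integral>\<^sup>+z. f z \<partial>lborel) = (\<integral>\<^sup>+z. f z \<partial>distr lborel borel ((+) (- a)))"
    by (simp add: lborel_distr_plus)
  also have "\<dots> = (\<integral>\<^sup>+z. f (z - a) \<partial>lborel)"
    by (subst nn_integral_distr) auto
  finally show ?thesis ..
qed

text \<open>The shift is by -c e because the kernel is evaluated at \<open>z - w\<close>. Only terms
  of order below \<open>r\<close> are subtracted, so \<open>r = 0\<close> gives the bare translate,
  the base case of the induction.\<close>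

definition taylor_rem :: "'a::euclidean_space \<Rightarrow> nat \<Rightarrow> ('a \<Rightarrow> complex) \<Rightarrow> real \<Rightarrow> 'a \<Rightarrow> complex" where
  "taylor_rem e r g c z =
     g (z - c *\<^sub>R e) - (\<Sum>j<r. of_real ((- c) ^ j / fact j) * (dir_deriv e ^^ j) g z)"

lemma continuous_taylor_rem:
  assumes "L1_smooth g" "e \<in> Basis"
  shows "continuous_on UNIV (\<lambda>x. taylor_rem e r g (fst x) (snd x))"
  unfolding taylor_rem_def
  by (intro continuous_intros continuous_on_compose2[OF L1_smoothD(2)[OF assms(1)]]
      continuous_on_compose2[OF L1_smoothD(2)[OF L1_smooth_funpow[OF assms]]]) auto

text \<open>Differentiating in the shift lowers the order by one and replaces \<open>g\<close> by
  its derivative: the zeroth Taylor term is constant and the others move down one index. This is the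
  recursion behind \<open>nn_integral_taylor_rem\<close>.\<close>

lemma taylor_rem_has_vector_derivative:
  assumes "L1_smooth g" "e \<in> Basis"
  shows "((\<lambda>s. taylor_rem e (Suc r) g (s * c) z) has_vector_derivative
    - of_real c * taylor_rem e r (dir_deriv e g) (s * c) z) (at s within S)"
proof -
  have 1: "((\<lambda>s. g (z - (s * c) *\<^sub>R e)) has_vector_derivative
      - of_real c * dir_deriv e g (z - (s * c) *\<^sub>R e)) (at s within S)"
  proof -
    have "((\<lambda>s. g (z + s *\<^sub>R e)) \<circ> (\<lambda>s. - c * s) has_vector_derivative
        (- c) *\<^sub>R dir_deriv e g (z + (- c * s) *\<^sub>R e)) (at s within S)"
    proof (rule vector_diff_chain_within)
      show "((\<lambda>s. - c * s) has_vector_derivative - c) (at s within S)"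
        by (auto intro!: derivative_eq_intros simp: has_vector_derivative_def)
    qed (rule has_vector_derivative_dir_deriv[OF L1_smoothD(1)[OF assms(1)]])
    thus ?thesis
      by (simp add: o_def scaleR_conv_of_real mult.commute)
  qed
  have 2: "((\<lambda>s. of_real ((- (s * c)) ^ Suc j / fact (Suc j)) * (dir_deriv e ^^ Suc j) g z) has_vector_derivative
      - of_real c * (of_real ((- (s * c)) ^ j / fact j) * (dir_deriv e ^^ j) (dir_deriv e g) z)) (at s within S)" for j
  proof -
    have "((\<lambda>s. (- (s * c)) ^ Suc j / fact (Suc j)) has_real_derivative
        (real (Suc j) * (- (s * c)) ^ j * (- c)) / fact (Suc j)) (at s within S)"
      by (auto intro!: derivative_eq_intros simp del: power_Suc fact_Suc)
    also have "(real (Suc j) * (- (s * c)) ^ j * (- c)) / fact (Suc j) = - c * ((- (s * c)) ^ j / fact j)"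
      by (simp del: of_nat_Suc)
    finally have "((\<lambda>s. complex_of_real ((- (s * c)) ^ Suc j / fact (Suc j))) has_vector_derivative
        of_real (- c * ((- (s * c)) ^ j / fact j))) (at s within S)"
      by (intro has_vector_derivative_of_real) (simp add: has_real_derivative_iff_has_vector_derivative)
    from has_vector_derivative_mult_left[OF this, of "(dir_deriv e ^^ Suc j) g z"]
    show ?thesis by (simp add: funpow_swap1 mult_ac del: power_Suc fact_Suc)
  qed
  have "((\<lambda>s. g (z - (s * c) *\<^sub>R e) - (g z +
      (\<Sum>j<r. of_real ((- (s * c)) ^ Suc j / fact (Suc j)) * (dir_deriv e ^^ Suc j) g z))) has_vector_derivative
      (- of_real c * dir_deriv e g (z - (s * c) *\<^sub>R e) - (0 +
      (\<Sum>j<r. - of_real c * (of_real ((- (s * c)) ^ j / fact j) * (dir_deriv e ^^ j) (dir_deriv e g) z))))) (at s within S)"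
    by (intro has_vector_derivative_diff has_vector_derivative_add has_vector_derivative_const
        has_vector_derivative_sum 1 2)
  moreover have "(\<lambda>s. taylor_rem e (Suc r) g (s * c) z) = (\<lambda>s. g (z - (s * c) *\<^sub>R e) - (g z +
      (\<Sum>j<r. of_real ((- (s * c)) ^ Suc j / fact (Suc j)) * (dir_deriv e ^^ Suc j) g z)))"
    by (simp add: taylor_rem_def sum.lessThan_Suc_shift del: sum.lessThan_Suc power_Suc fact_Suc funpow.simps(2))
  ultimately show ?thesis
    by (simp add: taylor_rem_def right_diff_distrib sum_distrib_left sum_negf)
qed

text \<open>The remainder vanishes at shift 0, hence is the integral of its derivative over s in
  [0, 1]. Tonelli and the induction hypothesis at shift s c give the bound; estimating |s c| by |c|
  forgoes the factor 1 / r!. The base case is translation invariance.\<close>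

lemma nn_integral_taylor_rem:
  assumes "L1_smooth g" and e: "e \<in> Basis"
  shows "(\<integral>\<^sup>+z. norm (taylor_rem e r g c z) \<partial>lborel) \<le>
    ennreal (\<bar>c\<bar> ^ r) * (\<integral>\<^sup>+z. norm ((dir_deriv e ^^ r) g z) \<partial>lborel)"
  using assms(1)
proof (induction r arbitrary: g c)
  case 0
  have "(\<integral>\<^sup>+z. norm (g (z - c *\<^sub>R e)) \<partial>lborel) = (\<integral>\<^sup>+z. norm (g z) \<partial>lborel)"
    using nn_integral_lborel_diff[of "\<lambda>z. ennreal (norm (g z))" "c *\<^sub>R e"] L1_smoothD(3)[OF 0] by simp
  thus ?case by (simp add: taylor_rem_def)
next
  case (Suc r)
  let ?R = "\<lambda>s z. taylor_rem e r (dir_deriv e g) (s * c) z"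
  have Dg: "L1_smooth (dir_deriv e g)" using Suc.prems e by (rule L1_smooth_dir_deriv)
  let ?K = "\<integral>\<^sup>+z. norm ((dir_deriv e ^^ r) (dir_deriv e g) z) \<partial>lborel"
  have cont: "continuous_on UNIV (\<lambda>x. ?R (fst x) (snd x))"
  proof -
    have "continuous_on UNIV (\<lambda>x::real \<times> 'a. (fst x * c, snd x))"
      by (intro continuous_intros)
    from continuous_on_compose2[OF continuous_taylor_rem[OF Dg e, of r] this] show ?thesis by simp
  qed
  have cont1: "continuous_on S (\<lambda>s. ?R s z)" for S z
    using continuous_on_compose2[OF cont, of S "\<lambda>s. (s, z)"] by (simp add: continuous_on_Pair)
  have cont2: "continuous_on S (?R s)" for S s
    using continuous_on_compose2[OF cont, of S "\<lambda>z. (s, z)"] by (simp add: continuous_on_Pair)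
  from cont have [measurable]: "(\<lambda>x. ?R (fst x) (snd x)) \<in> borel_measurable (borel \<Otimes>\<^sub>M borel)"
    unfolding borel_prod by (rule borel_measurable_continuous_onI)
  have pointwise: "ennreal (norm (taylor_rem e (Suc r) g c z)) \<le>
      (\<integral>\<^sup>+s. indicator {0..1} s * (ennreal \<bar>c\<bar> * norm (?R s z)) \<partial>lborel)" for z
  proof -
    let ?f = "\<lambda>s. - of_real c * ?R s z"
    have cont': "continuous_on {0..1} ?f"
      by (intro continuous_intros cont1)
    have "(LINT s|lborel. indicator {0..1} s *\<^sub>R ?f s) =
        taylor_rem e (Suc r) g (1 * c) z - taylor_rem e (Suc r) g (0 * c) z"
      by (rule integral_FTC_atLeastAtMost[OF zero_le_one taylor_rem_has_vector_derivative[OF Suc.prems e] cont'])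
    \<comment> \<open>At shift 0 only the term with j = 0 survives, where 0^0 = 1, and it cancels
      \<open>g z\<close>.\<close>
    moreover have "taylor_rem e (Suc r) g (0 * c) z = 0"
      by (simp add: taylor_rem_def sum.lessThan_Suc_shift del: sum.lessThan_Suc)
    moreover have "integrable lborel (\<lambda>s. indicator {0..1} s *\<^sub>R ?f s)"
      using borel_integrable_atLeastAtMost'[OF cont'] by (simp add: set_integrable_def)
    ultimately have "ennreal (norm (taylor_rem e (Suc r) g c z)) \<le>
        (\<integral>\<^sup>+s. norm (indicator {0..1} s *\<^sub>R ?f s) \<partial>lborel)"
      using integral_norm_bound_ennreal by fastforce
    also have "\<dots> = (\<integral>\<^sup>+s. indicator {0..1} s * (ennreal \<bar>c\<bar> * norm (?R s z)) \<partial>lborel)"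
      by (intro nn_integral_cong) (auto split: split_indicator simp: norm_mult ennreal_mult)
    finally show ?thesis .
  qed
  have "(\<integral>\<^sup>+z. norm (taylor_rem e (Suc r) g c z) \<partial>lborel) \<le>
      (\<integral>\<^sup>+z. (\<integral>\<^sup>+s. indicator {0..1} s * (ennreal \<bar>c\<bar> * norm (?R s z)) \<partial>lborel) \<partial>lborel)"
    by (intro nn_integral_mono pointwise)
  also have "\<dots> = (\<integral>\<^sup>+s. (\<integral>\<^sup>+z. indicator {0..1} s * (ennreal \<bar>c\<bar> * norm (?R s z)) \<partial>lborel) \<partial>lborel)"
    by (rule lborel_pair.Fubini') (unfold split_beta', measurable)
  also have "\<dots> \<le> (\<integral>\<^sup>+s. indicator {0..1} (s::real) * (ennreal \<bar>c\<bar> * (ennreal (\<bar>c\<bar> ^ r) * ?K)) \<partial>lborel)"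
  proof (rule nn_integral_mono)
    fix s :: real
    have [measurable]: "?R s \<in> borel_measurable borel"
      by (intro borel_measurable_continuous_onI cont2)
    have "(\<integral>\<^sup>+z. norm (?R s z) \<partial>lborel) \<le> ennreal (\<bar>c\<bar> ^ r) * ?K" if "s \<in> {0..1}"
    proof -
      have "(\<integral>\<^sup>+z. norm (?R s z) \<partial>lborel) \<le> ennreal (\<bar>s * c\<bar> ^ r) * ?K"
        by (rule Suc.IH[OF Dg])
      also have "\<dots> \<le> ennreal (\<bar>c\<bar> ^ r) * ?K"
        using that by (intro mult_right_mono ennreal_leI power_mono) (auto simp: abs_mult mult_left_le_one_le)
      finally show ?thesis .
    qed
    thus "(\<integral>\<^sup>+z. indicator {0..1} s * (ennreal \<bar>c\<bar> * norm (?R s z)) \<partial>lborel) \<le>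
        indicator {0..1} s * (ennreal \<bar>c\<bar> * (ennreal (\<bar>c\<bar> ^ r) * ?K))"
      by (auto split: split_indicator simp: nn_integral_cmult intro!: mult_left_mono)
  qed
  also have "\<dots> = ennreal \<bar>c\<bar> * (ennreal (\<bar>c\<bar> ^ r) * ?K)"
    by (simp add: nn_integral_multc)
  also have "\<dots> = ennreal (\<bar>c\<bar> ^ Suc r) * ?K"
    by (simp add: ennreal_mult mult.assoc)
  also have "?K = (\<integral>\<^sup>+z. norm ((dir_deriv e ^^ Suc r) g z) \<partial>lborel)"
    by (simp only: funpow_Suc_right o_def)
  finally show ?case .
qed

lemma nn_integral_norm_L1_smooth_finite:
  assumes "L1_smooth g"
  obtains K where "0 \<le> K" "(\<integral>\<^sup>+z. norm (g z) \<partial>lborel) = ennreal K"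
  using nn_integral_eq_integral[OF integrable_norm[OF L1_smoothD(4)[OF assms]]]
  by (metis AE_I2 norm_ge_zero Bochner_Integration.integral_nonneg)

lemma taylor_rem_bound:
  assumes "L1_smooth g" "e \<in> Basis"
  obtains K where "0 \<le> K"
    "\<And>c. (\<integral>\<^sup>+z. norm (taylor_rem e r g c z) \<partial>lborel) \<le> ennreal (K * \<bar>c\<bar> ^ r)"
proof -
  obtain K where K: "0 \<le> K" "(\<integral>\<^sup>+z. norm ((dir_deriv e ^^ r) g z) \<partial>lborel) = ennreal K"
    by (rule nn_integral_norm_L1_smooth_finite[OF L1_smooth_funpow[OF assms]])
  show thesis
    using nn_integral_taylor_rem[OF assms, of r] K
    by (intro that[OF K(1)]) (simp add: ennreal_mult mult.commute)
qed

section \<open>Taylor remainder in several coordinates\<close>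

definition multi_indices :: "'i list \<Rightarrow> nat \<Rightarrow> ('i \<Rightarrow> nat) set" where
  "multi_indices L r = {\<alpha>. (\<forall>i. i \<notin> set L \<longrightarrow> \<alpha> i = 0) \<and> sum \<alpha> (set L) < r}"

definition taylor_coeff :: "'i list \<Rightarrow> ('i \<Rightarrow> real) \<Rightarrow> ('i \<Rightarrow> nat) \<Rightarrow> real" where
  "taylor_coeff L c \<alpha> = (\<Prod>i\<in>set L. (- c i) ^ \<alpha> i / fact (\<alpha> i))"

text \<open>The derivative of the head of the list is outermost. Adding a coordinate to the list
  thus amounts to a one-variable expansion of each mixed derivative already present. The form
  matches \<open>D_x\<close> and \<open>D_y\<close>.\<close>

definition mixed_deriv :: "('i \<Rightarrow> 'a) \<Rightarrow> 'i list \<Rightarrow> ('i \<Rightarrow> nat) \<Rightarrow> ('a::euclidean_space \<Rightarrow> complex) \<Rightarrow> 'a \<Rightarrow> complex" where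
  "mixed_deriv b L \<alpha> g = foldr (\<lambda>i. dir_deriv (b i) ^^ \<alpha> i) L g"

lemma L1_smooth_mixed_deriv:
  "L1_smooth g \<Longrightarrow> (\<And>i. i \<in> set L \<Longrightarrow> b i \<in> Basis) \<Longrightarrow> L1_smooth (mixed_deriv b L \<alpha> g)"
  unfolding mixed_deriv_def by (rule L1_smooth_foldr)

lemma mixed_deriv_Cons_upd:
  assumes "i \<notin> set L"
  shows "mixed_deriv b (i # L) (\<alpha>(i := j)) g = (dir_deriv (b i) ^^ j) (mixed_deriv b L \<alpha> g)"
proof -
  have "foldr (\<lambda>l. dir_deriv (b l) ^^ (\<alpha>(i := j)) l) L g = foldr (\<lambda>l. dir_deriv (b l) ^^ \<alpha> l) L g"
    using assms by (intro foldr_cong) auto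
  thus ?thesis by (simp add: mixed_deriv_def)
qed

lemma taylor_coeff_Cons_upd:
  assumes "i \<notin> set L"
  shows "taylor_coeff (i # L) c (\<alpha>(i := j)) = (- c i) ^ j / fact j * taylor_coeff L c \<alpha>"
proof -
  have "(\<Prod>l\<in>set L. (- c l) ^ (\<alpha>(i := j)) l / fact ((\<alpha>(i := j)) l)) = (\<Prod>l\<in>set L. (- c l) ^ \<alpha> l / fact (\<alpha> l))"
    using assms by (intro prod.cong) auto
  thus ?thesis using assms by (simp add: taylor_coeff_def)
qed

lemma abs_taylor_coeff_le: "\<bar>taylor_coeff L c \<alpha>\<bar> \<le> (\<Sum>i\<in>set L. \<bar>c i\<bar>) ^ sum \<alpha> (set L)"
proof -
  have "\<bar>taylor_coeff L c \<alpha>\<bar> = (\<Prod>i\<in>set L. \<bar>c i\<bar> ^ \<alpha> i / fact (\<alpha> i))"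
    by (simp add: taylor_coeff_def abs_prod power_abs)
  also have "\<dots> \<le> (\<Prod>i\<in>set L. (\<Sum>i\<in>set L. \<bar>c i\<bar>) ^ \<alpha> i)"
  proof (intro prod_mono conjI)
    fix i assume i: "i \<in> set L"
    have "\<bar>c i\<bar> ^ \<alpha> i / fact (\<alpha> i) \<le> \<bar>c i\<bar> ^ \<alpha> i"
      using mult_right_mono[OF fact_ge_1[of "\<alpha> i"], of "\<bar>c i\<bar> ^ \<alpha> i"] by (simp add: divide_le_eq mult.commute)
    also have "\<dots> \<le> (\<Sum>i\<in>set L. \<bar>c i\<bar>) ^ \<alpha> i"
      using i by (intro power_mono member_le_sum) auto
    finally show "\<bar>c i\<bar> ^ \<alpha> i / fact (\<alpha> i) \<le> (\<Sum>i\<in>set L. \<bar>c i\<bar>) ^ \<alpha> i" .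
  qed auto
  finally show ?thesis by (simp add: power_sum)
qed

text \<open>A multi-index on \<open>L\<close> of degree d leaves the exponents below r - d for the
  new coordinate. The sum over multi-indices thereby becomes an iterated sum whose inner part is a
  one-variable Taylor polynomial of the complementary order.\<close>

lemma multi_indices_Cons:
  assumes "i \<notin> set L"
  shows "multi_indices (i # L) r =
    (\<lambda>(\<alpha>, j). \<alpha>(i := j)) ` (SIGMA \<alpha>:multi_indices L r. {..<r - sum \<alpha> (set L)})" (is "?A = ?B")
    and "inj_on (\<lambda>(\<alpha>, j). \<alpha>(i := j)) (SIGMA \<alpha>:multi_indices L r. {..<r - sum \<alpha> (set L)})"
proof -
  have sum_upd: "(\<Sum>l\<in>set L. if l = i then j else \<alpha> l) = sum \<alpha> (set L)" for \<alpha> :: "'a \<Rightarrow> nat" and j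
    using assms by (intro sum.cong) auto
  show "?A = ?B"
  proof (intro subset_antisym subsetI)
    fix \<alpha> assume "\<alpha> \<in> ?A"
    hence "(\<alpha>(i := 0), \<alpha> i) \<in> (SIGMA \<alpha>:multi_indices L r. {..<r - sum \<alpha> (set L)})"
      using assms by (auto simp: multi_indices_def sum_upd)
    moreover have "\<alpha> = (\<lambda>(\<alpha>, j). \<alpha>(i := j)) (\<alpha>(i := 0), \<alpha> i)" by simp
    ultimately show "\<alpha> \<in> ?B" by (rule rev_image_eqI)
  qed (use assms in \<open>auto simp: multi_indices_def sum_upd\<close>)
  show "inj_on (\<lambda>(\<alpha>, j). \<alpha>(i := j)) (SIGMA \<alpha>:multi_indices L r. {..<r - sum \<alpha> (set L)})"
  proof (rule inj_onI, clarify)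
    fix \<alpha> \<alpha>' :: "'a \<Rightarrow> nat" and j j'
    assume "\<alpha> \<in> multi_indices L r" "\<alpha>' \<in> multi_indices L r" and eq: "\<alpha>(i := j) = \<alpha>'(i := j')"
    hence "\<alpha> i = \<alpha>' i" using assms by (auto simp: multi_indices_def)
    with eq show "\<alpha> = \<alpha>' \<and> j = j'" by (auto simp: fun_eq_iff split: if_splits)
  qed
qed

lemma finite_multi_indices: "finite (multi_indices L r)"
proof (induction L)
  case Nil
  have "multi_indices [] r \<subseteq> {\<lambda>_. 0}" by (auto simp: multi_indices_def)
  thus ?case by (rule finite_subset) simp
next
  case (Cons i L)
  show ?case
  proof (cases "i \<in> set L")
    case True
    hence "multi_indices (i # L) r = multi_indices L r"
      by (auto simp: multi_indices_def insert_absorb)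
    thus ?thesis using Cons by simp
  next
    case False
    thus ?thesis using Cons by (simp add: multi_indices_Cons(1))
  qed
qed

text \<open>Induction on the coordinates: after expanding in \<open>L\<close>, each derivative of
  degree d that was kept is expanded in the new direction to order r - d. Its coefficient
  contributes the power d of the coordinate sum and its remainder the power r - d, so every error
  has total order \<open>r\<close>.\<close>

lemma multi_taylor_L1_bound:
  assumes g: "L1_smooth g" and "distinct L" and "\<And>i. i \<in> set L \<Longrightarrow> b i \<in> Basis"
  shows "\<exists>C\<ge>0. \<forall>c. (\<integral>\<^sup>+z. norm (g (z - (\<Sum>i\<in>set L. c i *\<^sub>R b i)) -
        (\<Sum>\<alpha>\<in>multi_indices L r. of_real (taylor_coeff L c \<alpha>) * mixed_deriv b L \<alpha> g z)) \<partial>lborel)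
      \<le> ennreal (C * (\<Sum>i\<in>set L. \<bar>c i\<bar>) ^ r)"
  using assms(2,3)
proof (induction L)
  case Nil
  show ?case
  proof (cases "r = 0")
    case True
    obtain K where "0 \<le> K" "(\<integral>\<^sup>+z. norm (g z) \<partial>lborel) = ennreal K"
      by (rule nn_integral_norm_L1_smooth_finite[OF g])
    thus ?thesis using True by (intro exI[of _ K]) (simp add: multi_indices_def)
  next
    case False
    hence "multi_indices [] r = {\<lambda>_::'b. 0}" by (auto simp: multi_indices_def)
    thus ?thesis by (intro exI[of _ 0]) (simp add: taylor_coeff_def mixed_deriv_def)
  qed
next
  case (Cons i L)
  hence iL: "i \<notin> set L" and bi: "b i \<in> Basis" and bL: "\<And>l. l \<in> set L \<Longrightarrow> b l \<in> Basis" by auto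
  let ?D = "\<lambda>\<alpha>. mixed_deriv b L \<alpha> g"
  have D: "L1_smooth (?D \<alpha>)" for \<alpha>
    using g bL by (rule L1_smooth_mixed_deriv)
  let ?rem = "\<lambda>c z. g (z - (\<Sum>l\<in>set L. c l *\<^sub>R b l)) -
      (\<Sum>\<alpha>\<in>multi_indices L r. of_real (taylor_coeff L c \<alpha>) * ?D \<alpha> z)"
  let ?T = "\<lambda>\<alpha>. taylor_rem (b i) (r - sum \<alpha> (set L)) (?D \<alpha>)"
  from Cons obtain C where C: "0 \<le> C"
    "\<And>c. (\<integral>\<^sup>+z. norm (?rem c z) \<partial>lborel) \<le> ennreal (C * (\<Sum>l\<in>set L. \<bar>c l\<bar>) ^ r)"
    by auto
  have "\<exists>K\<ge>0. \<forall>c. (\<integral>\<^sup>+z. norm (?T \<alpha> c z) \<partial>lborel) \<le> ennreal (K * \<bar>c\<bar> ^ (r - sum \<alpha> (set L)))" for \<alpha>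
    using taylor_rem_bound[OF D[of \<alpha>] bi, of "r - sum \<alpha> (set L)"] by metis
  then obtain K where K: "\<And>\<alpha>. 0 \<le> K \<alpha>"
    "\<And>\<alpha> c. (\<integral>\<^sup>+z. norm (?T \<alpha> c z) \<partial>lborel) \<le> ennreal (K \<alpha> * \<bar>c\<bar> ^ (r - sum \<alpha> (set L)))"
    by metis
  show ?case
  proof (intro exI[of _ "C + (\<Sum>\<alpha>\<in>multi_indices L r. K \<alpha>)"] conjI allI)
    show "0 \<le> C + (\<Sum>\<alpha>\<in>multi_indices L r. K \<alpha>)" using C(1) K(1) by (auto intro!: add_nonneg_nonneg sum_nonneg)
    fix c :: "'b \<Rightarrow> real"
    let ?S = "\<Sum>l\<in>set L. \<bar>c l\<bar>"
    let ?S' = "\<Sum>l\<in>set (i # L). \<bar>c l\<bar>"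
    have S': "?S' = \<bar>c i\<bar> + ?S" "0 \<le> ?S" "0 \<le> ?S'" using iL by (auto intro: sum_nonneg)
    let ?a = "\<lambda>\<alpha>. complex_of_real (taylor_coeff L c \<alpha>)"
    \<comment> \<open>The old remainder is taken at the point already shifted in direction
      \<open>b i\<close>. Its Taylor terms are then evaluated at that shifted point, and the
      one-variable remainders carry them back to \<open>z\<close>.\<close>
    have expand: "g (z - (\<Sum>l\<in>set (i # L). c l *\<^sub>R b l)) -
        (\<Sum>\<alpha>\<in>multi_indices (i # L) r. of_real (taylor_coeff (i # L) c \<alpha>) * mixed_deriv b (i # L) \<alpha> g z) =
        ?rem c (z - c i *\<^sub>R b i) + (\<Sum>\<alpha>\<in>multi_indices L r. ?a \<alpha> * ?T \<alpha> (c i) z)" for z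
    proof -
      have "(\<Sum>\<alpha>\<in>multi_indices (i # L) r. of_real (taylor_coeff (i # L) c \<alpha>) * mixed_deriv b (i # L) \<alpha> g z) =
          (\<Sum>(\<alpha>, j)\<in>(SIGMA \<alpha>:multi_indices L r. {..<r - sum \<alpha> (set L)}).
            ?a \<alpha> * (of_real ((- c i) ^ j / fact j) * (dir_deriv (b i) ^^ j) (?D \<alpha>) z))"
        unfolding multi_indices_Cons(1)[OF iL] sum.reindex[OF multi_indices_Cons(2)[OF iL]]
        by (intro sum.cong) (auto simp: mixed_deriv_Cons_upd[OF iL] taylor_coeff_Cons_upd[OF iL])
      also have "\<dots> = (\<Sum>\<alpha>\<in>multi_indices L r. ?a \<alpha> *
          (\<Sum>j<r - sum \<alpha> (set L). of_real ((- c i) ^ j / fact j) * (dir_deriv (b i) ^^ j) (?D \<alpha>) z))"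
        by (subst sum.Sigma[symmetric]) (auto simp: finite_multi_indices sum_distrib_left)
      finally show ?thesis
        using iL by (simp add: taylor_rem_def right_diff_distrib sum_subtractf algebra_simps)
    qed
    have [measurable]: "?D \<alpha> \<in> borel_measurable borel" "g \<in> borel_measurable borel"
      "(dir_deriv (b i) ^^ j) (?D \<alpha>) \<in> borel_measurable borel" for \<alpha> j
      using L1_smoothD(3)[OF D] L1_smoothD(3)[OF g] L1_smoothD(3)[OF L1_smooth_funpow[OF D bi]] by auto
    have rem_meas [measurable]: "?rem c \<in> borel_measurable borel"
      by measurable
    have T_meas [measurable]: "?T \<alpha> (c i) \<in> borel_measurable borel" for \<alpha>
      unfolding taylor_rem_def by measurable
    have "(\<integral>\<^sup>+z. norm (?rem c (z - c i *\<^sub>R b i) + (\<Sum>\<alpha>\<in>multi_indices L r. ?a \<alpha> * ?T \<alpha> (c i) z)) \<partial>lborel) \<le>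
        (\<integral>\<^sup>+z. ennreal (norm (?rem c (z - c i *\<^sub>R b i))) +
          (\<Sum>\<alpha>\<in>multi_indices L r. ennreal \<bar>taylor_coeff L c \<alpha>\<bar> * ennreal (norm (?T \<alpha> (c i) z))) \<partial>lborel)"
    proof (intro nn_integral_mono)
      fix z
      have "norm (?rem c (z - c i *\<^sub>R b i) + (\<Sum>\<alpha>\<in>multi_indices L r. ?a \<alpha> * ?T \<alpha> (c i) z)) \<le>
          norm (?rem c (z - c i *\<^sub>R b i)) + (\<Sum>\<alpha>\<in>multi_indices L r. \<bar>taylor_coeff L c \<alpha>\<bar> * norm (?T \<alpha> (c i) z))"
        by (intro norm_triangle_le add_left_mono order.trans[OF norm_sum]) (simp add: norm_mult)
      also have "ennreal \<dots> = ennreal (norm (?rem c (z - c i *\<^sub>R b i))) +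
          (\<Sum>\<alpha>\<in>multi_indices L r. ennreal \<bar>taylor_coeff L c \<alpha>\<bar> * ennreal (norm (?T \<alpha> (c i) z)))"
        by (simp add: ennreal_plus sum_nonneg ennreal_mult flip: sum_ennreal)
      finally show "ennreal (norm (?rem c (z - c i *\<^sub>R b i) + (\<Sum>\<alpha>\<in>multi_indices L r. ?a \<alpha> * ?T \<alpha> (c i) z))) \<le>
          ennreal (norm (?rem c (z - c i *\<^sub>R b i))) +
          (\<Sum>\<alpha>\<in>multi_indices L r. ennreal \<bar>taylor_coeff L c \<alpha>\<bar> * ennreal (norm (?T \<alpha> (c i) z)))"
        by (simp add: ennreal_leI)
    qed
    also have "\<dots> = (\<integral>\<^sup>+z. norm (?rem c (z - c i *\<^sub>R b i)) \<partial>lborel) +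
        (\<Sum>\<alpha>\<in>multi_indices L r. ennreal \<bar>taylor_coeff L c \<alpha>\<bar> * (\<integral>\<^sup>+z. norm (?T \<alpha> (c i) z) \<partial>lborel))"
      using measurable_compose[OF _ rem_meas, of "\<lambda>z. z - c i *\<^sub>R b i"]
      by (subst nn_integral_add) (auto simp: nn_integral_sum nn_integral_cmult)
    also have "(\<integral>\<^sup>+z. norm (?rem c (z - c i *\<^sub>R b i)) \<partial>lborel) = (\<integral>\<^sup>+z. norm (?rem c z) \<partial>lborel)"
      by (rule nn_integral_lborel_diff[of "\<lambda>z. ennreal (norm (?rem c z))"]) measurable
    also have "\<dots> + (\<Sum>\<alpha>\<in>multi_indices L r. ennreal \<bar>taylor_coeff L c \<alpha>\<bar> * (\<integral>\<^sup>+z. norm (?T \<alpha> (c i) z) \<partial>lborel)) \<le>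
        ennreal (C * ?S' ^ r) + (\<Sum>\<alpha>\<in>multi_indices L r. ennreal (K \<alpha> * ?S' ^ r))"
    proof (intro add_mono sum_mono)
      have "C * ?S ^ r \<le> C * ?S' ^ r"
        using S' C(1) by (intro mult_left_mono power_mono) auto
      thus "(\<integral>\<^sup>+z. norm (?rem c z) \<partial>lborel) \<le> ennreal (C * ?S' ^ r)"
        using C(2)[of c] ennreal_leI order.trans by blast
      fix \<alpha> assume \<alpha>: "\<alpha> \<in> multi_indices L r"
      let ?n = "sum \<alpha> (set L)"
      have "?n < r" using \<alpha> by (simp add: multi_indices_def)
      have "\<bar>taylor_coeff L c \<alpha>\<bar> * (K \<alpha> * \<bar>c i\<bar> ^ (r - ?n)) \<le> ?S' ^ ?n * (K \<alpha> * ?S' ^ (r - ?n))"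
        using S' K(1)[of \<alpha>]
        by (intro mult_mono order.trans[OF abs_taylor_coeff_le] power_mono mult_left_mono) auto
      also have "\<dots> = K \<alpha> * ?S' ^ r"
        using \<open>?n < r\<close> by (simp add: power_add[symmetric] del: set_simps)
      finally have *: "\<bar>taylor_coeff L c \<alpha>\<bar> * (K \<alpha> * \<bar>c i\<bar> ^ (r - ?n)) \<le> K \<alpha> * ?S' ^ r" .
      have "ennreal \<bar>taylor_coeff L c \<alpha>\<bar> * (\<integral>\<^sup>+z. norm (?T \<alpha> (c i) z) \<partial>lborel) \<le>
          ennreal \<bar>taylor_coeff L c \<alpha>\<bar> * ennreal (K \<alpha> * \<bar>c i\<bar> ^ (r - ?n))"
        by (intro mult_left_mono K) auto
      also have "\<dots> = ennreal (\<bar>taylor_coeff L c \<alpha>\<bar> * (K \<alpha> * \<bar>c i\<bar> ^ (r - ?n)))"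
        using K(1)[of \<alpha>] by (intro ennreal_mult[symmetric]) auto
      also have "\<dots> \<le> ennreal (K \<alpha> * ?S' ^ r)"
        using * by (rule ennreal_leI)
      finally show "ennreal \<bar>taylor_coeff L c \<alpha>\<bar> * (\<integral>\<^sup>+z. norm (?T \<alpha> (c i) z) \<partial>lborel) \<le> ennreal (K \<alpha> * ?S' ^ r)" .
    qed
    also have "\<dots> = ennreal (C * ?S' ^ r) + ennreal (\<Sum>\<alpha>\<in>multi_indices L r. K \<alpha> * ?S' ^ r)"
      using K(1) S'(3) by (subst sum_ennreal) auto
    also have "\<dots> = ennreal ((C + (\<Sum>\<alpha>\<in>multi_indices L r. K \<alpha>)) * ?S' ^ r)"
      using C(1) K(1) S'(3)
      by (subst ennreal_plus[symmetric]) (auto simp: distrib_right sum_distrib_right intro!: sum_nonneg)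
    finally show "(\<integral>\<^sup>+z. norm (g (z - (\<Sum>l\<in>set (i # L). c l *\<^sub>R b l)) -
        (\<Sum>\<alpha>\<in>multi_indices (i # L) r. of_real (taylor_coeff (i # L) c \<alpha>) * mixed_deriv b (i # L) \<alpha> g z)) \<partial>lborel)
      \<le> ennreal ((C + (\<Sum>\<alpha>\<in>multi_indices L r. K \<alpha>)) * ?S' ^ r)"
      unfolding expand .
  qed
qed

subsection \<open>Anisotropic expansion of the kernel\<close>

lemma enum_indices: "distinct (enum_indices :: 'i::finite list)" "set (enum_indices :: 'i list) = UNIV"
proof -
  have "\<exists>l :: 'i list. distinct l \<and> set l = UNIV"
    using finite_distinct_list[of "UNIV :: 'i set"] by auto
  from someI_ex[OF this]
  show "distinct (enum_indices :: 'i list)" "set (enum_indices :: 'i list) = UNIV"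
    by (simp_all add: enum_indices_def)
qed

text \<open>The numerical factor and monomial of \<open>expansion\<close> combined: the product of
  these in \<open>x\<close> and \<open>y\<close>, integrated against \<open>f\<close>, is the
  coefficient of one derivative of \<open>G t\<close>.\<close>

definition mi_coeff :: "real ^ 'i::finite \<Rightarrow> ('i \<Rightarrow> nat) \<Rightarrow> real" where
  "mi_coeff x \<alpha> = (- 1) ^ mi_abs \<alpha> / real (mi_fact \<alpha>) * mi_power x \<alpha>"

lemma taylor_coeff_enum_indices: "taylor_coeff enum_indices (($) x) \<alpha> = mi_coeff x \<alpha>"
proof -
  have "taylor_coeff enum_indices (($) x) \<alpha> = (\<Prod>i\<in>UNIV. (- 1) ^ \<alpha> i / fact (\<alpha> i) * (x $ i) ^ \<alpha> i)"
    unfolding taylor_coeff_def enum_indices(2)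
    by (intro prod.cong refl) (subst power_minus, simp)
  also have "\<dots> = mi_coeff x \<alpha>"
    by (simp add: mi_coeff_def mi_abs_def mi_fact_def mi_power_def prod.distrib prod_dividef power_sum)
  finally show ?thesis .
qed

lemma multi_indices_enum_indices: "multi_indices enum_indices r = {\<alpha>. mi_abs \<alpha> < r}"
  by (simp add: multi_indices_def enum_indices(2) mi_abs_def)

lemma finite_mi_abs_less: "finite {\<alpha> :: 'i::finite \<Rightarrow> nat. mi_abs \<alpha> < r}"
  using finite_multi_indices[of enum_indices r] by (simp add: multi_indices_enum_indices)

lemma abs_mi_power_le: "\<bar>mi_power x \<alpha>\<bar> \<le> norm x ^ mi_abs \<alpha>"
proof -
  have "\<bar>mi_power x \<alpha>\<bar> = (\<Prod>i\<in>UNIV. \<bar>x $ i\<bar> ^ \<alpha> i)"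
    by (simp add: mi_power_def abs_prod power_abs)
  also have "\<dots> \<le> (\<Prod>i\<in>UNIV. norm x ^ \<alpha> i)"
    by (intro prod_mono conjI power_mono component_le_norm_cart) auto
  finally show ?thesis by (simp add: mi_abs_def power_sum)
qed

lemma abs_mi_coeff_le: "\<bar>mi_coeff x \<alpha>\<bar> \<le> norm x ^ mi_abs \<alpha>"
proof -
  have "mi_fact \<alpha> \<ge> 1"
    unfolding mi_fact_def by (intro prod_ge_1) auto
  hence "1 \<le> real (mi_fact \<alpha>)" by simp
  hence "\<bar>mi_coeff x \<alpha>\<bar> \<le> \<bar>mi_power x \<alpha>\<bar>"
    using mult_right_mono[of 1 "real (mi_fact \<alpha>)" "\<bar>mi_power x \<alpha>\<bar>"]
    by (simp add: mi_coeff_def abs_mult power_abs divide_le_eq mult.commute)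
  thus ?thesis using abs_mi_power_le[of x \<alpha>] by linarith
qed

lemma continuous_on_mi_coeff [continuous_intros]:
  "continuous_on S f \<Longrightarrow> continuous_on S (\<lambda>z. mi_coeff (f z) \<alpha>)"
  unfolding mi_coeff_def mi_power_def by (intro continuous_intros)

lemma mi_coeff_scaleR: "mi_coeff (a *\<^sub>R x) \<alpha> = a ^ mi_abs \<alpha> * mi_coeff x \<alpha>"
  by (simp add: mi_coeff_def mi_power_def mi_abs_def power_mult_distrib prod.distrib power_sum)

lemma vec_taylor_L1_bound:
  fixes b :: "'i::finite \<Rightarrow> 'a::euclidean_space"
  assumes "L1_smooth g" and "\<And>i. b i \<in> Basis"
  shows "\<exists>C\<ge>0. \<forall>x :: real ^ 'i. (\<integral>\<^sup>+z. norm (g (z - (\<Sum>i\<in>UNIV. x $ i *\<^sub>R b i)) -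
        (\<Sum>\<alpha> | mi_abs \<alpha> < r. of_real (mi_coeff x \<alpha>) * mixed_deriv b enum_indices \<alpha> g z)) \<partial>lborel)
      \<le> ennreal (C * norm x ^ r)"
proof -
  obtain C where C: "0 \<le> C"
    "\<And>c. (\<integral>\<^sup>+z. norm (g (z - (\<Sum>i\<in>set enum_indices. c i *\<^sub>R b i)) -
        (\<Sum>\<alpha>\<in>multi_indices enum_indices r. of_real (taylor_coeff enum_indices c \<alpha>) * mixed_deriv b enum_indices \<alpha> g z)) \<partial>lborel)
      \<le> ennreal (C * (\<Sum>i\<in>set enum_indices. \<bar>c i\<bar>) ^ r)"
    using multi_taylor_L1_bound[where r = r and b = b, OF assms(1) enum_indices(1) assms(2)] by blast
  show ?thesis
  \<comment> \<open>Each coordinate is at most the Euclidean norm, so passing from the sum of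
    absolute coordinates to the norm costs a factor \<open>CARD('i)\<close> per order.\<close>
  proof (intro exI[of _ "C * real CARD('i) ^ r"] conjI allI)
    show "0 \<le> C * real CARD('i) ^ r" using C(1) by simp
    fix x :: "real ^ 'i"
    have "(\<Sum>i\<in>UNIV. \<bar>x $ i\<bar>) \<le> real CARD('i) * norm x"
      using sum_bounded_above[of UNIV "\<lambda>i. \<bar>x $ i\<bar>" "norm x"] by (simp add: component_le_norm_cart)
    hence "C * (\<Sum>i\<in>UNIV. \<bar>x $ i\<bar>) ^ r \<le> C * real CARD('i) ^ r * norm x ^ r"
      using C(1) by (simp add: power_mult_distrib[symmetric] mult.assoc mult_left_mono power_mono sum_nonneg)
    thus "(\<integral>\<^sup>+z. norm (g (z - (\<Sum>i\<in>UNIV. x $ i *\<^sub>R b i)) -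
        (\<Sum>\<alpha> | mi_abs \<alpha> < r. of_real (mi_coeff x \<alpha>) * mixed_deriv b enum_indices \<alpha> g z)) \<partial>lborel)
      \<le> ennreal (C * real CARD('i) ^ r * norm x ^ r)"
      using C(2)[of "($) x"] unfolding enum_indices(2) multi_indices_enum_indices taylor_coeff_enum_indices
      by (meson ennreal_leI order.trans)
  qed
qed

lemma D_x_eq: "D_x \<beta> g = mixed_deriv (\<lambda>i. (axis i 1, 0)) enum_indices \<beta> g"
  and D_y_eq: "D_y \<gamma> g = mixed_deriv (\<lambda>i. (0, axis i 1)) enum_indices \<gamma> g"
  by (simp_all add: D_x_def D_y_def mixed_deriv_def)

lemma axis_Basis:
  "(axis i 1 :: real ^ 'm::finite, 0 :: 'b::euclidean_space) \<in> Basis"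
  "(0 :: 'b::euclidean_space, axis i 1 :: real ^ 'm::finite) \<in> Basis"
  by (auto simp: Basis_prod_def axis_in_Basis_iff)

lemma L1_smooth_D_x: "L1_smooth g \<Longrightarrow> L1_smooth (D_x \<beta> g)"
  and L1_smooth_D_y: "L1_smooth g \<Longrightarrow> L1_smooth (D_y \<gamma> g)"
  unfolding D_x_eq D_y_eq by (intro L1_smooth_mixed_deriv axis_Basis; assumption)+

lemma sum_axis:
  fixes x :: "real ^ 'm::finite"
  shows "(\<Sum>i\<in>UNIV. x $ i *\<^sub>R (axis i 1, 0)) = (x, 0 :: 'b::euclidean_space)"
    and "(\<Sum>i\<in>UNIV. x $ i *\<^sub>R (0, axis i 1)) = (0 :: 'b, x)"
  using basis_expansion[of x] by (simp_all add: prod_eq_iff fst_sum snd_sum scalar_mult_eq_scaleR)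

text \<open>The weighted degree \<open>\<bar>\<beta>\<bar> + 2\<bar>\<gamma>\<bar>\<close> counts derivatives in the anisotropic scaling
  \<open>(x, y) \<mapsto> (x / s, y / s\<^sup>2)\<close> of the equation.\<close>

definition expansion_indices :: "nat \<Rightarrow> (('m::finite \<Rightarrow> nat) \<times> ('n::finite \<Rightarrow> nat)) set" where
  "expansion_indices k = {(\<beta>, \<gamma>). mi_abs \<beta> + 2 * mi_abs \<gamma> \<le> k}"

text \<open>This is where odd \<open>k\<close> enters: 2|gamma| <= k means |gamma| < p, and |beta| +
  2|gamma| <= k means |beta| < k + 1 - 2|gamma|. Each fibre over \<open>\<gamma>\<close> is thus a
  full Taylor polynomial in \<open>x\<close>.\<close>

lemma expansion_indices_Sigma:
  assumes "k + 1 = 2 * p"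
  shows "bij_betw (\<lambda>(\<gamma>, \<beta>). (\<beta>, \<gamma>))
    (SIGMA \<gamma>:{\<gamma>. mi_abs \<gamma> < p}. {\<beta>. mi_abs \<beta> < k + 1 - 2 * mi_abs \<gamma>}) (expansion_indices k)"
  using assms by (intro bij_betwI[where g = "\<lambda>(\<beta>, \<gamma>). (\<gamma>, \<beta>)"]) (auto simp: expansion_indices_def)

text \<open>Integrated against \<open>f w\<close>, with \<open>g = G t\<close>, this is the solution
  minus its expansion (\<open>sol_minus_expansion\<close>).\<close>

definition kernel_rem :: "nat \<Rightarrow> ((real ^ 'm::finite) \<times> (real ^ 'n::finite) \<Rightarrow> complex) \<Rightarrow>
    (real ^ 'm) \<times> (real ^ 'n) \<Rightarrow> (real ^ 'm) \<times> (real ^ 'n) \<Rightarrow> complex" where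
  "kernel_rem k g w z = g (z - w) -
    (\<Sum>(\<beta>, \<gamma>)\<in>expansion_indices k.
      of_real (mi_coeff (fst w) \<beta> * mi_coeff (snd w) \<gamma>) * D_x \<beta> (D_y \<gamma> g) z)"

text \<open>If \<open>b\<close> is given weight 2, all terms have degree 2p. Replacing the smaller
  of a^2 and b by the larger turns the product into one of the summands on the right.\<close>

lemma young_power:
  fixes a b :: real
  assumes "0 \<le> a" "0 \<le> b" "j \<le> p"
  shows "a ^ (2 * p - 2 * j) * b ^ j \<le> a ^ (2 * p) + b ^ p"
proof (cases "b \<le> a\<^sup>2")
  case True
  have "a ^ (2 * p - 2 * j) * b ^ j \<le> a ^ (2 * p - 2 * j) * (a\<^sup>2) ^ j"
    using assms True by (intro mult_left_mono power_mono) auto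
  also have "\<dots> = a ^ (2 * p)"
    using assms by (simp add: power_mult[symmetric] power_add[symmetric])
  finally show ?thesis using assms by (simp add: add_increasing2)
next
  case False
  have "a ^ (2 * p - 2 * j) * b ^ j = (a\<^sup>2) ^ (p - j) * b ^ j"
    by (simp add: power_mult[symmetric] right_diff_distrib')
  also have "\<dots> \<le> b ^ (p - j) * b ^ j"
    using assms False by (intro mult_right_mono power_mono) auto
  also have "\<dots> = b ^ p"
    using assms by (simp add: power_add[symmetric])
  finally show ?thesis using assms by (simp add: add_increasing)
qed

text \<open>Expanding in \<open>y\<close> before \<open>x\<close> makes every remainder term have weighted order exactly
  \<open>k + 1\<close>: as \<open>k + 1\<close> is even, the \<open>y\<close>-remainder has order \<open>(k + 1) / 2\<close>.\<close>

lemma kernel_rem_L1_bound: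
  fixes g :: "(real ^ 'm::finite) \<times> (real ^ 'n::finite) \<Rightarrow> complex"
  assumes g: "L1_smooth g" and p: "k + 1 = 2 * p"
  shows "\<exists>C\<ge>0. \<forall>w. (\<integral>\<^sup>+z. norm (kernel_rem k g w z) \<partial>lborel) \<le>
      ennreal (C * (norm (fst w) ^ (k + 1) + norm (snd w) ^ p))"
proof -
  let ?I = "{\<gamma> :: 'n \<Rightarrow> nat. mi_abs \<gamma> < p}"
  let ?r = "\<lambda>\<gamma> :: 'n \<Rightarrow> nat. k + 1 - 2 * mi_abs \<gamma>"
  let ?Ry = "\<lambda>y z. g (z - (0, y)) - (\<Sum>\<gamma>\<in>?I. of_real (mi_coeff y \<gamma>) * D_y \<gamma> g z)"
  let ?Rx = "\<lambda>\<gamma> x z. D_y \<gamma> g (z - (x, 0)) -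
    (\<Sum>\<beta> | mi_abs \<beta> < ?r \<gamma>. of_real (mi_coeff x \<beta>) * D_x \<beta> (D_y \<gamma> g) z)"
  obtain A where A: "0 \<le> A" "\<And>y. (\<integral>\<^sup>+z. norm (?Ry y z) \<partial>lborel) \<le> ennreal (A * norm y ^ p)"
    using vec_taylor_L1_bound[where r = p and b = "\<lambda>i. (0, axis i 1)", OF g axis_Basis(2)] unfolding sum_axis D_y_eq by blast
  have "\<exists>B\<ge>0. \<forall>x. (\<integral>\<^sup>+z. norm (?Rx \<gamma> x z) \<partial>lborel) \<le> ennreal (B * norm x ^ ?r \<gamma>)" for \<gamma>
    using vec_taylor_L1_bound[where r = "?r \<gamma>" and b = "\<lambda>i. (axis i 1, 0)", OF L1_smooth_D_y[OF g] axis_Basis(1)] unfolding sum_axis D_x_eq by blast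
  hence "\<exists>B. \<forall>\<gamma>. 0 \<le> B \<gamma> \<and> (\<forall>x. (\<integral>\<^sup>+z. norm (?Rx \<gamma> x z) \<partial>lborel) \<le> ennreal (B \<gamma> * norm x ^ ?r \<gamma>))"
    by (intro choice allI)
  then obtain B where B: "\<And>\<gamma>. 0 \<le> B \<gamma>"
    "\<And>\<gamma> x. (\<integral>\<^sup>+z. norm (?Rx \<gamma> x z) \<partial>lborel) \<le> ennreal (B \<gamma> * norm x ^ ?r \<gamma>)" by blast
  show ?thesis
  proof (intro exI[of _ "A + (\<Sum>\<gamma>\<in>?I. B \<gamma>)"] conjI allI)
    show "0 \<le> A + (\<Sum>\<gamma>\<in>?I. B \<gamma>)" using A(1) B(1) by (auto intro!: add_nonneg_nonneg sum_nonneg)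
    fix w :: "(real ^ 'm) \<times> (real ^ 'n)"
    obtain x y where w: "w = (x, y)" by force
    let ?M = "norm x ^ (k + 1) + norm y ^ p"
    \<comment> \<open>The y-remainder is taken at \<open>z - (x, 0)\<close>, a shift invisible to
      the L^1 norm. Its Taylor terms at that point are then expanded in \<open>x\<close>, each to
      the order its \<open>\<gamma>\<close> leaves.\<close>
    have expand: "kernel_rem k g w z = ?Ry y (z - (x, 0)) + (\<Sum>\<gamma>\<in>?I. of_real (mi_coeff y \<gamma>) * ?Rx \<gamma> x z)" for z
    proof -
      have "(\<Sum>(\<beta>, \<gamma>)\<in>expansion_indices k. of_real (mi_coeff x \<beta> * mi_coeff y \<gamma>) * D_x \<beta> (D_y \<gamma> g) z) =
          (\<Sum>(\<gamma>, \<beta>)\<in>(SIGMA \<gamma>:?I. {\<beta>. mi_abs \<beta> < ?r \<gamma>}).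
            of_real (mi_coeff y \<gamma>) * (of_real (mi_coeff x \<beta>) * D_x \<beta> (D_y \<gamma> g) z))"
        by (subst sum.reindex_bij_betw[OF expansion_indices_Sigma[OF p], symmetric])
          (auto simp: split_beta' mult_ac intro!: sum.cong)
      also have "\<dots> = (\<Sum>\<gamma>\<in>?I. of_real (mi_coeff y \<gamma>) *
          (\<Sum>\<beta> | mi_abs \<beta> < ?r \<gamma>. of_real (mi_coeff x \<beta>) * D_x \<beta> (D_y \<gamma> g) z))"
        by (subst sum.Sigma[symmetric]) (auto simp: finite_mi_abs_less sum_distrib_left)
      finally have *: "(\<Sum>(\<beta>, \<gamma>)\<in>expansion_indices k. of_real (mi_coeff x \<beta> * mi_coeff y \<gamma>) * D_x \<beta> (D_y \<gamma> g) z) =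
          (\<Sum>\<gamma>\<in>?I. of_real (mi_coeff y \<gamma>) *
          (\<Sum>\<beta> | mi_abs \<beta> < ?r \<gamma>. of_real (mi_coeff x \<beta>) * D_x \<beta> (D_y \<gamma> g) z))" .
      have "z - w = z - (x, 0) - (0, y)" by (simp add: w prod_eq_iff)
      thus ?thesis
        unfolding kernel_rem_def by (simp only: w fst_conv snd_conv * right_diff_distrib sum_subtractf) simp
    qed
    have [measurable]: "D_y \<gamma> g \<in> borel_measurable borel" "g \<in> borel_measurable borel"
      "D_x \<beta> (D_y \<gamma> g) \<in> borel_measurable borel" for \<gamma> and \<beta> :: "'m \<Rightarrow> nat"
      using L1_smoothD(3)[OF L1_smooth_D_y[OF g]] L1_smoothD(3)[OF g]
        L1_smoothD(3)[OF L1_smooth_D_x[OF L1_smooth_D_y[OF g]]] by auto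
    have Ry_meas [measurable]: "?Ry y \<in> borel_measurable borel" by measurable
    have Rx_meas [measurable]: "?Rx \<gamma> x \<in> borel_measurable borel" for \<gamma> by measurable
    have "(\<integral>\<^sup>+z. norm (kernel_rem k g w z) \<partial>lborel) \<le>
        (\<integral>\<^sup>+z. ennreal (norm (?Ry y (z - (x, 0)))) + (\<Sum>\<gamma>\<in>?I. ennreal \<bar>mi_coeff y \<gamma>\<bar> * ennreal (norm (?Rx \<gamma> x z))) \<partial>lborel)"
    proof (intro nn_integral_mono)
      fix z
      have "norm (kernel_rem k g w z) \<le> norm (?Ry y (z - (x, 0))) + (\<Sum>\<gamma>\<in>?I. \<bar>mi_coeff y \<gamma>\<bar> * norm (?Rx \<gamma> x z))"
        unfolding expand
        by (intro norm_triangle_le add_left_mono order.trans[OF norm_sum]) (simp add: norm_mult)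
      also have "ennreal \<dots> = ennreal (norm (?Ry y (z - (x, 0)))) + (\<Sum>\<gamma>\<in>?I. ennreal \<bar>mi_coeff y \<gamma>\<bar> * ennreal (norm (?Rx \<gamma> x z)))"
        by (simp add: ennreal_plus sum_nonneg ennreal_mult flip: sum_ennreal)
      finally show "ennreal (norm (kernel_rem k g w z)) \<le>
          ennreal (norm (?Ry y (z - (x, 0)))) + (\<Sum>\<gamma>\<in>?I. ennreal \<bar>mi_coeff y \<gamma>\<bar> * ennreal (norm (?Rx \<gamma> x z)))"
        by (simp add: ennreal_leI)
    qed
    also have "\<dots> = (\<integral>\<^sup>+z. norm (?Ry y (z - (x, 0))) \<partial>lborel) +
        (\<Sum>\<gamma>\<in>?I. ennreal \<bar>mi_coeff y \<gamma>\<bar> * (\<integral>\<^sup>+z. norm (?Rx \<gamma> x z) \<partial>lborel))"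
      using measurable_compose[OF _ Ry_meas, of "\<lambda>z. z - (x, 0)"]
      by (subst nn_integral_add) (auto simp: nn_integral_sum nn_integral_cmult)
    also have "(\<integral>\<^sup>+z. norm (?Ry y (z - (x, 0))) \<partial>lborel) = (\<integral>\<^sup>+z. norm (?Ry y z) \<partial>lborel)"
      by (rule nn_integral_lborel_diff[of "\<lambda>z. ennreal (norm (?Ry y z))"]) measurable
    also have "\<dots> + (\<Sum>\<gamma>\<in>?I. ennreal \<bar>mi_coeff y \<gamma>\<bar> * (\<integral>\<^sup>+z. norm (?Rx \<gamma> x z) \<partial>lborel)) \<le>
        ennreal (A * ?M) + (\<Sum>\<gamma>\<in>?I. ennreal (B \<gamma> * ?M))"
    proof (intro add_mono sum_mono)
      have "A * norm y ^ p \<le> A * ?M"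
        using A(1) by (intro mult_left_mono) auto
      thus "(\<integral>\<^sup>+z. norm (?Ry y z) \<partial>lborel) \<le> ennreal (A * ?M)"
        using A(2)[of y] ennreal_leI order.trans by blast
      fix \<gamma> :: "'n \<Rightarrow> nat" assume "\<gamma> \<in> ?I"
      hence "mi_abs \<gamma> \<le> p" by simp
      have "\<bar>mi_coeff y \<gamma>\<bar> * (B \<gamma> * norm x ^ ?r \<gamma>) \<le> norm y ^ mi_abs \<gamma> * (B \<gamma> * norm x ^ ?r \<gamma>)"
        using B(1)[of \<gamma>] by (intro mult_right_mono abs_mi_coeff_le) auto
      also have "\<dots> = B \<gamma> * (norm x ^ (2 * p - 2 * mi_abs \<gamma>) * norm y ^ mi_abs \<gamma>)"
        using p by simp
      also have "\<dots> \<le> B \<gamma> * ?M"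
        unfolding p using B(1)[of \<gamma>] \<open>mi_abs \<gamma> \<le> p\<close> by (intro mult_left_mono young_power) auto
      finally have *: "\<bar>mi_coeff y \<gamma>\<bar> * (B \<gamma> * norm x ^ ?r \<gamma>) \<le> B \<gamma> * ?M" .
      have "ennreal \<bar>mi_coeff y \<gamma>\<bar> * (\<integral>\<^sup>+z. norm (?Rx \<gamma> x z) \<partial>lborel) \<le>
          ennreal \<bar>mi_coeff y \<gamma>\<bar> * ennreal (B \<gamma> * norm x ^ ?r \<gamma>)"
        by (intro mult_left_mono B) auto
      also have "\<dots> = ennreal (\<bar>mi_coeff y \<gamma>\<bar> * (B \<gamma> * norm x ^ ?r \<gamma>))"
        using B(1)[of \<gamma>] by (intro ennreal_mult[symmetric]) auto
      also have "\<dots> \<le> ennreal (B \<gamma> * ?M)"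
        using * by (rule ennreal_leI)
      finally show "ennreal \<bar>mi_coeff y \<gamma>\<bar> * (\<integral>\<^sup>+z. norm (?Rx \<gamma> x z) \<partial>lborel) \<le> ennreal (B \<gamma> * ?M)" .
    qed
    also have "\<dots> = ennreal (A * ?M) + ennreal (\<Sum>\<gamma>\<in>?I. B \<gamma> * ?M)"
      using B(1) by (subst sum_ennreal) auto
    also have "\<dots> = ennreal ((A + (\<Sum>\<gamma>\<in>?I. B \<gamma>)) * ?M)"
      using A(1) B(1)
      by (subst ennreal_plus[symmetric]) (auto simp: distrib_right sum_distrib_right intro!: sum_nonneg)
    finally show "(\<integral>\<^sup>+z. norm (kernel_rem k g w z) \<partial>lborel) \<le>
      ennreal ((A + (\<Sum>\<gamma>\<in>?I. B \<gamma>)) * (norm (fst w) ^ (k + 1) + norm (snd w) ^ p))"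
      by (simp add: w)
  qed
qed

subsection \<open>Parabolic scaling\<close>

text \<open>Meant for \<open>T = dilate s\<close>, for which each coordinate vector is an
  eigenvector: the chain rule then stays in one direction and only produces the eigenvalue.\<close>

lemma dir_deriv_linear_scale:
  assumes g: "\<And>z. g differentiable (at z)" and T: "bounded_linear T" and e: "T e = a *\<^sub>R e"
  shows "dir_deriv e (\<lambda>z. c * g (T z)) = (\<lambda>z. c * of_real a * dir_deriv e g (T z))"
proof
  fix z
  from g obtain D where D: "(g has_derivative D) (at (T z))"
    by (auto simp: differentiable_def)
  interpret D: bounded_linear D using D by (rule has_derivative_bounded_linear)
  have "((\<lambda>z. c * g (T z)) has_derivative (\<lambda>h. c * D (T h))) (at z)"
    by (intro has_derivative_mult_right has_derivative_compose[OF bounded_linear.has_derivative[OF T has_derivative_ident] D])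
  from dir_deriv_eq[OF this] show "dir_deriv e (\<lambda>z. c * g (T z)) z = c * of_real a * dir_deriv e g (T z)"
    by (simp add: e D.scaleR dir_deriv_eq[OF D] scaleR_conv_of_real)
qed

lemma funpow_dir_deriv_linear_scale:
  assumes "L1_smooth g" "e \<in> Basis" "bounded_linear T" "T e = a *\<^sub>R e"
  shows "(dir_deriv e ^^ n) (\<lambda>z. c * g (T z)) = (\<lambda>z. c * of_real (a ^ n) * (dir_deriv e ^^ n) g (T z))"
proof (induction n)
  case (Suc n)
  have "(dir_deriv e ^^ Suc n) (\<lambda>z. c * g (T z)) = dir_deriv e (\<lambda>z. c * of_real (a ^ n) * (dir_deriv e ^^ n) g (T z))"
    by (simp add: Suc)
  also have "\<dots> = (\<lambda>z. c * of_real (a ^ n) * of_real a * dir_deriv e ((dir_deriv e ^^ n) g) (T z))"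
    by (intro dir_deriv_linear_scale L1_smoothD(1) L1_smooth_funpow assms)
  finally show ?case by (simp add: mult_ac)
qed simp

lemma mixed_deriv_linear_scale:
  assumes "L1_smooth g" "bounded_linear T" "distinct L"
    and "\<And>i. i \<in> set L \<Longrightarrow> b i \<in> Basis" "\<And>i. i \<in> set L \<Longrightarrow> T (b i) = a *\<^sub>R b i"
  shows "mixed_deriv b L \<alpha> (\<lambda>z. c * g (T z)) =
    (\<lambda>z. c * of_real (a ^ sum \<alpha> (set L)) * mixed_deriv b L \<alpha> g (T z))"
  using assms(3-)
proof (induction L)
  case (Cons i L)
  have "mixed_deriv b (i # L) \<alpha> (\<lambda>z. c * g (T z)) =
      (dir_deriv (b i) ^^ \<alpha> i) (mixed_deriv b L \<alpha> (\<lambda>z. c * g (T z)))"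
    by (simp add: mixed_deriv_def)
  also have "\<dots> = (dir_deriv (b i) ^^ \<alpha> i) (\<lambda>z. c * of_real (a ^ sum \<alpha> (set L)) * mixed_deriv b L \<alpha> g (T z))"
    using Cons by simp
  also have "\<dots> = (\<lambda>z. c * of_real (a ^ sum \<alpha> (set L)) * of_real (a ^ \<alpha> i) *
      (dir_deriv (b i) ^^ \<alpha> i) (mixed_deriv b L \<alpha> g) (T z))"
    using Cons.prems by (intro funpow_dir_deriv_linear_scale L1_smooth_mixed_deriv assms(1,2)) auto
  finally show ?case
    using Cons.prems by (simp add: mixed_deriv_def power_add mult_ac)
qed (simp add: mixed_deriv_def)

lemma nn_integral_lborel_scale:
  fixes f :: "'a::euclidean_space \<Rightarrow> ennreal"
  assumes [measurable]: "f \<in> borel_measurable borel" and "c \<noteq> 0"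
  shows "(\<integral>\<^sup>+x. f x \<partial>lborel) = ennreal (\<bar>c\<bar> ^ DIM('a)) * (\<integral>\<^sup>+x. f (c *\<^sub>R x) \<partial>lborel)"
proof -
  have "(\<integral>\<^sup>+x. f x \<partial>lborel) =
      (\<integral>\<^sup>+x. f x \<partial>density (distr lborel borel (\<lambda>x. 0 + c *\<^sub>R x)) (\<lambda>_. \<bar>c\<bar> ^ DIM('a)))"
    using lborel_affine[OF assms(2), of 0] by (rule arg_cong[of _ _ "\<lambda>M. integral\<^sup>N M f"])
  also have "\<dots> = ennreal (\<bar>c\<bar> ^ DIM('a)) * (\<integral>\<^sup>+x. f (c *\<^sub>R x) \<partial>lborel)"
    by (subst nn_integral_density) (auto simp: nn_integral_distr nn_integral_cmult)
  finally show ?thesis .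
qed

text \<open>With \<open>s = t powr (1 / 4)\<close> a single parameter carries both exponents of
  \<open>G\<close>, since s^2 is \<open>t powr (1 / 2)\<close>.\<close>

definition dilate :: "real \<Rightarrow> 'a::real_normed_vector \<times> 'b::real_normed_vector \<Rightarrow> 'a \<times> 'b" where
  "dilate s z = (fst z /\<^sub>R s, snd z /\<^sub>R s\<^sup>2)"

lemma bounded_linear_dilate: "bounded_linear (dilate s)"
  unfolding dilate_def
  by (intro bounded_linear_Pair bounded_linear_compose[OF bounded_linear_scaleR_right]
      bounded_linear_fst bounded_linear_snd)

lemma continuous_on_dilate [continuous_intros]:
  "continuous_on S f \<Longrightarrow> continuous_on S (\<lambda>x. dilate s (f x))"
  unfolding dilate_def by (intro continuous_intros)

lemma dilate_diff: "dilate s (z - w) = dilate s z - dilate s w"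
  by (rule linear_diff[OF bounded_linear.linear[OF bounded_linear_dilate]])

text \<open>The factor is the Jacobian of \<open>dilate s\<close> and also the prefactor of
  \<open>G t\<close>; hence the rescaling that relates time \<open>t\<close> to time 1 preserves L^1
  norms.\<close>

lemma nn_integral_dilate:
  fixes f :: "'a::euclidean_space \<times> 'b::euclidean_space \<Rightarrow> ennreal"
  assumes [measurable]: "f \<in> borel_measurable borel" and s: "s > 0"
  shows "(\<integral>\<^sup>+z. ennreal (inverse s ^ DIM('a) * inverse (s\<^sup>2) ^ DIM('b)) * f (dilate s z) \<partial>lborel) = (\<integral>\<^sup>+z. f z \<partial>lborel)"
proof -
  have [measurable]: "f \<in> borel_measurable (borel \<Otimes>\<^sub>M borel)" unfolding borel_prod by fact
  have [measurable]: "dilate s \<in> borel_measurable borel"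
    by (intro borel_measurable_continuous_onI continuous_intros)
  have "(\<integral>\<^sup>+z. f z \<partial>lborel) = (\<integral>\<^sup>+x. \<integral>\<^sup>+y. f (x, y) \<partial>lborel \<partial>lborel)"
    unfolding lborel_prod[symmetric] by (rule lborel.nn_integral_fst[symmetric]) measurable
  also have "\<dots> = (\<integral>\<^sup>+x. ennreal (inverse (s\<^sup>2) ^ DIM('b)) * (\<integral>\<^sup>+y. f (x, y /\<^sub>R s\<^sup>2) \<partial>lborel) \<partial>lborel)"
    using s by (intro nn_integral_cong, subst nn_integral_lborel_scale[where c = "inverse (s\<^sup>2)"]) auto
  also have "\<dots> = ennreal (inverse s ^ DIM('a)) *
      (\<integral>\<^sup>+x. ennreal (inverse (s\<^sup>2) ^ DIM('b)) * (\<integral>\<^sup>+y. f (x /\<^sub>R s, y /\<^sub>R s\<^sup>2) \<partial>lborel) \<partial>lborel)"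
    using s by (subst nn_integral_lborel_scale[where c = "inverse s"]) auto
  also have "\<dots> = ennreal (inverse s ^ DIM('a) * inverse (s\<^sup>2) ^ DIM('b)) *
      (\<integral>\<^sup>+x. \<integral>\<^sup>+y. f (x /\<^sub>R s, y /\<^sub>R s\<^sup>2) \<partial>lborel \<partial>lborel)"
    using s by (simp add: nn_integral_cmult ennreal_mult mult.assoc)
  also have "(\<integral>\<^sup>+x. \<integral>\<^sup>+y. f (x /\<^sub>R s, y /\<^sub>R s\<^sup>2) \<partial>lborel \<partial>lborel) = (\<integral>\<^sup>+z. f (dilate s z) \<partial>lborel)"
    unfolding lborel_prod[symmetric] dilate_def
    by (subst lborel.nn_integral_fst[symmetric]) auto
  finally show ?thesis by (subst nn_integral_cmult) auto
qed

lemma G_eq_dilate: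
  fixes z :: "(real ^ 'm::finite) \<times> (real ^ 'n::finite)"
  assumes "t > 0"
  defines "s \<equiv> t powr (1 / 4)"
  shows "G t z = of_real (inverse s ^ CARD('m) * inverse (s\<^sup>2) ^ CARD('n)) * G1 (dilate s z)"
proof -
  have s2: "s\<^sup>2 = t powr (1 / 2)"
    unfolding s_def using assms(1) by (simp add: powr_realpow[symmetric] powr_powr del: powr_realpow)
  have "t powr (- real CARD('m) / 4 - real CARD('n) / 2) =
      (t powr (1 / 4)) powr (- real CARD('m)) * (t powr (1 / 2)) powr (- real CARD('n))"
    by (simp add: powr_powr powr_add[symmetric])
  also have "\<dots> = inverse s ^ CARD('m) * inverse (s\<^sup>2) ^ CARD('n)"
    unfolding s2 unfolding s_def using assms(1)
    by (simp add: powr_minus powr_realpow power_inverse)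
  finally have "G t z = of_real (inverse s ^ CARD('m) * inverse (s\<^sup>2) ^ CARD('n)) *
      G1 (fst z /\<^sub>R t powr (1 / 4), snd z /\<^sub>R t powr (1 / 2))"
    by (simp only: G_def split_beta)
  thus ?thesis
    unfolding dilate_def s2 unfolding s_def .
qed

text \<open>A derivative of \<open>G t\<close> gains 1/s for each order in \<open>x\<close> and
  1/s^2 for each order in \<open>y\<close>. These are exactly the powers by which the monomials in
  \<open>w\<close> change under \<open>dilate s\<close>, so only the prefactor remains.\<close>

lemma kernel_rem_G:
  fixes w z :: "(real ^ 'm::finite) \<times> (real ^ 'n::finite)"
  assumes "t > 0"
  defines "s \<equiv> t powr (1 / 4)"
  shows "kernel_rem k (G t) w z = of_real (inverse s ^ CARD('m) * inverse (s\<^sup>2) ^ CARD('n)) *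
    kernel_rem k G1 (dilate s w) (dilate s z)"
proof -
  let ?c = "complex_of_real (inverse s ^ CARD('m) * inverse (s\<^sup>2) ^ CARD('n))"
  have D_y: "D_y \<gamma> (G t) = (\<lambda>z :: (real ^ 'm) \<times> (real ^ 'n). ?c * of_real (inverse (s\<^sup>2) ^ mi_abs \<gamma>) * D_y \<gamma> G1 (dilate s z))"
    for \<gamma> :: "'n \<Rightarrow> nat"
  proof -
    have G: "G t = (\<lambda>z :: (real ^ 'm) \<times> (real ^ 'n). ?c * G1 (dilate s z))"
      unfolding s_def by (intro ext G_eq_dilate assms(1))
    show ?thesis
      unfolding D_y_eq G mi_abs_def enum_indices(2)[symmetric]
      by (intro mixed_deriv_linear_scale L1_smooth_G1 bounded_linear_dilate enum_indices axis_Basis)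
        (simp add: dilate_def)
  qed
  have D: "D_x \<beta> (D_y \<gamma> (G t)) z = ?c * of_real (inverse (s\<^sup>2) ^ mi_abs \<gamma>) * of_real (inverse s ^ mi_abs \<beta>) *
      D_x \<beta> (D_y \<gamma> G1) (dilate s z)" for \<beta> :: "'m \<Rightarrow> nat" and \<gamma> :: "'n \<Rightarrow> nat"
  proof -
    have "D_x \<beta> (D_y \<gamma> (G t)) = (\<lambda>z :: (real ^ 'm) \<times> (real ^ 'n). ?c * of_real (inverse (s\<^sup>2) ^ mi_abs \<gamma>) * of_real (inverse s ^ mi_abs \<beta>) *
        D_x \<beta> (D_y \<gamma> G1) (dilate s z))"
      unfolding D_y D_x_eq mi_abs_def[of \<beta>] enum_indices(2)[symmetric]
      by (intro mixed_deriv_linear_scale L1_smooth_D_y L1_smooth_G1 bounded_linear_dilate enum_indices axis_Basis)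
        (simp add: dilate_def)
    thus ?thesis by simp
  qed
  show ?thesis
    unfolding kernel_rem_def right_diff_distrib sum_distrib_left G_eq_dilate[OF assms(1)] D s_def[symmetric]
    by (intro arg_cong2[of _ _ _ _ "(-)"] sum.cong)
      (simp only: dilate_diff, auto simp: dilate_def mi_coeff_scaleR)
qed

lemma continuous_kernel_rem:
  fixes g :: "(real ^ 'm::finite) \<times> (real ^ 'n::finite) \<Rightarrow> complex"
  assumes "L1_smooth g" "continuous_on UNIV v" "continuous_on UNIV u"
  shows "continuous_on UNIV (\<lambda>x. kernel_rem k g (v x) (u x))"
  unfolding kernel_rem_def split_beta'
  by (intro continuous_intros assms(2,3) continuous_on_compose2[OF L1_smoothD(2)[OF assms(1)]]
      continuous_on_compose2[OF L1_smoothD(2)[OF L1_smooth_D_x[OF L1_smooth_D_y[OF assms(1)]]]]) auto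

lemma continuous_kernel_rem_G:
  assumes "t > 0" "continuous_on UNIV v" "continuous_on UNIV u"
  shows "continuous_on UNIV (\<lambda>x. kernel_rem k (G t) (v x) (u x))"
  unfolding kernel_rem_G[OF assms(1)]
  by (intro continuous_intros continuous_kernel_rem L1_smooth_G1 assms(2,3))

text \<open>The prefactor is absorbed by the change of variables in \<open>z\<close>. What remains
  is |x|^(k+1) + |y|^p at the dilated \<open>w\<close>; as k + 1 = 2p both terms scale by s^-(k+1),
  the announced power of \<open>t\<close>.\<close>

lemma kernel_rem_G_L1_bound:
  assumes p: "k + 1 = 2 * p"
  shows "\<exists>C\<ge>0. \<forall>t>0. \<forall>w :: (real ^ 'm::finite) \<times> (real ^ 'n::finite).
    (\<integral>\<^sup>+z. norm (kernel_rem k (G t) w z) \<partial>lborel) \<le>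
      ennreal (C * t powr (- (real k + 1) / 4) * (norm (fst w) ^ (k + 1) + norm (snd w) ^ p))"
proof -
  obtain C where C: "0 \<le> C" "\<And>w :: (real ^ 'm) \<times> (real ^ 'n).
      (\<integral>\<^sup>+z. norm (kernel_rem k G1 w z) \<partial>lborel) \<le> ennreal (C * (norm (fst w) ^ (k + 1) + norm (snd w) ^ p))"
    using kernel_rem_L1_bound[OF L1_smooth_G1 p] by blast
  show ?thesis
  proof (intro exI[of _ C] conjI allI impI C(1))
    fix t :: real and w :: "(real ^ 'm) \<times> (real ^ 'n)"
    assume "t > 0"
    define s where "s = t powr (1 / 4)"
    have "s > 0" using \<open>t > 0\<close> by (simp add: s_def)
    have [measurable]: "kernel_rem k G1 (dilate s w) \<in> borel_measurable borel"
      by (intro borel_measurable_continuous_onI continuous_kernel_rem L1_smooth_G1 continuous_intros)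
    have "(\<integral>\<^sup>+z. norm (kernel_rem k (G t) w z) \<partial>lborel) =
        (\<integral>\<^sup>+z. ennreal (inverse s ^ DIM(real ^ 'm) * inverse (s\<^sup>2) ^ DIM(real ^ 'n)) *
          ennreal (norm (kernel_rem k G1 (dilate s w) (dilate s z))) \<partial>lborel)"
      using \<open>s > 0\<close> unfolding kernel_rem_G[OF \<open>t > 0\<close>] s_def[symmetric]
      by (intro nn_integral_cong) (simp add: norm_mult norm_power norm_inverse ennreal_mult)
    also have "\<dots> = (\<integral>\<^sup>+z. norm (kernel_rem k G1 (dilate s w) z) \<partial>lborel)"
      using \<open>s > 0\<close> by (intro nn_integral_dilate) auto
    also have "\<dots> \<le> ennreal (C * (norm (fst (dilate s w)) ^ (k + 1) + norm (snd (dilate s w)) ^ p))"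
      by (rule C(2))
    also have "norm (fst (dilate s w)) ^ (k + 1) + norm (snd (dilate s w)) ^ p =
        inverse s ^ (k + 1) * (norm (fst w) ^ (k + 1) + norm (snd w) ^ p)"
      using \<open>s > 0\<close> unfolding p
      by (simp add: dilate_def power_mult_distrib power_mult[symmetric] power_inverse distrib_left)
    also have "inverse s ^ (k + 1) = t powr (- (real k + 1) / 4)"
    proof -
      have "t powr (- (real k + 1) / 4) = s powr (- real (k + 1))"
        by (simp add: s_def powr_powr algebra_simps)
      also have "\<dots> = inverse s ^ (k + 1)"
        using \<open>s > 0\<close> by (simp only: powr_minus powr_realpow power_inverse)
      finally show ?thesis ..
    qed
    finally show "(\<integral>\<^sup>+z. norm (kernel_rem k (G t) w z) \<partial>lborel) \<le>
      ennreal (C * t powr (- (real k + 1) / 4) * (norm (fst w) ^ (k + 1) + norm (snd w) ^ p))"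
      by (simp add: mult.assoc)
  qed
qed

subsection \<open>Convolution with the datum\<close>

text \<open>Required for Fubini over the completed measure, since \<open>f\<close> is only Lebesgue
  measurable. A countable cover for \<open>lborel\<close> works unchanged.\<close>

lemma sigma_finite_lebesgue: "sigma_finite_measure (lebesgue :: 'a::euclidean_space measure)"
proof
  have "\<exists>A :: 'a set set. countable A \<and> A \<subseteq> sets lborel \<and> \<Union>A = space lborel \<and>
      (\<forall>a\<in>A. emeasure lborel a \<noteq> \<infinity>)"
    by (rule sigma_finite_measure.sigma_finite_countable[OF sigma_finite_lborel])
  then obtain A :: "'a set set" where A: "countable A" "A \<subseteq> sets lborel" "\<Union>A = space lborel"
    "\<forall>a\<in>A. emeasure lborel a \<noteq> \<infinity>" by (elim exE conjE)
  show "\<exists>A :: 'a set set. countable A \<and> A \<subseteq> sets lebesgue \<and> \<Union>A = space lebesgue \<and>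
      (\<forall>a\<in>A. emeasure lebesgue a \<noteq> \<infinity>)"
  proof (intro exI[of _ A] conjI ballI)
    show "A \<subseteq> sets lebesgue" "\<Union>A = space lebesgue" "countable A"
      using A(1-3) by (auto intro: sets_completionI_sets)
    fix a assume "a \<in> A"
    with A(2) have "a \<in> sets lborel" by blast
    hence "emeasure lebesgue a = emeasure lborel a" by simp
    thus "emeasure lebesgue a \<noteq> \<infinity>" using A(4) \<open>a \<in> A\<close> by metis
  qed
qed

text \<open>Guarantees that all moments in the expansion converge. The x-exponent is first raised to
  2p - 2j, where j is the degree of \<open>\<gamma>\<close>, at the price of an additive 1; then
  \<open>young_power\<close> applies.\<close>

lemma abs_mi_coeff_le_weight:
  assumes "k + 1 = 2 * p" "(\<beta>, \<gamma>) \<in> expansion_indices k"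
  shows "\<bar>mi_coeff (fst w) \<beta> * mi_coeff (snd w) \<gamma>\<bar> \<le> 2 * weight k w"
proof -
  let ?a = "norm (fst w)" and ?b = "norm (snd w)"
  let ?i = "mi_abs \<beta>" and ?j = "mi_abs \<gamma>"
  have ij: "?i \<le> 2 * p - 2 * ?j" "?j \<le> p"
    using assms by (auto simp: expansion_indices_def)
  have one: "x ^ m \<le> 1 + x ^ n" if "0 \<le> x" "m \<le> n" for x :: real and m n
  proof (cases "x \<le> 1")
    case True
    thus ?thesis using that power_le_one[of x m] by (simp add: add_increasing2)
  next
    case False
    hence "x ^ m \<le> x ^ n" using that by (intro power_increasing) auto
    thus ?thesis by simp
  qed
  have "\<bar>mi_coeff (fst w) \<beta> * mi_coeff (snd w) \<gamma>\<bar> \<le> ?a ^ ?i * ?b ^ ?j"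
    unfolding abs_mult by (intro mult_mono abs_mi_coeff_le) auto
  also have "\<dots> \<le> (1 + ?a ^ (2 * p - 2 * ?j)) * ?b ^ ?j"
    using ij by (intro mult_right_mono one) auto
  also have "\<dots> = ?b ^ ?j + ?a ^ (2 * p - 2 * ?j) * ?b ^ ?j"
    by (simp add: distrib_right)
  also have "\<dots> \<le> (1 + ?b ^ p) + (?a ^ (2 * p) + ?b ^ p)"
    using ij by (intro add_mono one young_power) auto
  also have "\<dots> \<le> 2 * (1 + ?a ^ (2 * p) + ?b ^ p)"
    by simp
  also have "1 + ?a ^ (2 * p) + ?b ^ p = weight k w"
    using assms(1) by (simp add: weight_def split_beta)
  finally show ?thesis .
qed

text \<open>A continuous function on the product space is measurable for the product of the Borel
  sigma-algebras, and each of these is contained in the Lebesgue one.\<close>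

lemma measurable_lebesgue_pair:
  assumes "continuous_on UNIV h"
  shows "h \<in> borel_measurable (lebesgue \<Otimes>\<^sub>M lebesgue)"
proof -
  have h: "h \<in> borel_measurable (borel \<Otimes>\<^sub>M borel)"
    unfolding borel_prod by (rule borel_measurable_continuous_onI[OF assms])
  have [measurable]: "(\<lambda>x. x) \<in> lebesgue \<rightarrow>\<^sub>M borel"
    by (rule measurable_completion) simp
  have "(\<lambda>x. (fst x, snd x)) \<in> lebesgue \<Otimes>\<^sub>M lebesgue \<rightarrow>\<^sub>M borel \<Otimes>\<^sub>M borel"
    by (intro measurable_Pair measurable_compose[OF measurable_fst] measurable_compose[OF measurable_snd]) auto
  from measurable_compose[OF this h] show ?thesis
    unfolding prod.collapse .
qed

lemma G_bounded:
  assumes "t > 0"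
  shows "\<exists>B. \<forall>z :: (real ^ 'm::finite) \<times> (real ^ 'n::finite). norm (G t z) \<le> B"
proof -
  obtain B where B: "\<And>z :: (real ^ 'm) \<times> (real ^ 'n). norm (G1 z) \<le> B"
    using G1_bounded by blast
  let ?c = "complex_of_real (inverse (t powr (1 / 4)) ^ CARD('m) * inverse ((t powr (1 / 4))\<^sup>2) ^ CARD('n))"
  have "norm (G t z) \<le> norm ?c * B" for z :: "(real ^ 'm) \<times> (real ^ 'n)"
    unfolding G_eq_dilate[OF assms] norm_mult[of ?c] by (intro mult_left_mono B) auto
  thus ?thesis by blast
qed

lemma weight_ge_1: "1 \<le> weight k w"
  by (simp add: weight_def split_beta)

lemma weight_nonneg: "0 \<le> weight k w"
  using weight_ge_1[of k w] by linarith

text \<open>This is linearity of the integral, but a Bochner integral defaults to 0, so each piece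
  must be shown integrable first: the kernel because it is bounded and the weight is at least 1, the
  monomials by \<open>abs_mi_coeff_le_weight\<close>.\<close>

lemma sol_minus_expansion:
  fixes f :: "(real ^ 'm::finite) \<times> (real ^ 'n::finite) \<Rightarrow> complex"
  assumes f: "f \<in> weighted_L1 (weight k)" and p: "k + 1 = 2 * p" and t: "t > 0"
  shows "sol f z t - expansion k f z t = (LINT w|lebesgue. kernel_rem k (G t) w z * f w)"
proof -
  have f_meas [measurable]: "f \<in> borel_measurable lebesgue"
    and f_int: "integrable lebesgue (\<lambda>w. norm (f w) * weight k w)"
    using f by (auto simp: weighted_L1_def)
  have int: "integrable lebesgue (\<lambda>w. h w * f w)"
    if h: "continuous_on UNIV h" "\<And>w. norm (h w) \<le> B * weight k w" for h :: "_ \<Rightarrow> complex" and B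
  proof (rule Bochner_Integration.integrable_bound)
    show "integrable lebesgue (\<lambda>w. B * (norm (f w) * weight k w))"
      using f_int by simp
    have "h \<in> borel_measurable lebesgue"
      using h(1) by (intro measurable_completion) (simp add: borel_measurable_continuous_onI)
    thus "(\<lambda>w. h w * f w) \<in> borel_measurable lebesgue" by measurable
    show "AE w in lebesgue. norm (h w * f w) \<le> norm (B * (norm (f w) * weight k w))"
    proof (intro AE_I2)
      fix w
      have "norm (h w * f w) \<le> (B * weight k w) * norm (f w)"
        unfolding norm_mult by (intro mult_right_mono h) auto
      also have "\<dots> \<le> norm (B * (norm (f w) * weight k w))"
        by (simp add: mult_ac)
      finally show "norm (h w * f w) \<le> norm (B * (norm (f w) * weight k w))" .
    qed
  qed
  obtain B where B: "\<And>z :: (real ^ 'm) \<times> (real ^ 'n). norm (G t z) \<le> B"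
    using G_bounded[OF t] by blast
  have "0 \<le> B" using B[of 0] norm_ge_zero order.trans by blast
  have cont_G: "continuous_on UNIV (\<lambda>w. G t (z - w))"
    unfolding G_eq_dilate[OF t]
    by (intro continuous_intros continuous_on_compose2[OF L1_smoothD(2)[OF L1_smooth_G1]]) auto
  have int_G: "integrable lebesgue (\<lambda>w. G t (z - w) * f w)"
  proof (rule int[OF cont_G])
    fix w :: "(real ^ 'm) \<times> (real ^ 'n)"
    have "B * 1 \<le> B * weight k w" using \<open>0 \<le> B\<close> by (intro mult_left_mono weight_ge_1)
    thus "norm (G t (z - w)) \<le> B * weight k w" using B[of "z - w"] by linarith
  qed
  let ?m = "\<lambda>\<beta> \<gamma> w. complex_of_real (mi_coeff (fst w) \<beta> * mi_coeff (snd w) \<gamma>)"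
  let ?D = "\<lambda>\<beta> \<gamma>. D_x \<beta> (D_y \<gamma> (G t)) z"
  have int_m: "integrable lebesgue (\<lambda>w. ?m \<beta> \<gamma> w * f w)" if "(\<beta>, \<gamma>) \<in> expansion_indices k" for \<beta> \<gamma>
    using abs_mi_coeff_le_weight[OF p that]
    by (intro int[where B = 2] continuous_intros) (simp only: norm_of_real)
  have term_eq: "(-1) ^ (mi_abs \<beta> + mi_abs \<gamma>) / of_nat (mi_fact \<beta> * mi_fact \<gamma>) * moment f \<beta> \<gamma> =
      (LINT w|lebesgue. ?m \<beta> \<gamma> w * f w)" for \<beta> \<gamma>
    unfolding moment_def
    by (subst integral_mult_right_zero[symmetric], intro Bochner_Integration.integral_cong refl)
      (simp add: mi_coeff_def power_add)
  have "expansion k f z t = (\<Sum>(\<beta>, \<gamma>)\<in>expansion_indices k. (LINT w|lebesgue. ?m \<beta> \<gamma> w * f w) * ?D \<beta> \<gamma>)"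
    unfolding expansion_def expansion_indices_def term_eq ..
  also have "\<dots> = (\<Sum>(\<beta>, \<gamma>)\<in>expansion_indices k. (LINT w|lebesgue. ?m \<beta> \<gamma> w * ?D \<beta> \<gamma> * f w))"
  proof -
    have "(LINT w|lebesgue. M w * f w) * d = (LINT w|lebesgue. M w * d * f w)" for M d
      by (subst integral_mult_left_zero[symmetric]) (simp add: mult_ac)
    thus ?thesis by simp
  qed
  also have "\<dots> = (LINT w|lebesgue. (\<Sum>(\<beta>, \<gamma>)\<in>expansion_indices k. ?m \<beta> \<gamma> w * ?D \<beta> \<gamma> * f w))"
    unfolding split_beta'
  proof (rule Bochner_Integration.integral_sum[symmetric])
    fix i :: "('m \<Rightarrow> nat) \<times> ('n \<Rightarrow> nat)" assume "i \<in> expansion_indices k"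
    hence "integrable lebesgue (\<lambda>w. ?D (fst i) (snd i) * (?m (fst i) (snd i) w * f w))"
      by (intro integrable_mult_right int_m) simp
    thus "integrable lebesgue (\<lambda>w. ?m (fst i) (snd i) w * ?D (fst i) (snd i) * f w)"
      by (simp add: mult_ac)
  qed
  finally have "sol f z t - expansion k f z t = (LINT w|lebesgue. G t (z - w) * f w) -
      (LINT w|lebesgue. (\<Sum>(\<beta>, \<gamma>)\<in>expansion_indices k. ?m \<beta> \<gamma> w * ?D \<beta> \<gamma> * f w))"
    by (simp add: sol_def Defs.convolution_def)
  also have "\<dots> = (LINT w|lebesgue. G t (z - w) * f w -
      (\<Sum>(\<beta>, \<gamma>)\<in>expansion_indices k. ?m \<beta> \<gamma> w * ?D \<beta> \<gamma> * f w))"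
  proof (rule Bochner_Integration.integral_diff[OF int_G, symmetric])
    show "integrable lebesgue (\<lambda>w. \<Sum>(\<beta>, \<gamma>)\<in>expansion_indices k. ?m \<beta> \<gamma> w * ?D \<beta> \<gamma> * f w)"
      unfolding split_beta'
    proof (rule Bochner_Integration.integrable_sum)
      fix i :: "('m \<Rightarrow> nat) \<times> ('n \<Rightarrow> nat)" assume "i \<in> expansion_indices k"
      hence "integrable lebesgue (\<lambda>w. ?D (fst i) (snd i) * (?m (fst i) (snd i) w * f w))"
        by (intro integrable_mult_right int_m) simp
      thus "integrable lebesgue (\<lambda>w. ?m (fst i) (snd i) w * ?D (fst i) (snd i) * f w)"
        by (simp add: mult_ac)
    qed
  qed
  also have "\<dots> = (LINT w|lebesgue. kernel_rem k (G t) w z * f w)"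
    unfolding kernel_rem_def left_diff_distrib sum_distrib_right split_beta' ..
  finally show ?thesis .
qed

section \<open>The L^1 estimate for general data\<close>

theorem theorem1p1:
  fixes k :: nat
  assumes "k > 0" and "odd k"
  shows "\<exists>C>0. \<forall>f :: (real ^ 'm::finite) \<times> (real ^ 'n::finite) \<Rightarrow> complex.
           f \<in> weighted_L1 (weight k) \<longrightarrow>
           (\<forall>t>0. integrable lebesgue (\<lambda>z. sol f z t - expansion k f z t) \<and>
                  L1_norm (\<lambda>z. sol f z t - expansion k f z t)
                    \<le> C * t powr (- (real k + 1) / 4) * L1_norm (\<lambda>z. weight k z *\<^sub>R f z))"
proof -
  define p where "p = (k + 1) div 2"
  have p: "k + 1 = 2 * p" using assms(2) by (simp add: p_def)
  obtain C where C: "0 \<le> C" "\<And>t (w :: (real ^ 'm) \<times> (real ^ 'n)). 0 < t \<Longrightarrow>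
      (\<integral>\<^sup>+z. norm (kernel_rem k (G t) w z) \<partial>lborel) \<le>
        ennreal (C * t powr (- (real k + 1) / 4) * (norm (fst w) ^ (k + 1) + norm (snd w) ^ p))"
    using kernel_rem_G_L1_bound[OF p] by blast
  interpret lebesgue_pair: pair_sigma_finite
    "lebesgue :: ((real ^ 'm) \<times> (real ^ 'n)) measure" "lebesgue :: ((real ^ 'm) \<times> (real ^ 'n)) measure"
    by (intro pair_sigma_finite.intro sigma_finite_lebesgue)
  show ?thesis
  \<comment> \<open>The kernel estimate only gives a nonnegative \<open>C\<close>; adding 1 makes
    the constant positive.\<close>
  proof (intro exI[of _ "C + 1"] conjI allI impI)
    show "0 < C + 1" using C(1) by simp
    fix f :: "(real ^ 'm) \<times> (real ^ 'n) \<Rightarrow> complex" and t :: real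
    assume f: "f \<in> weighted_L1 (weight k)" and t: "0 < t"
    have f_meas [measurable]: "f \<in> borel_measurable lebesgue"
      and f_int: "integrable lebesgue (\<lambda>w. norm (f w) * weight k w)"
      using f by (auto simp: weighted_L1_def)
    let ?u = "\<lambda>z. sol f z t - expansion k f z t"
    let ?K = "\<lambda>z w. kernel_rem k (G t) w z"
    define A where "A = C * t powr (- (real k + 1) / 4)"
    define H where "H = L1_norm (\<lambda>z. weight k z *\<^sub>R f z)"
    have H: "H = (LINT w|lebesgue. norm (f w) * weight k w)"
      by (simp add: H_def L1_norm_def mult.commute weight_nonneg)
    have "0 \<le> A" using C(1) by (simp add: A_def)
    have u_eq: "?u z = (LINT w|lebesgue. ?K z w * f w)" for z
      by (rule sol_minus_expansion[OF f p t])
    have "continuous_on UNIV (\<lambda>x. ?K (fst x) (snd x))"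
      by (intro continuous_kernel_rem_G t continuous_intros)
    hence K_meas [measurable]: "(\<lambda>x. ?K (fst x) (snd x)) \<in> borel_measurable (lebesgue \<Otimes>\<^sub>M lebesgue)"
      by (rule measurable_lebesgue_pair)
    have Kf_meas [measurable]: "(\<lambda>x. ?K (fst x) (snd x) * f (snd x)) \<in> borel_measurable (lebesgue \<Otimes>\<^sub>M lebesgue)"
      by measurable
    have u_meas: "?u \<in> borel_measurable lebesgue"
      unfolding u_eq
      by (rule sigma_finite_measure.borel_measurable_lebesgue_integral[OF sigma_finite_lebesgue]) (use Kf_meas in \<open>simp add: split_beta'\<close>)
    have bound: "(\<integral>\<^sup>+z. norm (?u z) \<partial>lebesgue) \<le> ennreal (A * H)"
    proof -
      have "(\<integral>\<^sup>+z. norm (?u z) \<partial>lebesgue) \<le> (\<integral>\<^sup>+z. \<integral>\<^sup>+w. norm (?K z w * f w) \<partial>lebesgue \<partial>lebesgue)"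
      proof (intro nn_integral_mono)
        fix z
        \<comment> \<open>If the integrand is not integrable, the Bochner integral on the left is 0
          by default and the inequality is trivial.\<close>
        show "ennreal (norm (?u z)) \<le> (\<integral>\<^sup>+w. norm (?K z w * f w) \<partial>lebesgue)"
          unfolding u_eq
          by (cases "integrable lebesgue (\<lambda>w. ?K z w * f w)")
            (simp_all add: integral_norm_bound_ennreal not_integrable_integral_eq)
      qed
      also have "\<dots> = (\<integral>\<^sup>+w. \<integral>\<^sup>+z. norm (?K z w * f w) \<partial>lebesgue \<partial>lebesgue)"
        by (rule lebesgue_pair.Fubini'[symmetric]) (use Kf_meas in \<open>simp add: split_beta'\<close>)
      also have "\<dots> \<le> (\<integral>\<^sup>+w. ennreal (A * (norm (f w) * weight k w)) \<partial>lebesgue)"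
      proof (intro nn_integral_mono)
        fix w :: "(real ^ 'm) \<times> (real ^ 'n)"
        \<comment> \<open>For fixed \<open>w\<close> the kernel is continuous in \<open>z\<close>,
          so the inner integral may be taken over \<open>lborel\<close>, where \<open>C(2)\<close>
          is stated.\<close>
        have [measurable]: "kernel_rem k (G t) w \<in> borel_measurable borel"
          by (intro borel_measurable_continuous_onI continuous_kernel_rem_G t continuous_intros)
        have "(\<integral>\<^sup>+z. norm (?K z w * f w) \<partial>lebesgue) = (\<integral>\<^sup>+z. norm (?K z w) * ennreal (norm (f w)) \<partial>lborel)"
          by (simp add: nn_integral_completion norm_mult ennreal_mult)
        also have "\<dots> = (\<integral>\<^sup>+z. norm (?K z w) \<partial>lborel) * ennreal (norm (f w))"
          by (rule nn_integral_multc) measurable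
        also have "\<dots> \<le> ennreal (A * weight k w) * ennreal (norm (f w))"
        proof (intro mult_right_mono)
          have "A * (norm (fst w) ^ (k + 1) + norm (snd w) ^ p) \<le> A * weight k w"
            using \<open>0 \<le> A\<close> by (intro mult_left_mono) (auto simp: weight_def split_beta p_def)
          thus "(\<integral>\<^sup>+z. norm (?K z w) \<partial>lborel) \<le> ennreal (A * weight k w)"
            using C(2)[OF t, of w] unfolding A_def by (meson ennreal_leI order.trans)
        qed auto
        also have "\<dots> = ennreal (A * (norm (f w) * weight k w))"
          using \<open>0 \<le> A\<close> weight_nonneg[of k w]
          by (subst ennreal_mult[symmetric]) (auto simp: mult_ac)
        finally show "(\<integral>\<^sup>+z. norm (?K z w * f w) \<partial>lebesgue) \<le> ennreal (A * (norm (f w) * weight k w))" .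
      qed
      also have "\<dots> = ennreal (LINT w|lebesgue. A * (norm (f w) * weight k w))"
        using f_int \<open>0 \<le> A\<close>
        by (intro nn_integral_eq_integral integrable_mult_right AE_I2 mult_nonneg_nonneg weight_nonneg) auto
      finally show ?thesis by (simp add: H)
    qed
    \<comment> \<open>The finite bound on the nonnegative integral gives integrability, which makes
      \<open>L1_norm ?u\<close> a genuine norm instead of the default value 0.\<close>
    show int: "integrable lebesgue ?u"
      by (rule integrableI_bounded[OF u_meas]) (rule le_less_trans[OF bound], simp)
    have "0 \<le> H" by (simp add: H_def L1_norm_def)
    have "ennreal (L1_norm ?u) \<le> ennreal (A * H)"
      using bound nn_integral_eq_integral[OF integrable_norm[OF int]] by (simp add: L1_norm_def)
    hence "L1_norm ?u \<le> A * H"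
      using \<open>0 \<le> A\<close> \<open>0 \<le> H\<close> by (simp add: ennreal_le_iff)
    also have "\<dots> \<le> (C + 1) * t powr (- (real k + 1) / 4) * H"
      unfolding A_def using \<open>0 \<le> H\<close> by (intro mult_right_mono) auto
    finally show "L1_norm ?u \<le> (C + 1) * t powr (- (real k + 1) / 4) * L1_norm (\<lambda>z. weight k z *\<^sub>R f z)"
      unfolding H_def .
  qed
qed

end
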